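(* Let $b^R\equiv0$ and $b^T(x)\equiv b$ with $b>0$ a constant. Let $\gamma:[0,\infty)\to(0,\infty)$ be a continuous (differentiable) function satisfying $\gamma'<1$ and $\lim_{x\to\infty}(x-\gamma(x))=\infty$. Consider the diffusion with the two-phase drift determined by $b^T$, $b^R$ and the down-crossing function $\gamma$. (i) If $\gamma(x)\le \frac1{2b}\log^{(2)}x+\frac1{2b}\log^{(3)}x$ for all sufficiently large $x$, then the diffusion with the two-phase drift is recurrent. (ii) If there is a constant $k>1$ such that $\gamma(x)\ge \frac1{2b}\log^{(2)}x+\frac k{2b}\log^{(3)}x$ for all sufficiently large $x$, then the diffusion with the two-phase drift is transient to $+\infty$.
   Context: $\log^{(j)}$ denotes the $j$-fold iterated natural logarithm: $\log^{(2)}x=\log\log x$, $\log^{(3)}x=\log\log\log x$. For a continuous trajectory $x(\cdot):[0,\infty)\to\mathbb{R}$ let $x^*(t)=\max_{0\le s\le t}x(s)$ be its running maximum. Given continuous functions $b^T,b^R$ on $\mathbb{R}$ and a down-crossing function $\gamma$, define the non-anticipating drift $$b(t,x(\cdot))=\begin{cases} b^T(x(t)), & \text{if } x(t)>x^*(t)-\gamma(x^*(t)),\\ b^R(x(t)), & \text{if } x(t)\le x^*(t)-\gamma(x^*(t)).\end{cases}$$ The diffusion with the two-phase drift determined by $b^T,b^R,\gamma$, started from $x_0$, is the solution $X(\cdot)$ of $$X(t)=x_0+W(t)+\int_0^t b(s,X(\cdot))\,ds,$$ where $W$ is a standard one-dimensional Brownian motion. Since $\gamma$ is defined on $[0,\infty)$,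 starting points are taken with $x_0\ge0$, so that the running maximum is always nonnegative. The diffusion with the two-phase drift is recurrent if for any starting point $x_0$ and any $x_1\in\mathbb{R}$, the process started at $x_0$ almost surely returns to $x_1$ at arbitrarily large times. It is transient to $+\infty$ if, starting at any starting point $x_0$, the process almost surely satisfies $\lim_{t\to\infty}X(t)=\infty$. *)

theory Defs
  imports "HOL-Probability.Probability"
begin

text \<open>
  One-dimensional standard Brownian motion relative to a filtration. Only times \<open>t \<ge> 0\<close> matter:
  a filtration indexed by \<open>[0,\<infinity>)\<close> is extended to negative times by \<open>F t = F 0\<close>.
\<close>

locale brownian_motion = prob_space M + filtration "space M" F
  for M :: "'w measure" and F :: "real \<Rightarrow> 'w measure" +
  fixes W :: "real \<Rightarrow> 'w \<Rightarrow> real"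
  assumes subalgebra_F: "\<And>t. subalgebra M (F t)"
    and adapted: "\<And>t. 0 \<le> t \<Longrightarrow> W t \<in> borel_measurable (F t)"
    and start: "AE \<omega> in M. W 0 \<omega> = 0"
    and continuous_paths: "AE \<omega> in M. continuous_on {0..} (\<lambda>t. W t \<omega>)"
    and gaussian_increments: "\<And>s t. 0 \<le> s \<Longrightarrow> s < t \<Longrightarrow>
      distributed M lborel (\<lambda>\<omega>. W t \<omega> - W s \<omega>) (normal_density 0 (sqrt (t - s)))"
    and indep_increments: "\<And>s t. 0 \<le> s \<Longrightarrow> s < t \<Longrightarrow>
      indep_set (sets (F s)) {(\<lambda>\<omega>. W t \<omega> - W s \<omega>) -` B \<inter> space M | B. B \<in> sets borel}"

definition running_max :: "(real \<Rightarrow> real) \<Rightarrow> real \<Rightarrow> real" where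
  "running_max x t = (SUP s\<in>{0..t}. x s)"

lemma running_max_attained:
  assumes "continuous_on {0..} x" and "0 \<le> t"
  shows "\<exists>s\<in>{0..t}. running_max x t = x s \<and> (\<forall>r\<in>{0..t}. x r \<le> x s)"
proof -
  have "continuous_on {0..t} x"
    by (rule continuous_on_subset[OF assms(1)]) auto
  then obtain s where s: "s \<in> {0..t}" "\<forall>r\<in>{0..t}. x r \<le> x s"
    using continuous_attains_sup[of "{0..t}" x] assms(2) by auto
  moreover have "running_max x t = x s"
    unfolding running_max_def by (rule cSup_eq_maximum) (use s in auto)
  ultimately show ?thesis
    by blast
qed

definition two_phase_drift ::
  "(real \<Rightarrow> real) \<Rightarrow> (real \<Rightarrow> real) \<Rightarrow> (real \<Rightarrow> real) \<Rightarrow> real \<Rightarrow> (real \<Rightarrow> real) \<Rightarrow> real"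
where
  "two_phase_drift bT bR \<gamma> t x =
    (if x t > running_max x t - \<gamma> (running_max x t) then bT (x t) else bR (x t))"

text \<open>
  \<open>X\<close> solves the equation driven by the \<open>F\<close>-Brownian motion \<open>W\<close>. Since the drift is non-anticipating,
  a solution is required to be \<open>F\<close>-adapted; \<open>F\<close> may be larger than the filtration generated
  by \<open>W\<close>, so both strong and weak solutions are covered.
\<close>

locale two_phase_diffusion = brownian_motion M F W
  for M :: "'w measure" and F :: "real \<Rightarrow> 'w measure" and W :: "real \<Rightarrow> 'w \<Rightarrow> real" +
  fixes bT bR \<gamma> :: "real \<Rightarrow> real" and x\<^sub>0 :: real and X :: "real \<Rightarrow> 'w \<Rightarrow> real"
  assumes adapted_X: "\<And>t. 0 \<le> t \<Longrightarrow> X t \<in> borel_measurable (F t)"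
    and continuous_paths_X: "AE \<omega> in M. continuous_on {0..} (\<lambda>t. X t \<omega>)"
    and equation: "AE \<omega> in M. \<forall>t\<ge>0.
      set_integrable lborel {0..t} (\<lambda>s. two_phase_drift bT bR \<gamma> s (\<lambda>r. X r \<omega>)) \<and>
      X t \<omega> = x\<^sub>0 + W t \<omega> + (LINT s:{0..t}|lborel. two_phase_drift bT bR \<gamma> s (\<lambda>r. X r \<omega>))"

text \<open>
  The type argument is the type carrying the sample space; theorems polymorphic in it
  speak about solutions on arbitrary probability spaces. Only the restriction of \<open>\<gamma>\<close> to
  \<open>[0,\<infinity>)\<close> is meaningful, hence \<open>x\<^sub>0 \<ge> 0\<close>.
\<close>

definition two_phase_recurrent ::
  "'w itself \<Rightarrow> (real \<Rightarrow> real) \<Rightarrow> (real \<Rightarrow> real) \<Rightarrow> (real \<Rightarrow> real) \<Rightarrow> bool"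
where
  "two_phase_recurrent _ bT bR \<gamma> \<longleftrightarrow>
    (\<forall>x\<^sub>0\<ge>0. \<forall>x\<^sub>1. \<forall>(M :: 'w measure) F W X. two_phase_diffusion M F W bT bR \<gamma> x\<^sub>0 X \<longrightarrow>
      (AE \<omega> in M. \<forall>T. \<exists>t\<ge>max 0 T. X t \<omega> = x\<^sub>1))"

definition two_phase_transient ::
  "'w itself \<Rightarrow> (real \<Rightarrow> real) \<Rightarrow> (real \<Rightarrow> real) \<Rightarrow> (real \<Rightarrow> real) \<Rightarrow> bool"
where
  "two_phase_transient _ bT bR \<gamma> \<longleftrightarrow>
    (\<forall>x\<^sub>0\<ge>0. \<forall>(M :: 'w measure) F W X. two_phase_diffusion M F W bT bR \<gamma> x\<^sub>0 X \<longrightarrow>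
      (AE \<omega> in M. filterlim (\<lambda>t. X t \<omega>) at_top at_top))"

end

theory Submission
  imports Defs
begin

text \<open>
  Between the first times at which the process attains the levels \<open>n\<close> and \<open>n + 1\<close>, the switching point of the
  drift lies between \<open>n - \<gamma> n\<close> and \<open>n + 1 - \<gamma> (n + 1)\<close>, because \<open>\<gamma>' < 1\<close>. Comparing with the scale
  function of a drift that is switched off below a fixed point, the probability of a visit to \<open>x\<^sub>1\<close> during
  this phase is, up to constant factors, \<open>1 / (n exp (2 b \<gamma> n))\<close>: shifting the switching point by a bounded
  amount costs only a constant factor. For the two bounds on \<open>\<gamma>\<close> these probabilities are compared with
  \<open>1 / (n log n loglog n)\<close> and \<open>1 / (n log n (loglog n)\<^sup>k)\<close>, so a product argument gives recurrence and the
  Borel-Cantelli lemma gives transience.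

  Ito's formula is avoided. The scale functions are piecewise explicit and their Taylor bound is only required
  up to a cubic error. Over a time step \<open>h\<close> the independent Gaussian increment then yields the supermartingale
  inequality up to \<open>O(h\<^sup>3\<^sup>/\<^sup>2)\<close>, and the errors vanish in the limit over a refining grid with \<open>h = j\<^sup>-\<^sup>4\<close> and
  \<open>j\<^sup>5\<close> steps, whose horizon \<open>j\<close> tends to infinity at the same time.
\<close>

section \<open>Level crossings of continuous paths\<close>

text \<open>The event followed through the levels is that \<open>n\<close> is attained before a
  visit to \<open>x\<^sub>1\<close>, where visits count only after a marker level \<open>a\<close>
  has been attained; so the start may lie on either side of \<open>x\<^sub>1\<close>. The marker is
  used in two ways. For recurrence it is a fixed \<open>N\<close>, and the inequalities for
  successive levels multiply. For transience it is \<open>n\<close> itself: each phase then starts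
  with probability one, and the failure probabilities are summed. The obstacle in each grid step is
  that the drift depends on the path inside the step, not only on its initial point. For transience,
  \<open>x - \<gamma> x\<close> may tend to infinity slowly. The factor of order
  \<open>1 / n\<close> is therefore extracted only when \<open>\<gamma>\<close> is at most half its
  argument; otherwise the exponential factor alone is geometrically small.\<close>

definition triangle :: "(real \<times> real) set" where
  "triangle = {z. 0 \<le> fst z \<and> fst z \<le> snd z \<and> snd z \<le> 1}"

lemma compact_triangle: "compact triangle"
proof -
  have "triangle = ({0..1} \<times> {0..1}) \<inter> {z. fst z \<le> snd z}"
    by (auto simp: triangle_def)
  moreover have "closed {z::real \<times> real. fst z \<le> snd z}"
    by (intro closed_Collect_le continuous_intros)
  ultimately show ?thesis
    by (metis compact_Int_closed compact_Times compact_Icc)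
qed

lemma floor_approximation: "(\<lambda>k. real_of_int \<lfloor>real k * r\<rfloor> / real k) \<longlonglongrightarrow> r"
proof -
  have "(\<lambda>k. real_of_int \<lfloor>real k * r\<rfloor> / real k - r) \<longlonglongrightarrow> 0"
  proof (rule tendsto_0_le[where K=1])
    show "(\<lambda>k. 1 / real k) \<longlonglongrightarrow> 0" by (rule lim_1_over_n)
    show "\<forall>\<^sub>F k in sequentially. norm (real_of_int \<lfloor>real k * r\<rfloor> / real k - r) \<le> norm (1 / real k) * 1"
    proof (rule eventually_sequentiallyI[of 1])
      fix k :: nat assume k: "1 \<le> k"
      have "real_of_int \<lfloor>real k * r\<rfloor> / real k - r = (real_of_int \<lfloor>real k * r\<rfloor> - real k * r) / real k"
        using k by (simp add: field_simps)
      moreover have "\<bar>real_of_int \<lfloor>real k * r\<rfloor> - real k * r\<bar> \<le> 1" by linarith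
      ultimately show "norm (real_of_int \<lfloor>real k * r\<rfloor> / real k - r) \<le> norm (1 / real k) * 1"
        by (simp add: divide_right_mono)
    qed
  qed
  then show ?thesis by (simp add: LIM_zero_iff)
qed

text \<open>From right to left this is compactness: values above every \<open>- 1 / Suc m\<close>
  force the maximum to be nonnegative. The other direction is continuity along rational points. The
  tolerance is essential, since the exact inequality may hold at irrational points only.\<close>

lemma nonneg_on_triangle_iff_rational:
  assumes "continuous_on triangle \<Phi>"
  shows "(\<exists>z\<in>triangle. 0 \<le> \<Phi> z) \<longleftrightarrow> (\<forall>m::nat. \<exists>z\<in>triangle \<inter> (\<rat> \<times> \<rat>). - 1 / real (Suc m) < \<Phi> z)"
proof
  assume "\<exists>z\<in>triangle. 0 \<le> \<Phi> z"
  then obtain r s where rs: "(r, s) \<in> triangle" "0 \<le> \<Phi> (r, s)" by force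
  \<comment> \<open>Rounding both coordinates down to multiples of \<open>1 / k\<close> preserves
    their order and the bounds 0 and 1, so the approximations stay in
    \<open>triangle\<close>.\<close>
  define z where "z k = (real_of_int \<lfloor>real k * r\<rfloor> / real k, real_of_int \<lfloor>real k * s\<rfloor> / real k)" for k :: nat
  have z_lim: "z \<longlonglongrightarrow> (r, s)"
    unfolding z_def by (intro tendsto_Pair floor_approximation)
  have z_in: "z k \<in> triangle \<inter> (\<rat> \<times> \<rat>)" if "k > 0" for k
  proof -
    have "real k * r \<le> real k * s" using rs by (simp add: triangle_def mult_left_mono)
    then have *: "\<lfloor>real k * r\<rfloor> \<le> \<lfloor>real k * s\<rfloor>" by (rule floor_mono)
    have "real k * s \<le> real k" using rs by (simp add: triangle_def mult_left_le)
    then have **: "real_of_int \<lfloor>real k * s\<rfloor> \<le> real k" by linarith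
    have "0 \<le> \<lfloor>real k * r\<rfloor>" using rs by (simp add: triangle_def)
    with * ** that show ?thesis
      by (auto simp: z_def triangle_def divide_right_mono)
  qed
  show "\<forall>m::nat. \<exists>z\<in>triangle \<inter> (\<rat> \<times> \<rat>). - 1 / real (Suc m) < \<Phi> z"
  proof
    fix m :: nat
    have "(\<lambda>k. \<Phi> (z k)) \<longlonglongrightarrow> \<Phi> (r, s)"
      by (rule continuous_on_tendsto_compose[OF assms z_lim rs(1)])
        (use z_in in \<open>auto intro!: eventually_sequentiallyI[of 1]\<close>)
    moreover have "- 1 / real (Suc m) < \<Phi> (r, s)"
      using rs(2) by (smt (verit) divide_neg_pos of_nat_0_less_iff zero_less_Suc)
    ultimately have "\<forall>\<^sub>F k in sequentially. - 1 / real (Suc m) < \<Phi> (z k)"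
      by (rule order_tendstoD(1))
    then have "\<forall>\<^sub>F k in sequentially. - 1 / real (Suc m) < \<Phi> (z k) \<and> k > 0"
      by (intro eventually_conj eventually_gt_at_top)
    then obtain k where "- 1 / real (Suc m) < \<Phi> (z k)" "k > 0"
      by (auto simp: eventually_sequentially)
    with z_in show "\<exists>z\<in>triangle \<inter> (\<rat> \<times> \<rat>). - 1 / real (Suc m) < \<Phi> z" by blast
  qed
next
  assume R: "\<forall>m::nat. \<exists>z\<in>triangle \<inter> (\<rat> \<times> \<rat>). - 1 / real (Suc m) < \<Phi> z"
  have "(0, 0) \<in> triangle" by (simp add: triangle_def)
  then obtain w where w: "w \<in> triangle" "\<And>z. z \<in> triangle \<Longrightarrow> \<Phi> z \<le> \<Phi> w"
    using continuous_attains_sup[OF compact_triangle _ assms] by blast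
  have "0 \<le> \<Phi> w"
  proof (rule ccontr)
    assume "\<not> 0 \<le> \<Phi> w"
    then obtain m where "1 / real (Suc m) < - \<Phi> w"
      using nat_approx_posE[of "- \<Phi> w"] by auto
    moreover obtain z where "z \<in> triangle" "- 1 / real (Suc m) < \<Phi> z" using R by blast
    ultimately show False using w(2)[of z] by simp
  qed
  with w show "\<exists>z\<in>triangle. 0 \<le> \<Phi> z" by blast
qed

text \<open>Both notions quantify over countably many rational times so that they are measurable
  with respect to the uncompleted filtration; on continuous paths they mean what their names say.\<close>

definition reached :: "(real \<Rightarrow> real) \<Rightarrow> real \<Rightarrow> real \<Rightarrow> bool" where
  "reached x a t \<longleftrightarrow>
    (\<forall>m::nat. \<exists>z\<in>triangle \<inter> (\<rat> \<times> \<rat>). - 1 / real (Suc m) < x (fst z * t) - a)"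

definition crossed :: "(real \<Rightarrow> real) \<Rightarrow> real \<Rightarrow> real \<Rightarrow> real \<Rightarrow> bool" where
  "crossed x a c t \<longleftrightarrow>
    (\<forall>m::nat. \<exists>z\<in>triangle \<inter> (\<rat> \<times> \<rat>). - 1 / real (Suc m) < min (x (fst z * t) - a) (c - x (snd z * t)))"

lemma triangle_scaled: "0 \<le> t \<Longrightarrow> z \<in> triangle \<Longrightarrow> 0 \<le> fst z * t \<and> fst z * t \<le> snd z * t \<and> snd z * t \<le> t"
  by (auto simp: triangle_def mult_right_mono mult_left_le_one_le)

lemma reached_iff:
  assumes "continuous_on {0..} x" "0 \<le> t"
  shows "reached x a t \<longleftrightarrow> (\<exists>s\<in>{0..t}. a \<le> x s)"
proof -
  have "continuous_on triangle (\<lambda>z. x (fst z * t) - a)"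
    by (intro continuous_intros continuous_on_compose2[OF assms(1)])
      (use triangle_scaled[OF assms(2)] in auto)
  from nonneg_on_triangle_iff_rational[OF this]
  have "reached x a t \<longleftrightarrow> (\<exists>z\<in>triangle. 0 \<le> x (fst z * t) - a)"
    by (simp add: reached_def)
  also have "\<dots> \<longleftrightarrow> (\<exists>s\<in>{0..t}. a \<le> x s)"
  proof
    assume "\<exists>z\<in>triangle. 0 \<le> x (fst z * t) - a"
    then obtain z where "z \<in> triangle" "a \<le> x (fst z * t)" by auto
    then show "\<exists>s\<in>{0..t}. a \<le> x s"
      using triangle_scaled[OF assms(2), of z] by (intro bexI[of _ "fst z * t"]) auto
  next
    assume "\<exists>s\<in>{0..t}. a \<le> x s"
    then obtain s where s: "0 \<le> s" "s \<le> t" "a \<le> x s" by auto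
    \<comment> \<open>This includes \<open>t = 0\<close>: then \<open>s = 0\<close>, and division by
      zero gives 0.\<close>
    have "(s / t, 1) \<in> triangle" "s / t * t = s" using s by (auto simp: triangle_def divide_le_eq_1)
    then show "\<exists>z\<in>triangle. 0 \<le> x (fst z * t) - a" using s by (intro bexI[of _ "(s / t, 1)"]) auto
  qed
  finally show ?thesis .
qed

lemma crossed_iff:
  assumes "continuous_on {0..} x" "0 \<le> t"
  shows "crossed x a c t \<longleftrightarrow> (\<exists>r s. 0 \<le> r \<and> r \<le> s \<and> s \<le> t \<and> a \<le> x r \<and> x s \<le> c)"
proof -
  have "continuous_on triangle (\<lambda>z. min (x (fst z * t) - a) (c - x (snd z * t)))"
    by (intro continuous_intros continuous_on_compose2[OF assms(1)])
      (use triangle_scaled[OF assms(2)] in force)+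
  from nonneg_on_triangle_iff_rational[OF this]
  have "crossed x a c t \<longleftrightarrow> (\<exists>z\<in>triangle. 0 \<le> min (x (fst z * t) - a) (c - x (snd z * t)))"
    by (simp add: crossed_def)
  also have "\<dots> \<longleftrightarrow> (\<exists>r s. 0 \<le> r \<and> r \<le> s \<and> s \<le> t \<and> a \<le> x r \<and> x s \<le> c)"
  proof
    assume "\<exists>z\<in>triangle. 0 \<le> min (x (fst z * t) - a) (c - x (snd z * t))"
    then obtain z where "z \<in> triangle" "a \<le> x (fst z * t)" "x (snd z * t) \<le> c" by auto
    then show "\<exists>r s. 0 \<le> r \<and> r \<le> s \<and> s \<le> t \<and> a \<le> x r \<and> x s \<le> c"
      using triangle_scaled[OF assms(2), of z] by blast
  next
    assume "\<exists>r s. 0 \<le> r \<and> r \<le> s \<and> s \<le> t \<and> a \<le> x r \<and> x s \<le> c"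
    then obtain r s where s: "0 \<le> r" "r \<le> s" "s \<le> t" "a \<le> x r" "x s \<le> c" by auto
    have "(r / t, s / t) \<in> triangle" "s / t * t = s" "r / t * t = r"
      using s assms(2) by (auto simp: triangle_def divide_le_eq_1 divide_right_mono)
    then show "\<exists>z\<in>triangle. 0 \<le> min (x (fst z * t) - a) (c - x (snd z * t))"
      using s by (intro bexI[of _ "(r / t, s / t)"]) auto
  qed
  finally show ?thesis .
qed

section \<open>Hitting times and phases of a continuous path\<close>

lemma first_hitting_time:
  fixes x :: "real \<Rightarrow> real"
  assumes cont: "continuous_on {s..} x" and "x s < a" "s \<le> u" "a \<le> x u"
  obtains T where "s < T" "x T = a" "\<And>t. s \<le> t \<Longrightarrow> t < T \<Longrightarrow> x t < a"
proof -
  let ?S = "{s..u} \<inter> x -` {a..}"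
  have "closed ?S"
    by (rule continuous_closed_preimage) (auto intro: continuous_on_subset[OF cont])
  then have cS: "compact ?S" by (simp add: compact_Int_closed bounded_Int compact_eq_bounded_closed)
  moreover have "?S \<noteq> {}" using assms by auto
  ultimately obtain T where T: "T \<in> ?S" "\<And>t. t \<in> ?S \<Longrightarrow> T \<le> t"
    using compact_attains_inf[of ?S] by blast
  have "s < T" using T(1) assms by (cases "T = s") auto
  have less: "x t < a" if "s \<le> t" "t < T" for t
    using T(2)[of t] T(1) that by (force simp: not_le)
  have "\<exists>t. s \<le> t \<and> t \<le> T \<and> x t = a"
    using IVT'[of x s a T] T(1) assms \<open>s < T\<close> by (force intro: continuous_on_subset[OF cont])
  then obtain t where "s \<le> t" "t \<le> T" "x t = a" by blast
  then have "x T = a" using less[of t] by (cases "t = T") auto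
  then show ?thesis using that \<open>s < T\<close> less by blast
qed

text \<open>On continuous paths these are the times at which the running maximum lies in
  \<open>[n, n + 1)\<close> and \<open>c\<close> has not been visited since \<open>a\<close> was
  attained. Earlier visits are ignored, so \<open>c\<close> may lie above the starting
  point.\<close>

definition phase :: "(real \<Rightarrow> real) \<Rightarrow> real \<Rightarrow> real \<Rightarrow> real \<Rightarrow> real \<Rightarrow> bool" where
  "phase x a c n t \<longleftrightarrow> reached x n t \<and> \<not> reached x (n + 1) t \<and> \<not> crossed x a c t"

text \<open>On unbounded continuous paths a nonempty phase is a half-open interval, so rational times suffice.\<close>

definition survives :: "(real \<Rightarrow> real) \<Rightarrow> real \<Rightarrow> real \<Rightarrow> real \<Rightarrow> bool" where
  "survives x a c n \<longleftrightarrow> (\<exists>t\<in>\<rat> \<inter> {0..}. phase x a c n t)"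

lemma reached_threshold:
  assumes cont: "continuous_on {0..} x" and "x 0 < a" "\<exists>u\<ge>0. a \<le> x u"
  obtains T where "0 < T" "x T = a" "\<And>t. 0 \<le> t \<Longrightarrow> reached x a t \<longleftrightarrow> T \<le> t"
proof -
  obtain T where T: "0 < T" "x T = a" "\<And>t. 0 \<le> t \<Longrightarrow> t < T \<Longrightarrow> x t < a"
    using first_hitting_time[OF cont assms(2)] assms(3) by blast
  have "reached x a t \<longleftrightarrow> T \<le> t" if "0 \<le> t" for t
    unfolding reached_iff[OF cont that] using T that by (force simp: not_le[symmetric])
  with T that show ?thesis by blast
qed

text \<open>All times with value at least \<open>a\<close> come at or after the first one,
  \<open>T\<close>. A crossing is thus a visit to the half-line below \<open>c\<close> after
  \<open>T\<close>, and the first such visit is a hitting time of \<open>- x\<close>.\<close>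

lemma crossed_threshold:
  assumes cont: "continuous_on {0..} x" and "x 0 < a" "\<exists>u\<ge>0. a \<le> x u" "c < a"
    and T: "0 \<le> T" "x T = a" "\<And>t. 0 \<le> t \<Longrightarrow> reached x a t \<longleftrightarrow> T \<le> t"
  shows "(\<forall>t\<ge>0. \<not> crossed x a c t) \<or> (\<exists>C>T. x C = c \<and> (\<forall>t\<ge>0. crossed x a c t \<longleftrightarrow> C \<le> t))"
proof -
  have T_le: "T \<le> r" if "0 \<le> r" "a \<le> x r" for r
    using T(3)[OF that(1)] reached_iff[OF cont that(1), of a] that by auto
  have *: "crossed x a c t \<longleftrightarrow> (\<exists>s\<in>{T..t}. x s \<le> c)" if "0 \<le> t" for t
    unfolding crossed_iff[OF cont that] using T_le T by force
  show ?thesis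
  proof (cases "\<exists>s\<ge>T. x s \<le> c")
    case True
    then obtain u where u: "T \<le> u" "x u \<le> c" by blast
    have "continuous_on {T..} (\<lambda>t. - x t)"
      by (intro continuous_intros continuous_on_subset[OF cont]) (use T in auto)
    then obtain C where C: "T < C" "- x C = - c" "\<And>t. T \<le> t \<Longrightarrow> t < C \<Longrightarrow> - x t < - c"
      using first_hitting_time[of T "\<lambda>t. - x t" "- c" u] u T assms(4) by auto
    have "crossed x a c t \<longleftrightarrow> C \<le> t" if "0 \<le> t" for t
      unfolding *[OF that] using C by (force simp: not_le[symmetric])
    with C show ?thesis by auto
  next
    case False
    then show ?thesis using * by auto
  qed
qed

text \<open>With \<open>T0\<close>, \<open>T1\<close> the hitting times of \<open>n\<close>,
  \<open>n + 1\<close> and \<open>C\<close> the time at which the crossing is completed, the phase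
  is the interval from \<open>T0\<close> up to \<open>min T1 C\<close>. It is nonempty exactly if
  \<open>T0 < C\<close>, and the value of the path at its right end tells which of
  \<open>T1\<close>, \<open>C\<close> came first.\<close>

lemma phase_interval:
  assumes cont: "continuous_on {0..} x" and unb: "\<And>a. \<exists>u\<ge>0. a \<le> x u"
    and "x 0 < a" "c < a" "a \<le> n"
  shows "\<not> survives x a c n \<Longrightarrow> \<forall>t\<ge>0. \<not> phase x a c n t" (is "_ \<Longrightarrow> ?no")
    and "survives x a c n \<Longrightarrow> \<exists>\<sigma> \<tau>. 0 \<le> \<sigma> \<and> \<sigma> < \<tau> \<and> (\<forall>t\<ge>0. phase x a c n t \<longleftrightarrow> \<sigma> \<le> t \<and> t < \<tau>) \<and>
      x \<sigma> = n \<and> x \<tau> = (if survives x a c (n + 1) then n + 1 else c)" (is "_ \<Longrightarrow> ?yes")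
    and "survives x a c (n + 1) \<Longrightarrow> survives x a c n"
    and "survives x a c n \<longleftrightarrow> (\<exists>t\<ge>0. reached x n t \<and> \<not> crossed x a c t)"
proof -
  have less: "x 0 < n" "x 0 < n + 1" "x 0 < n + 2" using assms by auto
  obtain T where T: "0 < T" "x T = a" "\<And>t. 0 \<le> t \<Longrightarrow> reached x a t \<longleftrightarrow> T \<le> t"
    using reached_threshold[OF cont assms(3) unb] by metis
  obtain T0 where T0: "0 < T0" "x T0 = n" "\<And>t. 0 \<le> t \<Longrightarrow> reached x n t \<longleftrightarrow> T0 \<le> t"
    using reached_threshold[OF cont less(1) unb] by metis
  obtain T1 where T1: "0 < T1" "x T1 = n + 1" "\<And>t. 0 \<le> t \<Longrightarrow> reached x (n + 1) t \<longleftrightarrow> T1 \<le> t"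
    using reached_threshold[OF cont less(2) unb] by metis
  \<comment> \<open>Level \<open>n + 2\<close> bounds phase \<open>n + 1\<close> from the right.
    That phase then has positive length, and contains a rational time, as soon as it is
    nonempty.\<close>
  obtain T2 where T2: "0 < T2" "x T2 = n + 2" "\<And>t. 0 \<le> t \<Longrightarrow> reached x (n + 2) t \<longleftrightarrow> T2 \<le> t"
    using reached_threshold[OF cont less(3) unb] by metis
  have mono: "u \<le> v" if "0 < u" "x v = l" "k \<le> l" "0 < v" "\<And>t. 0 \<le> t \<Longrightarrow> reached x k t \<longleftrightarrow> u \<le> t" for u v k l
  proof -
    have "reached x k v" unfolding reached_iff[OF cont less_imp_le[OF that(4)]] using that by auto
    then show ?thesis using that by auto
  qed
  have TT: "T \<le> T0" using mono[OF T(1) T0(2) assms(5) T0(1)] T(3) by blast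
  have "T0 \<le> T1" by (rule mono[OF T0(1) T1(2) _ T1(1) T0(3)]) auto
  with T0 T1 have T01: "T0 < T1" by (cases "T0 = T1") auto
  have "T1 \<le> T2" by (rule mono[OF T1(1) T2(2) _ T2(1) T1(3)]) auto
  with T1 T2 have T12: "T1 < T2" by (cases "T1 = T2") auto
  have rat: "\<exists>t\<in>\<rat> \<inter> {0..}. u \<le> t \<and> t < v" if "0 < u" "u < v" for u v :: real
  proof -
    obtain r where "r \<in> \<rat>" "u < r" "r < v" using Rats_dense_in_real[OF \<open>u < v\<close>] by blast
    then show ?thesis using that(1) by (intro bexI[of _ r]) auto
  qed
  have n2: "n + 1 + 1 = n + 2" by simp
  have ph0: "phase x a c n t \<longleftrightarrow> T0 \<le> t \<and> t < T1 \<and> \<not> crossed x a c t" if "0 \<le> t" for t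
    using T0(3)[OF that] T1(3)[OF that] by (auto simp: phase_def)
  have ph1: "phase x a c (n + 1) t \<longleftrightarrow> T1 \<le> t \<and> t < T2 \<and> \<not> crossed x a c t" if "0 \<le> t" for t
    unfolding phase_def n2 using T1(3)[OF that] T2(3)[OF that] by auto
  have C: "(\<forall>t\<ge>0. \<not> crossed x a c t) \<or> (\<exists>C>T. x C = c \<and> (\<forall>t\<ge>0. crossed x a c t \<longleftrightarrow> C \<le> t))"
    using crossed_threshold[OF cont assms(3) unb assms(4) less_imp_le[OF T(1)] T(2)] T(3) by blast
  have "(\<not> survives x a c n \<longrightarrow> ?no) \<and> (survives x a c n \<longrightarrow> ?yes) \<and> (survives x a c (n + 1) \<longrightarrow> survives x a c n)
    \<and> (survives x a c n \<longleftrightarrow> (\<exists>t\<ge>0. reached x n t \<and> \<not> crossed x a c t))"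
    using C
  proof
    assume nc: "\<forall>t\<ge>0. \<not> crossed x a c t"
    have 0: "survives x a c n" "survives x a c (n + 1)"
      unfolding survives_def using rat[OF T0(1) T01] rat[OF T1(1) T12] ph0 ph1 nc by auto
    moreover have ?yes
      by (intro exI[of _ T0] exI[of _ T1]) (use T0 T1 T01 ph0 nc 0 in auto)
    moreover have "\<exists>t\<ge>0. reached x n t \<and> \<not> crossed x a c t"
      using nc T0(1,3) by (intro exI[of _ T0]) auto
    ultimately show ?thesis by simp
  next
    assume "\<exists>C>T. x C = c \<and> (\<forall>t\<ge>0. crossed x a c t \<longleftrightarrow> C \<le> t)"
    then obtain C where C: "T < C" "x C = c" "\<And>t. 0 \<le> t \<Longrightarrow> crossed x a c t \<longleftrightarrow> C \<le> t" by auto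
    \<comment> \<open>The path is above \<open>c\<close> at \<open>T0\<close> and \<open>T1\<close>,
      so ties are impossible and strict comparisons decide how the phase ends.\<close>
    have ne: "C \<noteq> T1" "C \<noteq> T0" using C T1 T0 assms by auto
    have s0: "survives x a c n \<longleftrightarrow> T0 < C"
    proof
      assume "survives x a c n"
      then show "T0 < C" unfolding survives_def using ph0 C by auto
    next
      assume "T0 < C"
      then have "T0 < min T1 C" using T01 by simp
      from rat[OF T0(1) this] show "survives x a c n" unfolding survives_def using ph0 C by auto
    qed
    have s1: "survives x a c (n + 1) \<longleftrightarrow> T1 < C"
    proof
      assume "survives x a c (n + 1)"
      then show "T1 < C" unfolding survives_def using ph1 C by auto
    next
      assume "T1 < C"
      then have "T1 < min T2 C" using T12 by simp
      from rat[OF T1(1) this] show "survives x a c (n + 1)" unfolding survives_def using ph1 C by auto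
    qed
    have ?no if "\<not> survives x a c n"
      using that s0 ph0 C by auto
    moreover have ?yes if "survives x a c n"
      by (intro exI[of _ T0] exI[of _ "min T1 C"])
        (use that s0 s1 ne C T0 T1 T01 ph0 in \<open>auto simp: min_def\<close>)
    moreover have "survives x a c n \<longleftrightarrow> (\<exists>t\<ge>0. reached x n t \<and> \<not> crossed x a c t)"
    proof
      assume "survives x a c n"
      then show "\<exists>t\<ge>0. reached x n t \<and> \<not> crossed x a c t"
        using s0 T0(1,3) C(3) by (intro exI[of _ T0]) auto
    next
      assume "\<exists>t\<ge>0. reached x n t \<and> \<not> crossed x a c t"
      then obtain t where "t \<ge> 0" "reached x n t" "\<not> crossed x a c t" by blast
      then show "survives x a c n" using s0 T0(3) C(3) by auto
    qed
    ultimately show ?thesis using s0 s1 T01 by auto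
  qed
  then show "\<not> survives x a c n \<Longrightarrow> ?no" "survives x a c n \<Longrightarrow> ?yes"
    "survives x a c (n + 1) \<Longrightarrow> survives x a c n"
    "survives x a c n \<longleftrightarrow> (\<exists>t\<ge>0. reached x n t \<and> \<not> crossed x a c t)" by simp_all
qed

section \<open>Scale functions with a fixed switching point\<close>

text \<open>The solution of \<open>f'' / 2 + b f' = 0\<close> to the right of \<open>c\<close> and
  \<open>f'' = 0\<close> to the left, with value 0 and slope 1 at \<open>c\<close>.
  \<open>scale_density\<close> is its derivative. The second derivative jumps at \<open>c\<close>,
  which forces the one-sided Taylor bounds below.\<close>

definition scale_fun :: "real \<Rightarrow> real \<Rightarrow> real \<Rightarrow> real" where
  "scale_fun b c x = (if x \<le> c then x - c else (1 - exp (- (2 * b * (x - c)))) / (2 * b))"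

definition scale_density :: "real \<Rightarrow> real \<Rightarrow> real \<Rightarrow> real" where
  "scale_density b c x = exp (- (2 * b * max 0 (x - c)))"

lemma scale_density_pos: "0 < scale_density b c x"
  by (simp add: scale_density_def)

lemma scale_density_le_1: "0 < b \<Longrightarrow> scale_density b c x \<le> 1"
  by (simp add: scale_density_def)

lemma scale_density_eq_1: "x \<le> c \<Longrightarrow> scale_density b c x = 1"
  by (simp add: scale_density_def)

lemma scale_density_le: "0 < b \<Longrightarrow> scale_density b c x \<le> exp (- (2 * b * (x - c)))"
  by (simp add: scale_density_def)

lemma measurable_scale_density [measurable]: "scale_density b c \<in> borel_measurable borel"
  unfolding scale_density_def[abs_def] by measurable

lemma scale_fun_upper_half: "0 < b \<Longrightarrow> c \<le> x \<Longrightarrow> scale_fun b c x = (1 - exp (- (2 * b * (x - c)))) / (2 * b)"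
  by (auto simp: scale_fun_def)

lemma scale_fun_le_linear:
  assumes "0 < b" shows "scale_fun b c x \<le> x - c"
proof -
  have "1 + - (2 * b * (x - c)) \<le> exp (- (2 * b * (x - c)))" by (rule exp_ge_add_one_self)
  then have "(1 - exp (- (2 * b * (x - c)))) / (2 * b) \<le> x - c"
    using assms by (simp add: field_simps)
  then show ?thesis by (simp add: scale_fun_def)
qed

lemma scale_fun_ge_exp:
  assumes "0 < b" shows "(1 - exp (- (2 * b * (x - c)))) / (2 * b) \<le> scale_fun b c x"
proof -
  have "1 + - (2 * b * (x - c)) \<le> exp (- (2 * b * (x - c)))" by (rule exp_ge_add_one_self)
  then have "(1 - exp (- (2 * b * (x - c)))) / (2 * b) \<le> x - c"
    using assms by (simp add: field_simps)
  then show ?thesis by (simp add: scale_fun_def)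
qed

lemma scale_fun_le_bound: "0 < b \<Longrightarrow> scale_fun b c x \<le> 1 / (2 * b)"
  by (auto simp: scale_fun_def divide_right_mono intro: order_trans[of _ 0])

text \<open>Increments of the exponential branch factor through its slope at \<open>x\<close>, so a
  Taylor expansion at zero is enough.\<close>

lemma exp_branch_diff:
  fixes b :: real assumes "0 < b"
  shows "(1 - exp (- (2 * b * (y - c)))) / (2 * b) - (1 - exp (- (2 * b * (x - c)))) / (2 * b)
    = exp (- (2 * b * (x - c))) * ((1 - exp (- (2 * b * (y - x)))) / (2 * b))"
proof -
  have "exp (- (2 * b * (y - c))) = exp (- (2 * b * (x - c))) * exp (- (2 * b * (y - x)))"
    by (simp add: exp_add[symmetric] algebra_simps)
  then show ?thesis using assms by (simp add: field_simps)
qed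

text \<open>This is concavity: the graph lies below its tangents. Every case reduces to
  \<open>1 + z \<le> exp z\<close>, and monotonicity and the Lipschitz bound are read off from
  it.\<close>

lemma scale_fun_tangent:
  assumes b: "0 < b" shows "scale_fun b c y \<le> scale_fun b c x + scale_density b c x * (y - x)"
proof (cases "x \<le> c")
  case True
  then show ?thesis using scale_fun_le_linear[OF b, of c y] by (simp add: scale_fun_def scale_density_def)
next
  case x: False
  let ?e = "exp (- (2 * b * (x - c)))"
  have e: "scale_density b c x = ?e" using x by (simp add: scale_density_def)
  show ?thesis
  proof (cases "y \<le> c")
    case True
    have "1 + 2 * b * (x - c) \<le> exp (2 * b * (x - c))" by (rule exp_ge_add_one_self)
    then have "(1 + 2 * b * (x - c)) * ?e \<le> exp (2 * b * (x - c)) * ?e" by (rule mult_right_mono) simp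
    then have *: "(1 + 2 * b * (x - c)) * ?e \<le> 1" by (simp add: exp_minus)
    then have "(x - c) * ?e \<le> (1 - ?e) / (2 * b)" using b by (simp add: field_simps)
    moreover have "(y - c) * 1 \<le> (y - c) * ?e"
      by (rule mult_left_mono_neg) (use True b x in auto)
    ultimately have "y - c \<le> (1 - ?e) / (2 * b) + ?e * (y - x)" by (simp add: algebra_simps)
    then show ?thesis using True x e by (simp add: scale_fun_def)
  next
    case False
    have "(1 - exp (- (2 * b * (y - x)))) / (2 * b) \<le> y - x"
      using exp_ge_add_one_self[of "- (2 * b * (y - x))"] b by (simp add: field_simps)
    then have "?e * ((1 - exp (- (2 * b * (y - x)))) / (2 * b)) \<le> ?e * (y - x)"
      by (rule mult_left_mono) simp
    then show ?thesis using exp_branch_diff[OF b, of y c x] x False e by (simp add: scale_fun_def)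
  qed
qed

lemma scale_fun_mono:
  assumes "0 < b" "x \<le> y" shows "scale_fun b c x \<le> scale_fun b c y"
proof -
  have "scale_density b c y * (x - y) \<le> 0"
    using assms scale_density_pos[of b c y] by (simp add: mult_nonneg_nonpos)
  then show ?thesis using scale_fun_tangent[OF assms(1), of c x y] by linarith
qed

lemma scale_fun_diff_le:
  assumes "0 < b" "x \<le> y" shows "scale_fun b c y - scale_fun b c x \<le> y - x"
proof -
  have "scale_fun b c y - scale_fun b c x \<le> scale_density b c x * (y - x)"
    using scale_fun_tangent[OF assms(1), of c y x] by simp
  also have "\<dots> \<le> 1 * (y - x)"
    by (rule mult_right_mono) (use assms scale_density_le_1 in auto)
  finally show ?thesis by simp
qed

lemma scale_fun_lipschitz:
  assumes "0 < b" shows "\<bar>scale_fun b c y - scale_fun b c x\<bar> \<le> \<bar>y - x\<bar>"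
  using scale_fun_diff_le[OF assms, of x y c] scale_fun_diff_le[OF assms, of y x c]
    scale_fun_mono[OF assms, of x y c] scale_fun_mono[OF assms, of y x c] by linarith

lemma continuous_on_scale_fun:
  assumes "0 < b" shows "continuous_on A (scale_fun b c)"
proof (rule continuous_onI)
  fix x e :: real assume "0 < e"
  then show "\<exists>d>0. \<forall>x'\<in>A. dist x' x < d \<longrightarrow> dist (scale_fun b c x') (scale_fun b c x) \<le> e"
    using scale_fun_lipschitz[OF assms, of c]
    by (intro exI[of _ e]) (auto simp: dist_real_def intro!: order.trans[OF scale_fun_lipschitz[OF assms]])
qed

section \<open>Taylor bounds with cubic error\<close>

lemma exp_minus_quadratic:
  fixes z :: real
  shows "\<bar>1 - exp (- z) - z + z\<^sup>2 / 2\<bar> \<le> exp \<bar>z\<bar> * \<bar>z\<bar> ^ 3"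
proof -
  obtain t where t: "\<bar>t\<bar> \<le> \<bar>z\<bar>" "exp (- z) = (\<Sum>m<3. ((- z) ^ m) / fact m) + (exp t / fact 3) * (- z) ^ 3"
    using Maclaurin_exp_le[of "- z" 3] by auto
  have "1 - exp (- z) - z + z\<^sup>2 / 2 = exp t / 6 * z ^ 3"
    unfolding t(2) by (simp add: eval_nat_numeral)
  also have "\<bar>\<dots>\<bar> = exp t / 6 * \<bar>z\<bar> ^ 3" by (simp add: abs_mult power_abs)
  also have "\<dots> \<le> exp \<bar>z\<bar> * \<bar>z\<bar> ^ 3"
  proof (rule mult_right_mono)
    have "exp t \<le> exp \<bar>z\<bar>" using t(1) by auto
    moreover have "exp t / 6 \<le> exp t" by simp
    ultimately show "exp t / 6 \<le> exp \<bar>z\<bar>" by linarith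
  qed simp
  finally show ?thesis .
qed

lemma exp_branch_taylor:
  fixes b d :: real
  assumes b: "0 < b" and "\<bar>d\<bar> \<le> 1 / 2"
  shows "\<bar>(1 - exp (- (2 * b * d))) / (2 * b) - d + b * d\<^sup>2\<bar> \<le> 4 * b\<^sup>2 * exp b * \<bar>d\<bar> ^ 3"
proof -
  have "(1 - exp (- (2 * b * d))) / (2 * b) - d + b * d\<^sup>2
      = (1 - exp (- (2 * b * d)) - 2 * b * d + (2 * b * d)\<^sup>2 / 2) / (2 * b)"
    using b by (simp add: field_simps power2_eq_square)
  also have "\<bar>\<dots>\<bar> \<le> exp \<bar>2 * b * d\<bar> * \<bar>2 * b * d\<bar> ^ 3 / (2 * b)"
    using b exp_minus_quadratic[of "2 * b * d"] by (simp add: abs_divide divide_right_mono)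
  also have "\<dots> = exp \<bar>2 * b * d\<bar> * (4 * b\<^sup>2 * \<bar>d\<bar> ^ 3)"
    using b by (simp add: abs_mult field_simps eval_nat_numeral)
  also have "\<dots> \<le> exp b * (4 * b\<^sup>2 * \<bar>d\<bar> ^ 3)"
  proof (rule mult_right_mono)
    have "2 * b * \<bar>d\<bar> \<le> 2 * b * (1 / 2)" using assms by (intro mult_left_mono) auto
    then show "exp \<bar>2 * b * d\<bar> \<le> exp b" using b by (simp add: abs_mult)
  qed simp
  finally show ?thesis by (simp add: mult_ac)
qed

lemma mult_unit_interval_bounds:
  fixes e r :: real
  assumes "0 \<le> e" "e \<le> 1" "\<bar>r\<bar> \<le> k" shows "e * r \<le> k" "- k \<le> e * r"
proof -
  have "\<bar>e * r\<bar> \<le> 1 * k" unfolding abs_mult using assms by (intro mult_mono) auto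
  then show "e * r \<le> k" "- k \<le> e * r" by auto
qed

text \<open>From \<open>c + 1 / 2\<close> on, both points lie on the exponential branch and the
  expansion applies. To the left of that, concavity gives the bound with second-order coefficient 0.
  Being allowed to switch the coefficient late leaves a margin of \<open>1 / 2\<close> towards
  \<open>c\<close>.\<close>

lemma scale_fun_taylor_upper:
  assumes b: "0 < b" and d: "\<bar>y - x\<bar> \<le> 1 / 2"
  shows "scale_fun b c y \<le> scale_fun b c x + scale_density b c x * (y - x)
    + (if c + 1 / 2 \<le> x then - (2 * b * scale_density b c x) else 0) / 2 * (y - x)\<^sup>2 + 4 * b\<^sup>2 * exp b * \<bar>y - x\<bar> ^ 3"
proof (cases "c + 1 / 2 \<le> x")
  case True
  let ?r = "(1 - exp (- (2 * b * (y - x)))) / (2 * b) - (y - x) + b * (y - x)\<^sup>2"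
  have c: "c \<le> x" "c \<le> y" using True d by linarith+
  have "scale_density b c x = exp (- (2 * b * (x - c)))" using c by (simp add: scale_density_def)
  then have "scale_fun b c y - scale_fun b c x = scale_density b c x * ((1 - exp (- (2 * b * (y - x)))) / (2 * b))"
    using c exp_branch_diff[OF b, of y c x] by (simp add: scale_fun_upper_half[OF b])
  moreover have "scale_density b c x * ?r \<le> 4 * b\<^sup>2 * exp b * \<bar>y - x\<bar> ^ 3"
    by (rule mult_unit_interval_bounds[OF _ _ exp_branch_taylor[OF b d]]) (use scale_density_pos[of b c x] scale_density_le_1[OF b] in auto)
  ultimately show ?thesis using True by (simp add: algebra_simps)
next
  case False
  then show ?thesis using scale_fun_tangent[OF b, of c y x] by (auto intro: order_trans)
qed

text \<open>The negated function is convex, so the second-order term has to be paid wherever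
  \<open>y\<close> can reach the exponential branch, that is from \<open>c - 1 / 2\<close> on. Right
  of \<open>c\<close> the exponential formula is a lower bound for \<open>scale_fun\<close> even if
  \<open>y\<close> falls below \<open>c\<close>.\<close>

lemma scale_fun_taylor_lower:
  assumes b: "0 < b" and d: "\<bar>y - x\<bar> \<le> 1 / 2"
  shows "- scale_fun b c y \<le> - scale_fun b c x + - scale_density b c x * (y - x)
    + (if c - 1 / 2 \<le> x then 2 * b * scale_density b c x else 0) / 2 * (y - x)\<^sup>2 + 4 * b\<^sup>2 * exp b * \<bar>y - x\<bar> ^ 3"
proof -
  have K: "0 \<le> 4 * b\<^sup>2 * exp b * \<bar>y - x\<bar> ^ 3" by simp
  consider "x < c - 1 / 2" | "c - 1 / 2 \<le> x" "x < c" | "c \<le> x" by linarith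
  then show ?thesis
  proof cases
    case 1
    then have "y \<le> c" using d by linarith
    then have "scale_fun b c y = scale_fun b c x + (y - x)" using 1 by (simp add: scale_fun_def)
    with 1 K show ?thesis by (simp add: scale_density_eq_1)
  next
    case 2
    show ?thesis
    proof (cases "y \<le> c")
      case True
      then have "scale_fun b c y = scale_fun b c x + (y - x)" using 2 by (simp add: scale_fun_def)
      moreover have "0 \<le> b * (y - x)\<^sup>2" using b by simp
      ultimately show ?thesis using 2 K by (simp add: scale_density_eq_1)
    next
      case False
      let ?d = "y - c"
      have d': "\<bar>?d\<bar> \<le> 1 / 2" "0 \<le> ?d" "?d \<le> y - x" using d False 2 by auto
      have "(1 - exp (- (2 * b * ?d))) / (2 * b) \<ge> ?d - b * ?d\<^sup>2 - 4 * b\<^sup>2 * exp b * \<bar>?d\<bar> ^ 3"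
        using exp_branch_taylor[OF b d'(1)] by linarith
      moreover have "b * ?d\<^sup>2 \<le> b * (y - x)\<^sup>2" using d' b by (intro mult_left_mono power_mono) auto
      moreover have "4 * b\<^sup>2 * exp b * \<bar>?d\<bar> ^ 3 \<le> 4 * b\<^sup>2 * exp b * \<bar>y - x\<bar> ^ 3"
        using d' b by (intro mult_left_mono power_mono) auto
      ultimately show ?thesis using 2 False by (simp add: scale_density_eq_1 scale_fun_def)
    qed
  next
    case 3
    let ?r = "(1 - exp (- (2 * b * (y - x)))) / (2 * b) - (y - x) + b * (y - x)\<^sup>2"
    have "scale_density b c x = exp (- (2 * b * (x - c)))" using 3 by (simp add: scale_density_def)
    then have "scale_fun b c y - scale_fun b c x \<ge> scale_density b c x * ((1 - exp (- (2 * b * (y - x)))) / (2 * b))"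
      using 3 exp_branch_diff[OF b, of y c x] scale_fun_ge_exp[OF b, of y c] by (simp add: scale_fun_upper_half[OF b])
    moreover have "- (4 * b\<^sup>2 * exp b * \<bar>y - x\<bar> ^ 3) \<le> scale_density b c x * ?r"
      by (rule mult_unit_interval_bounds[OF _ _ exp_branch_taylor[OF b d]]) (use scale_density_pos[of b c x] scale_density_le_1[OF b] in auto)
    ultimately show ?thesis using 3 by (simp add: algebra_simps)
  qed
qed

text \<open>\<open>p\<close> and \<open>q\<close> stand for the first two derivatives at
  \<open>x\<close>. An upper bound is all that a supermartingale inequality asks for, and it
  tolerates the jump of the second derivative. It is global in \<open>y\<close>, so that a Gaussian
  increment can be inserted without truncation.\<close>

definition cubic_bound :: "(real \<Rightarrow> real) \<Rightarrow> real \<Rightarrow> real \<Rightarrow> real \<Rightarrow> real \<Rightarrow> bool" where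
  "cubic_bound \<phi> p q K x \<longleftrightarrow> (\<forall>y. \<phi> y \<le> \<phi> x + p * (y - x) + q / 2 * (y - x)\<^sup>2 + K * \<bar>y - x\<bar> ^ 3)"

text \<open>At distance \<open>d > 1 / 2\<close> the cubic term dominates everything else:
  \<open>1 \<le> 8 d^3\<close>, \<open>d \<le> 4 d^3\<close> and \<open>d^2 \<le> 2 d^3\<close>.
  These give the contributions \<open>16 * B\<close>, \<open>4 * P\<close> and \<open>Q\<close> to
  the constant.\<close>

lemma cubic_bound_of_local:
  assumes bound: "\<And>y. \<bar>\<phi> y\<bar> \<le> B" and pq: "\<bar>p\<bar> \<le> P" "\<bar>q\<bar> \<le> Q" and K: "0 \<le> K"
    and local: "\<And>y. \<bar>y - x\<bar> \<le> 1 / 2 \<Longrightarrow> \<phi> y \<le> \<phi> x + p * (y - x) + q / 2 * (y - x)\<^sup>2 + K * \<bar>y - x\<bar> ^ 3"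
  shows "cubic_bound \<phi> p q (K + 16 * B + 4 * P + Q) x"
  unfolding cubic_bound_def
proof
  fix y
  let ?d = "\<bar>y - x\<bar>"
  have nn: "0 \<le> B" "0 \<le> P" "0 \<le> Q" using bound[of 0] pq by linarith+
  show "\<phi> y \<le> \<phi> x + p * (y - x) + q / 2 * (y - x)\<^sup>2 + (K + 16 * B + 4 * P + Q) * ?d ^ 3"
  proof (cases "?d \<le> 1 / 2")
    case True
    have "K * ?d ^ 3 \<le> (K + 16 * B + 4 * P + Q) * ?d ^ 3"
      using nn by (intro mult_right_mono) auto
    with local[OF True] show ?thesis by linarith
  next
    case False
    then have d: "1 \<le> 2 * ?d" by simp
    have d3: "1 \<le> 8 * ?d ^ 3" using power_mono[OF d, of 3] by (simp add: power_mult_distrib)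
    have d2: "1 \<le> 4 * ?d\<^sup>2" using power_mono[OF d, of 2] by (simp add: power_mult_distrib)
    have "?d * 1 \<le> ?d * (4 * ?d\<^sup>2)" by (rule mult_left_mono[OF d2]) simp
    then have d1: "?d \<le> 4 * ?d ^ 3" by (simp add: eval_nat_numeral)
    have "?d\<^sup>2 * 1 \<le> ?d\<^sup>2 * (2 * ?d)" by (rule mult_left_mono[OF d]) simp
    then have d22: "?d\<^sup>2 \<le> 2 * ?d ^ 3" by (simp add: eval_nat_numeral)
    have "- (p * (y - x)) \<le> \<bar>p * (y - x)\<bar>" by simp
    also have "\<dots> \<le> P * ?d" using pq by (simp add: abs_mult mult_right_mono)
    also have "\<dots> \<le> P * (4 * ?d ^ 3)" using d1 nn by (intro mult_left_mono) auto
    finally have 1: "- (p * (y - x)) \<le> 4 * P * ?d ^ 3" by simp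
    have "- (q / 2 * (y - x)\<^sup>2) \<le> \<bar>q / 2 * (y - x)\<^sup>2\<bar>" by simp
    also have "\<dots> \<le> Q / 2 * ?d\<^sup>2" using pq by (simp add: abs_mult mult_right_mono)
    also have "\<dots> \<le> Q / 2 * (2 * ?d ^ 3)" using d22 nn by (intro mult_left_mono) auto
    finally have 2: "- (q / 2 * (y - x)\<^sup>2) \<le> Q * ?d ^ 3" by simp
    have "2 * B * 1 \<le> 2 * B * (8 * ?d ^ 3)" using d3 nn by (intro mult_left_mono) auto
    moreover have "\<phi> y - \<phi> x \<le> 2 * B" using bound[of x] bound[of y] by linarith
    moreover have "0 \<le> K * ?d ^ 3" using K by simp
    ultimately show ?thesis using 1 2 by (simp add: algebra_simps)
  qed
qed

text \<open>Flattening \<open>scale_fun\<close> below \<open>l\<close> makes it bounded without affecting it near the points \<open>x \<ge> l + 1/2\<close>.\<close>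

lemma flat_scale_bound:
  assumes "0 < b" shows "\<bar>scale_fun b c (max y l)\<bar> \<le> \<bar>scale_fun b c l\<bar> + 1 / (2 * b)"
proof -
  have "0 < 1 / (2 * b)" using assms by simp
  then show ?thesis
    using scale_fun_mono[OF assms, of l "max y l" c] scale_fun_le_bound[OF assms, of c "max y l"]
    by linarith
qed

lemma cubic_bound_flat_scale_fun:
  assumes b: "0 < b"
  shows "\<exists>K\<ge>0. \<forall>x\<ge>l + 1 / 2. cubic_bound (\<lambda>y. scale_fun b c (max y l)) (scale_density b c x)
      (if c + 1 / 2 \<le> x then - (2 * b * scale_density b c x) else 0) K x" (is "\<exists>K\<ge>0. ?U K")
    and "\<exists>K\<ge>0. \<forall>x\<ge>l + 1 / 2. cubic_bound (\<lambda>y. - scale_fun b c (max y l)) (- scale_density b c x)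
      (if c - 1 / 2 \<le> x then 2 * b * scale_density b c x else 0) K x" (is "\<exists>K\<ge>0. ?L K")
proof -
  \<comment> \<open>This is the constant of \<open>cubic_bound_of_local\<close> with
    \<open>P = 1\<close> and \<open>Q = 2 * b\<close>; it does not depend on
    \<open>x\<close>.\<close>
  let ?K = "4 * b\<^sup>2 * exp b + 16 * (\<bar>scale_fun b c l\<bar> + 1 / (2 * b)) + 4 * 1 + 2 * b"
  have K: "0 \<le> ?K" using b by simp
  have s: "\<bar>scale_density b c x\<bar> \<le> 1" "\<bar>2 * b * scale_density b c x\<bar> \<le> 2 * b" for x
    using scale_density_pos[of b c x] scale_density_le_1[OF b, of c x] b by (auto simp: abs_mult mult_left_le)
  have max: "max y l = y" "max x l = x" if "l + 1 / 2 \<le> x" "\<bar>y - x\<bar> \<le> 1 / 2" for x y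
    using that by linarith+
  have "?U ?K"
  proof (intro allI impI cubic_bound_of_local)
    fix x assume x: "l + 1 / 2 \<le> x"
    show "\<bar>if c + 1 / 2 \<le> x then - (2 * b * scale_density b c x) else 0\<bar> \<le> 2 * b" using s[of x] b by auto
    fix y assume "\<bar>y - x\<bar> \<le> 1 / 2"
    from scale_fun_taylor_upper[OF b this, of c] max[OF x this]
    show "scale_fun b c (max y l) \<le> scale_fun b c (max x l) + scale_density b c x * (y - x)
      + (if c + 1 / 2 \<le> x then - (2 * b * scale_density b c x) else 0) / 2 * (y - x)\<^sup>2 + 4 * b\<^sup>2 * exp b * \<bar>y - x\<bar> ^ 3"
      by simp
  qed (use b s flat_scale_bound in auto)
  with K show "\<exists>K\<ge>0. ?U K" by blast
  have "?L ?K"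
  proof (intro allI impI cubic_bound_of_local)
    fix x assume x: "l + 1 / 2 \<le> x"
    show "\<bar>if c - 1 / 2 \<le> x then 2 * b * scale_density b c x else 0\<bar> \<le> 2 * b" using s[of x] b by auto
    fix y assume "\<bar>y - x\<bar> \<le> 1 / 2"
    from scale_fun_taylor_lower[OF b this, of c] max[OF x this]
    show "- scale_fun b c (max y l) \<le> - scale_fun b c (max x l) + - scale_density b c x * (y - x)
      + (if c - 1 / 2 \<le> x then 2 * b * scale_density b c x else 0) / 2 * (y - x)\<^sup>2 + 4 * b\<^sup>2 * exp b * \<bar>y - x\<bar> ^ 3"
      by simp
  qed (use b s flat_scale_bound in auto)
  with K show "\<exists>K\<ge>0. ?L K" by blast
qed

section \<open>Increments of Brownian motion\<close>

context brownian_motion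
begin

lemma sets_F: "A \<in> sets (F t) \<Longrightarrow> A \<in> sets M"
  using subalgebra_F[of t] by (auto simp: subalgebra_def)

lemma measurable_F_mono: "f \<in> measurable (F s) N \<Longrightarrow> s \<le> t \<Longrightarrow> f \<in> measurable (F t) N"
  using sets_F_mono[of s t] by (auto simp: measurable_def space_F)

lemma measurable_F: "f \<in> measurable (F t) N \<Longrightarrow> f \<in> measurable M N"
  using subalgebra_F[of t] by (auto simp: measurable_def subalgebra_def)

lemma measurable_W: "0 \<le> t \<Longrightarrow> W t \<in> borel_measurable M"
  using adapted measurable_F by blast

text \<open>The bounds come from the explicit normal moments and
  \<open>1 / 2 \<le> sqrt (2 / pi) \<le> 1\<close>. The lower bound on the first absolute moment
  serves the unboundedness of the paths; the other moments control the error of a time step.\<close>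

lemma increment_moments:
  assumes "0 \<le> s" "0 < h"
  defines "Z \<equiv> (\<lambda>\<omega>. W (s + h) \<omega> - W s \<omega>)"
  shows "integrable M Z" "expectation Z = 0"
    and "integrable M (\<lambda>\<omega>. (Z \<omega>)\<^sup>2)" "expectation (\<lambda>\<omega>. (Z \<omega>)\<^sup>2) = h"
    and "integrable M (\<lambda>\<omega>. \<bar>Z \<omega>\<bar>)" "expectation (\<lambda>\<omega>. \<bar>Z \<omega>\<bar>) \<le> sqrt h"
    and "integrable M (\<lambda>\<omega>. \<bar>Z \<omega>\<bar> ^ 3)" "expectation (\<lambda>\<omega>. \<bar>Z \<omega>\<bar> ^ 3) \<le> 2 * (h * sqrt h)"
    and "sqrt h / 2 \<le> expectation (\<lambda>\<omega>. \<bar>Z \<omega>\<bar>)"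
proof -
  have D: "distributed M lborel Z (normal_density 0 (sqrt h))"
    using gaussian_increments[of s "s + h"] assms by simp
  have pos: "0 < sqrt h" using assms by simp
  have moment: "integrable M (\<lambda>\<omega>. g (Z \<omega>)) \<and> expectation (\<lambda>\<omega>. g (Z \<omega>)) = I"
    if "has_bochner_integral lborel (\<lambda>x. normal_density 0 (sqrt h) x * g x) I" "g \<in> borel_measurable borel" for g I
  proof -
    have g: "g \<in> borel_measurable lborel" using that by simp
    show ?thesis
      using distributed_integral[OF D g] distributed_integrable[OF D g] that(1)
      by (auto simp: has_bochner_integral_iff)
  qed
  have pi: "sqrt (2 / pi) \<le> 1"
    using pi_gt3 by (simp add: divide_le_eq_1)
  have pi': "1 / 2 \<le> sqrt (2 / pi)"
    using pi_less_4 by (intro real_le_rsqrt) (simp add: power2_eq_square field_simps)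
  have h3: "sqrt h ^ 3 = h * sqrt h"
    using assms by (simp add: eval_nat_numeral)
  have "has_bochner_integral lborel (\<lambda>x. normal_density 0 (sqrt h) x * x) 0"
    using normal_moment_odd[OF pos, of 0 0] by simp
  from moment[OF this] show "integrable M Z" "expectation Z = 0" by auto
  have "has_bochner_integral lborel (\<lambda>x. normal_density 0 (sqrt h) x * x\<^sup>2) h"
    using normal_moment_even[OF pos, of 0 1] assms by simp
  from moment[OF this] show "integrable M (\<lambda>\<omega>. (Z \<omega>)\<^sup>2)" "expectation (\<lambda>\<omega>. (Z \<omega>)\<^sup>2) = h" by auto
  have "has_bochner_integral lborel (\<lambda>x. normal_density 0 (sqrt h) x * \<bar>x\<bar>) (sqrt h * sqrt (2 / pi))"
    using normal_moment_abs_odd[OF pos, of 0 0] by simp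
  from moment[OF this] show "integrable M (\<lambda>\<omega>. \<bar>Z \<omega>\<bar>)" "expectation (\<lambda>\<omega>. \<bar>Z \<omega>\<bar>) \<le> sqrt h"
    "sqrt h / 2 \<le> expectation (\<lambda>\<omega>. \<bar>Z \<omega>\<bar>)"
    using mult_left_le[OF pi, of "sqrt h"] mult_left_mono[OF pi', of "sqrt h"] assms by auto
  have "has_bochner_integral lborel (\<lambda>x. normal_density 0 (sqrt h) x * \<bar>x\<bar> ^ 3) (2 * (h * sqrt h) * sqrt (2 / pi))"
    using normal_moment_abs_odd[OF pos, of 0 1] h3 assms(2) by (simp add: numeral_3_eq_3[symmetric] mult_ac del: power_Suc)
  from moment[OF this] show "integrable M (\<lambda>\<omega>. \<bar>Z \<omega>\<bar> ^ 3)" "expectation (\<lambda>\<omega>. \<bar>Z \<omega>\<bar> ^ 3) \<le> 2 * (h * sqrt h)"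
    using mult_left_le[OF pi, of "2 * (h * sqrt h)"] assms by auto
qed

text \<open>This takes the place of conditional expectations: a factor known at time
  \<open>s\<close> separates from any function of the later increment, by independence of the
  generated sigma-algebras.\<close>

lemma past_increment_product:
  assumes U: "U \<in> borel_measurable (F s)" "integrable M U" and "0 \<le> s" "0 < h"
    and g: "g \<in> borel_measurable borel" "integrable M (\<lambda>\<omega>. g (W (s + h) \<omega> - W s \<omega>))"
  shows "integrable M (\<lambda>\<omega>. U \<omega> * g (W (s + h) \<omega> - W s \<omega>))"
    and "expectation (\<lambda>\<omega>. U \<omega> * g (W (s + h) \<omega> - W s \<omega>))
      = expectation U * expectation (\<lambda>\<omega>. g (W (s + h) \<omega> - W s \<omega>) :: real)"
proof -
  let ?Z = "\<lambda>\<omega>. W (s + h) \<omega> - W s \<omega>"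
  let ?U = "{U -` A \<inter> space M | A. A \<in> sets borel}" and ?V = "{?Z -` B \<inter> space M | B. B \<in> sets borel}"
  have Z: "?Z \<in> borel_measurable M" using assms measurable_W by simp
  have sub: "?U \<subseteq> sets (F s)"
    using measurable_sets[OF U(1)] by (auto simp: space_F)
  have stable: "Int_stable {f -` A \<inter> space M | A. A \<in> sets borel}" for f :: "'w \<Rightarrow> real"
  proof (rule Int_stableI)
    fix a b assume "a \<in> {f -` A \<inter> space M | A. A \<in> sets borel}" "b \<in> {f -` A \<inter> space M | A. A \<in> sets borel}"
    then obtain A B where "A \<in> sets borel" "B \<in> sets borel" "a = f -` A \<inter> space M" "b = f -` B \<inter> space M" by blast
    then show "a \<inter> b \<in> {f -` A \<inter> space M | A. A \<in> sets borel}"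
      by (intro CollectI exI[of _ "A \<inter> B"]) auto
  qed
  have "indep_set (sets (F s)) ?V"
    using indep_increments[of s "s + h"] assms by simp
  then have "indep_set ?U ?V"
    unfolding indep_set_def by (rule indep_sets_mono_sets) (use sub in \<open>auto split: bool.split\<close>)
  then have "indep_set (sigma_sets (space M) ?U) (sigma_sets (space M) ?V)"
    by (rule indep_set_sigma_sets[OF _ stable stable])
  then have "indep_var borel U borel ?Z"
    unfolding indep_var_eq using measurable_F[OF U(1)] Z by blast
  then have "indep_var borel ((\<lambda>x. x) \<circ> U) borel (g \<circ> ?Z)"
    by (rule indep_var_compose) (use g in auto)
  then have I: "indep_var borel U borel (\<lambda>\<omega>. g (?Z \<omega>))" by (simp add: comp_def)
  show "integrable M (\<lambda>\<omega>. U \<omega> * g (?Z \<omega>))"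
    by (rule indep_var_integrable[OF I U(2) g(2)])
  show "expectation (\<lambda>\<omega>. U \<omega> * g (?Z \<omega>)) = expectation U * expectation (\<lambda>\<omega>. g (?Z \<omega>))"
    by (rule indep_var_lebesgue_integral[OF I U(2) g(2)])
qed

text \<open>By Fubini the mean is the integral of the variances \<open>u - t\<close> over the step.
  On the exceptional null set of discontinuous paths the time integral need not be measurable in the
  sample point, so a measurable version \<open>J\<close> is supplied.\<close>

lemma quadratic_oscillation:
  assumes t: "0 \<le> t" "0 < h"
  obtains J where "integrable M J" "expectation J \<le> h\<^sup>2" "\<And>\<omega>. 0 \<le> J \<omega>"
    "AE \<omega> in M. (LINT u:{t..t + h}|lborel. (W u \<omega> - W t \<omega>)\<^sup>2) = J \<omega>"
proof -
  obtain N where N: "{\<omega> \<in> space M. \<not> continuous_on {0..} (\<lambda>t. W t \<omega>)} \<subseteq> N" "emeasure M N = 0" "N \<in> sets M"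
    using AE_E[OF continuous_paths] by blast
  have AE_N: "AE \<omega> in M. \<omega> \<notin> N" using N by (intro AE_not_in) (auto simp: null_sets_def)
  \<comment> \<open>Making every path continuous gives joint measurability in time and sample point.\<close>
  define V where "V u \<omega> = (if \<omega> \<in> N then 0 else W (max 0 u) \<omega>)" for u \<omega>
  have V_meas: "V u \<in> borel_measurable M" for u
    unfolding V_def using N measurable_W[of "max 0 u"] by (intro measurable_If_set) auto
  have V_cont: "continuous_on UNIV (\<lambda>u. V u \<omega>)" if "\<omega> \<in> space M" for \<omega>
  proof (cases "\<omega> \<in> N")
    case False
    then have c: "continuous_on {0..} (\<lambda>t. W t \<omega>)" using N that by auto
    have "continuous_on UNIV (\<lambda>u. W (max 0 u) \<omega>)"
      by (rule continuous_on_compose2[OF c]) (auto intro!: continuous_intros)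
    then show ?thesis using False by (simp add: V_def)
  qed (simp add: V_def)
  \<comment> \<open>The value at \<open>u\<close> is the limit of the values at \<open>u\<close>
    rounded down to multiples of \<open>1 / k\<close>. For fixed \<open>k\<close> only countably
    many times occur, so these approximations are jointly measurable.\<close>
  have joint: "(\<lambda>(u, \<omega>). V u \<omega>) \<in> borel_measurable (lborel \<Otimes>\<^sub>M M)"
  proof (rule borel_measurable_LIMSEQ_real)
    fix z :: "real \<times> 'w" assume "z \<in> space (lborel \<Otimes>\<^sub>M M)"
    then obtain u :: real and \<omega> where z: "z = (u, \<omega>)" "\<omega> \<in> space M" by (auto simp: space_pair_measure)
    have "isCont (\<lambda>u. V u \<omega>) u" using V_cont[OF z(2)] by (simp add: continuous_on_eq_continuous_at)
    then have "(\<lambda>k. V (real_of_int \<lfloor>real k * u\<rfloor> / real k) \<omega>) \<longlonglongrightarrow> V u \<omega>"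
      by (rule isCont_tendsto_compose) (rule floor_approximation)
    then show "(\<lambda>k. case z of (u, \<omega>) \<Rightarrow> V (real_of_int \<lfloor>real k * u\<rfloor> / real k) \<omega>) \<longlonglongrightarrow> (case z of (u, \<omega>) \<Rightarrow> V u \<omega>)"
      using z by simp
  next
    fix k :: nat
    have "(\<lambda>z. V (real_of_int \<lfloor>real k * fst z\<rfloor> / real k) (snd z)) \<in> borel_measurable (lborel \<Otimes>\<^sub>M M)"
    proof (rule measurable_compose_countable[where f="\<lambda>i z. V (real_of_int i / real k) (snd z)" and g="\<lambda>z. \<lfloor>real k * fst z\<rfloor>"])
      show "(\<lambda>z. V (real_of_int i / real k) (snd z)) \<in> borel_measurable (lborel \<Otimes>\<^sub>M M)" for i
        using V_meas by measurable
      show "(\<lambda>z. \<lfloor>real k * fst z\<rfloor>) \<in> lborel \<Otimes>\<^sub>M M \<rightarrow>\<^sub>M count_space UNIV" by measurable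
    qed
    then show "(\<lambda>z. case z of (u, \<omega>) \<Rightarrow> V (real_of_int \<lfloor>real k * u\<rfloor> / real k) \<omega>) \<in> borel_measurable (lborel \<Otimes>\<^sub>M M)"
      by (simp add: case_prod_beta)
  qed
  let ?g = "\<lambda>u \<omega>. (V u \<omega> - V t \<omega>)\<^sup>2 * indicator {t..t + h} u :: real"
  have g_meas: "(\<lambda>(u, \<omega>). ?g u \<omega>) \<in> borel_measurable (lborel \<Otimes>\<^sub>M M)"
  proof -
    have [measurable]: "(\<lambda>z. V (fst z) (snd z)) \<in> borel_measurable (lborel \<Otimes>\<^sub>M M)"
      using joint by (simp add: case_prod_beta)
    have [measurable]: "V t \<in> borel_measurable M" by (rule V_meas)
    show ?thesis unfolding case_prod_beta by measurable
  qed
  have g_meas1: "(\<lambda>u. ?g u \<omega>) \<in> borel_measurable lborel" if "\<omega> \<in> space M" for \<omega>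
  proof -
    have [measurable]: "(\<lambda>u. V u \<omega>) \<in> borel_measurable borel"
      by (rule borel_measurable_continuous_onI[OF V_cont[OF that]])
    show ?thesis by measurable
  qed
  define J where "J \<omega> = enn2real (\<integral>\<^sup>+u. ennreal (?g u \<omega>) \<partial>lborel)" for \<omega>
  have J_eq: "(\<integral>u. ?g u \<omega> \<partial>lborel) = J \<omega>" if "\<omega> \<in> space M" for \<omega>
    unfolding J_def by (rule integral_eq_nn_integral) (use g_meas1[OF that] in auto)
  have "(\<lambda>\<omega>. \<integral>\<^sup>+u. ennreal (?g u \<omega>) \<partial>lborel) \<in> borel_measurable M"
  proof (rule lborel.borel_measurable_nn_integral)
    show "(\<lambda>(\<omega>, u). ennreal (?g u \<omega>)) \<in> borel_measurable (M \<Otimes>\<^sub>M lborel)"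
      using measurable_compose[OF measurable_pair_swap'[of M lborel] measurable_compose[OF g_meas measurable_ennreal]]
      by (simp add: case_prod_beta)
  qed
  then have J_meas: "J \<in> borel_measurable M" unfolding J_def by measurable
  \<comment> \<open>Bounding the variance \<open>u - t\<close> by \<open>h\<close> is crude but
    enough: integration over the step gives \<open>h\<^sup>2\<close>.\<close>
  have second: "(\<integral>\<^sup>+\<omega>. ennreal (?g u \<omega>) \<partial>M) \<le> ennreal h * indicator {t..t + h} u" for u
  proof (cases "u \<in> {t..t + h}")
    case u: True
    show ?thesis
    proof (cases "u = t")
      case False
      then have ut: "0 < u - t" "u - t \<le> h" "0 \<le> u" using u t by auto
      have "(\<integral>\<^sup>+\<omega>. ennreal (?g u \<omega>) \<partial>M) = (\<integral>\<^sup>+\<omega>. ennreal ((W (t + (u - t)) \<omega> - W t \<omega>)\<^sup>2) \<partial>M)"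
        by (rule nn_integral_cong_AE) (use AE_N u ut t in \<open>auto simp: V_def\<close>)
      also have "\<dots> = ennreal (u - t)"
        using nn_integral_eq_integral[OF increment_moments(3)[OF t(1) ut(1)]] increment_moments(4)[OF t(1) ut(1)]
        by simp
      finally show ?thesis using u ut by (simp add: ennreal_leI)
    qed (use u in simp)
  qed simp
  have "(\<integral>\<^sup>+\<omega>. ennreal (J \<omega>) \<partial>M) \<le> (\<integral>\<^sup>+\<omega>. (\<integral>\<^sup>+u. ennreal (?g u \<omega>) \<partial>lborel) \<partial>M)"
    unfolding J_def by (intro nn_integral_mono) (simp add: ennreal_enn2real_if)
  also have "\<dots> = (\<integral>\<^sup>+u. (\<integral>\<^sup>+\<omega>. ennreal (?g u \<omega>) \<partial>M) \<partial>lborel)"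
  proof -
    interpret P: pair_sigma_finite lborel M ..
    show ?thesis using P.Fubini[OF measurable_compose[OF g_meas measurable_ennreal]]
      by (simp add: case_prod_beta)
  qed
  also have "\<dots> \<le> (\<integral>\<^sup>+u. ennreal h * indicator {t..t + h} u \<partial>lborel)"
    by (intro nn_integral_mono second)
  also have "\<dots> = ennreal (h\<^sup>2)"
    using t by (simp add: nn_integral_cmult_indicator power2_eq_square ennreal_mult[symmetric])
  finally have nn: "(\<integral>\<^sup>+\<omega>. ennreal (J \<omega>) \<partial>M) \<le> ennreal (h\<^sup>2)" .
  have J_nn: "0 \<le> J \<omega>" for \<omega> by (simp add: J_def)
  have "integrable M J"
    using J_meas J_nn nn by (intro integrableI_nonneg) (auto intro: le_less_trans)
  moreover have "expectation J \<le> h\<^sup>2"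
    using J_meas J_nn nn by (subst integral_eq_nn_integral) (auto intro!: enn2real_leI)
  moreover have "AE \<omega> in M. (LINT u:{t..t + h}|lborel. (W u \<omega> - W t \<omega>)\<^sup>2) = J \<omega>"
    using AE_N AE_space
  proof eventually_elim
    case (elim \<omega>)
    have "(LINT u:{t..t + h}|lborel. (W u \<omega> - W t \<omega>)\<^sup>2) = (\<integral>u. ?g u \<omega> \<partial>lborel)"
      unfolding set_lebesgue_integral_def
      by (rule Bochner_Integration.integral_cong) (use elim t in \<open>auto simp: V_def split: split_indicator\<close>)
    then show ?case using J_eq elim by simp
  qed
  ultimately show ?thesis using that J_nn by blast
qed

end

section \<open>The estimate for one time step and measurability of the phases\<close>

lemma power3_add_le:
  fixes u v :: real assumes "0 \<le> u" "0 \<le> v"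
  shows "(u + v) ^ 3 \<le> 4 * (u ^ 3 + v ^ 3)"
proof -
  have "4 * (u ^ 3 + v ^ 3) - (u + v) ^ 3 = 3 * ((u + v) * (u - v)\<^sup>2)"
    by (simp add: eval_nat_numeral algebra_simps)
  moreover have "0 \<le> 3 * ((u + v) * (u - v)\<^sup>2)" using assms by simp
  ultimately show ?thesis by linarith
qed

context brownian_motion
begin

text \<open>The increment of \<open>X\<close> is \<open>z + D\<close> with \<open>z\<close> Gaussian
  and independent of the past and \<open>\<bar>D\<bar> \<le> L * h\<close>. In the expansion,
  \<open>p z\<close> and \<open>q / 2 * (z\<^sup>2 - h)\<close> have mean zero on \<open>A\<close>,
  since \<open>A\<close>, \<open>p\<close> and \<open>q\<close> are known at time \<open>t\<close>.
  The terms \<open>p D + q / 2 * h\<close> are the generator, bounded by \<open>R\<close>. The rest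
  is of order \<open>h * sqrt h\<close>.\<close>

lemma one_step:
  fixes X :: "real \<Rightarrow> 'w \<Rightarrow> real"
  assumes t: "0 \<le> t" "0 < h" "h \<le> 1" and A: "A \<in> sets (F t)"
    and X: "X t \<in> borel_measurable (F t)" "X (t + h) \<in> borel_measurable M"
    and meas: "\<phi> \<in> borel_measurable borel" "p \<in> borel_measurable borel" "q \<in> borel_measurable borel"
    and bound: "\<And>x. \<bar>\<phi> x\<bar> \<le> B" "\<And>x. \<bar>p x\<bar> \<le> P" "\<And>x. \<bar>q x\<bar> \<le> Q"
    and K: "0 \<le> K" and L: "0 \<le> L"
    and R: "integrable M R"
    and drift: "AE \<omega> in M. \<bar>X (t + h) \<omega> - X t \<omega> - (W (t + h) \<omega> - W t \<omega>)\<bar> \<le> L * h"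
    and cubic: "AE \<omega> in M. \<omega> \<in> A \<longrightarrow> cubic_bound \<phi> (p (X t \<omega>)) (q (X t \<omega>)) K (X t \<omega>)"
    and generator: "AE \<omega> in M. \<omega> \<in> A \<longrightarrow>
      p (X t \<omega>) * (X (t + h) \<omega> - X t \<omega> - (W (t + h) \<omega> - W t \<omega>)) + q (X t \<omega>) / 2 * h \<le> R \<omega>"
  shows "expectation (\<lambda>\<omega>. indicator A \<omega> * (\<phi> (X (t + h) \<omega>) - \<phi> (X t \<omega>)))
    \<le> expectation (\<lambda>\<omega>. indicator A \<omega> * R \<omega>) + (Q * L + Q * L\<^sup>2 + 8 * K + 4 * K * L ^ 3) * (h * sqrt h)"
proof -
  define Z where "Z \<omega> = W (t + h) \<omega> - W t \<omega>" for \<omega>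
  note m = increment_moments[OF t(1,2), folded Z_def]
  have A_M: "A \<in> sets M" using A sets_F by blast
  have [measurable]: "X t \<in> borel_measurable M" "X (t + h) \<in> borel_measurable M" "A \<in> sets M"
    "\<phi> \<in> borel_measurable borel"
    using X measurable_F A_M meas by blast+
  have [measurable]: "R \<in> borel_measurable M" using R by auto
  have nn: "0 \<le> B" "0 \<le> P" "0 \<le> Q" using bound[of 0] by (auto intro: order_trans[OF abs_ge_zero])
  have U1: "(\<lambda>\<omega>. indicator A \<omega> * p (X t \<omega>)) \<in> borel_measurable (F t)"
    and U2: "(\<lambda>\<omega>. indicator A \<omega> * (q (X t \<omega>) / 2)) \<in> borel_measurable (F t)"
    using measurable_compose[OF X(1) meas(2)] measurable_compose[OF X(1) meas(3)] A by simp_all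
  have I1: "integrable M (\<lambda>\<omega>. indicator A \<omega> * p (X t \<omega>))"
    using measurable_F[OF U1] bound(2) nn
    by (intro integrable_const_bound[where B=P]) (auto simp: abs_mult split: split_indicator)
  have I2: "integrable M (\<lambda>\<omega>. indicator A \<omega> * (q (X t \<omega>) / 2))"
    using measurable_F[OF U2] bound(3) nn
    by (intro integrable_const_bound[where B="Q / 2"]) (auto simp: abs_mult split: split_indicator)
  have E1: "integrable M (\<lambda>\<omega>. indicator A \<omega> * p (X t \<omega>) * Z \<omega>)"
    "expectation (\<lambda>\<omega>. indicator A \<omega> * p (X t \<omega>) * Z \<omega>) = 0"
    using past_increment_product[OF U1 I1 t(1,2), of "\<lambda>z. z"] m(1,2) by (auto simp: Z_def)
  have m2: "integrable M (\<lambda>\<omega>. (Z \<omega>)\<^sup>2 - h)" "expectation (\<lambda>\<omega>. (Z \<omega>)\<^sup>2 - h) = 0"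
    using m(3,4) by (auto simp: prob_space)
  have E2: "integrable M (\<lambda>\<omega>. indicator A \<omega> * (q (X t \<omega>) / 2) * ((Z \<omega>)\<^sup>2 - h))"
    "expectation (\<lambda>\<omega>. indicator A \<omega> * (q (X t \<omega>) / 2) * ((Z \<omega>)\<^sup>2 - h)) = 0"
    using past_increment_product[OF U2 I2 t(1,2), of "\<lambda>z. z\<^sup>2 - h"] m2 by (auto simp: Z_def)
  have E3: "integrable M (\<lambda>\<omega>. indicator A \<omega> * R \<omega>)"
    using integrable_mult_indicator[OF A_M R] by simp
  \<comment> \<open>\<open>G\<close> bounds the leftover terms: the cross terms of
    \<open>q / 2 * (z + D)\<^sup>2\<close> and the cubic error, the latter split by
    \<open>power3_add_le\<close>.\<close>
  define G where "G \<omega> = Q * L * h * \<bar>Z \<omega>\<bar> + Q / 2 * L\<^sup>2 * h\<^sup>2 + 4 * K * \<bar>Z \<omega>\<bar> ^ 3 + 4 * K * L ^ 3 * h ^ 3" for \<omega>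
  have G_int: "integrable M G" unfolding G_def using m(5,7) by auto
  have G_nn: "0 \<le> G \<omega>" for \<omega>
    unfolding G_def using nn K L t by (intro add_nonneg_nonneg mult_nonneg_nonneg) auto
  have left: "integrable M (\<lambda>\<omega>. indicator A \<omega> * (\<phi> (X (t + h) \<omega>) - \<phi> (X t \<omega>)))"
  proof (rule integrable_const_bound[where B="2 * B"])
    show "AE \<omega> in M. norm (indicator A \<omega> * (\<phi> (X (t + h) \<omega>) - \<phi> (X t \<omega>))) \<le> 2 * B"
    proof (intro AE_I2)
      fix \<omega>
      show "norm (indicator A \<omega> * (\<phi> (X (t + h) \<omega>) - \<phi> (X t \<omega>))) \<le> 2 * B"
        using bound(1)[of "X (t + h) \<omega>"] bound(1)[of "X t \<omega>"] nn(1) by (auto split: split_indicator)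
    qed
  qed measurable
  have "expectation (\<lambda>\<omega>. indicator A \<omega> * (\<phi> (X (t + h) \<omega>) - \<phi> (X t \<omega>)))
    \<le> expectation (\<lambda>\<omega>. indicator A \<omega> * p (X t \<omega>) * Z \<omega> + indicator A \<omega> * (q (X t \<omega>) / 2) * ((Z \<omega>)\<^sup>2 - h)
      + indicator A \<omega> * R \<omega> + G \<omega>)"
  proof (rule integral_mono_AE[OF left])
    show "AE \<omega> in M. indicator A \<omega> * (\<phi> (X (t + h) \<omega>) - \<phi> (X t \<omega>)) \<le> indicator A \<omega> * p (X t \<omega>) * Z \<omega>
      + indicator A \<omega> * (q (X t \<omega>) / 2) * ((Z \<omega>)\<^sup>2 - h) + indicator A \<omega> * R \<omega> + G \<omega>"
      using drift cubic generator
    proof eventually_elim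
      case (elim \<omega>)
      show ?case
      proof (cases "\<omega> \<in> A")
        case True
        define D where "D = X (t + h) \<omega> - X t \<omega> - (W (t + h) \<omega> - W t \<omega>)"
        define z where "z = Z \<omega>"
        have Xd: "X (t + h) \<omega> - X t \<omega> = z + D" by (simp add: D_def z_def Z_def)
        have D: "\<bar>D\<bar> \<le> L * h" using elim(1) by (simp add: D_def)
        have gen: "p (X t \<omega>) * D + q (X t \<omega>) / 2 * h \<le> R \<omega>" using elim(3) True by (simp add: D_def)
        have cub: "\<phi> (X (t + h) \<omega>) - \<phi> (X t \<omega>) \<le> p (X t \<omega>) * (z + D) + q (X t \<omega>) / 2 * (z + D)\<^sup>2 + K * \<bar>z + D\<bar> ^ 3"
        proof -
          have "\<phi> (X (t + h) \<omega>) \<le> \<phi> (X t \<omega>) + p (X t \<omega>) * (X (t + h) \<omega> - X t \<omega>)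
              + q (X t \<omega>) / 2 * (X (t + h) \<omega> - X t \<omega>)\<^sup>2 + K * \<bar>X (t + h) \<omega> - X t \<omega>\<bar> ^ 3"
            using elim(2) True unfolding cubic_bound_def by blast
          then show ?thesis unfolding Xd by linarith
        qed
        have "\<bar>z + D\<bar> ^ 3 \<le> (\<bar>z\<bar> + L * h) ^ 3"
          by (rule power_mono) (use D in auto)
        also have "\<dots> \<le> 4 * (\<bar>z\<bar> ^ 3 + (L * h) ^ 3)"
          by (rule power3_add_le) (use L t in auto)
        finally have c3: "K * \<bar>z + D\<bar> ^ 3 \<le> K * (4 * (\<bar>z\<bar> ^ 3 + (L * h) ^ 3))"
          using K by (rule mult_left_mono)
        have "\<bar>2 * z * D + D\<^sup>2\<bar> \<le> 2 * \<bar>z\<bar> * \<bar>D\<bar> + \<bar>D\<bar>\<^sup>2"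
          using abs_triangle_ineq[of "2 * z * D" "D\<^sup>2"] by (simp add: abs_mult)
        also have "\<dots> \<le> 2 * \<bar>z\<bar> * (L * h) + (L * h)\<^sup>2"
          using D by (intro add_mono mult_left_mono power_mono) auto
        finally have "\<bar>q (X t \<omega>) / 2 * (2 * z * D + D\<^sup>2)\<bar> \<le> Q / 2 * (2 * \<bar>z\<bar> * (L * h) + (L * h)\<^sup>2)"
          unfolding abs_mult using bound(3)[of "X t \<omega>"] by (intro mult_mono) auto
        then have c2: "q (X t \<omega>) / 2 * (2 * z * D + D\<^sup>2) \<le> Q / 2 * (2 * \<bar>z\<bar> * (L * h) + (L * h)\<^sup>2)"
          by (rule order_trans[OF abs_ge_self])
        have "(z + D)\<^sup>2 = (z\<^sup>2 - h) + h + (2 * z * D + D\<^sup>2)" by (simp add: power2_eq_square algebra_simps)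
        then have "q (X t \<omega>) / 2 * (z + D)\<^sup>2 = q (X t \<omega>) / 2 * (z\<^sup>2 - h) + q (X t \<omega>) / 2 * h + q (X t \<omega>) / 2 * (2 * z * D + D\<^sup>2)"
          by (simp only: distrib_left)
        then have "\<phi> (X (t + h) \<omega>) - \<phi> (X t \<omega>) \<le> p (X t \<omega>) * z + q (X t \<omega>) / 2 * (z\<^sup>2 - h) + R \<omega>
            + (Q / 2 * (2 * \<bar>z\<bar> * (L * h) + (L * h)\<^sup>2) + K * (4 * (\<bar>z\<bar> ^ 3 + (L * h) ^ 3)))"
          using cub gen c2 c3 distrib_left[of "p (X t \<omega>)" z D] by linarith
        also have "Q / 2 * (2 * \<bar>z\<bar> * (L * h) + (L * h)\<^sup>2) + K * (4 * (\<bar>z\<bar> ^ 3 + (L * h) ^ 3)) = G \<omega>"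
          by (simp add: G_def z_def algebra_simps power_mult_distrib)
        finally show ?thesis using True by (simp add: z_def)
      qed (use G_nn in simp)
    qed
  qed (use E1 E2 E3 G_int in auto)
  also have "\<dots> = expectation (\<lambda>\<omega>. indicator A \<omega> * R \<omega>) + expectation G"
    using E1 E2 E3 G_int by simp
  also have "expectation G \<le> (Q * L + Q * L\<^sup>2 + 8 * K + 4 * K * L ^ 3) * (h * sqrt h)"
  proof -
    have h: "h * h \<le> h * sqrt h"
    proof (rule mult_left_mono)
      have "h * h \<le> h" using t by (simp add: mult_left_le)
      then show "h \<le> sqrt h" using t by (simp add: real_le_rsqrt power2_eq_square)
    qed (use t in simp)
    have h3: "h ^ 3 \<le> h * sqrt h"
    proof -
      have "h ^ 3 = h * h * h" by (simp add: power3_eq_cube)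
      also have "\<dots> \<le> h * h" using t by (intro mult_left_le) auto
      finally show ?thesis using h by (rule order_trans)
    qed
    have "expectation G = Q * L * h * expectation (\<lambda>\<omega>. \<bar>Z \<omega>\<bar>) + Q / 2 * L\<^sup>2 * h\<^sup>2
        + 4 * K * expectation (\<lambda>\<omega>. \<bar>Z \<omega>\<bar> ^ 3) + 4 * K * L ^ 3 * h ^ 3"
      unfolding G_def using m(5,7) by (simp add: prob_space)
    also have "\<dots> \<le> Q * L * h * sqrt h + Q * L\<^sup>2 * (h * sqrt h)
        + 4 * K * (2 * (h * sqrt h)) + 4 * K * L ^ 3 * (h * sqrt h)"
    proof (intro add_mono)
      show "Q * L * h * expectation (\<lambda>\<omega>. \<bar>Z \<omega>\<bar>) \<le> Q * L * h * sqrt h"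
        using m(6) nn L t by (intro mult_left_mono) auto
      have "Q / 2 * L\<^sup>2 * h\<^sup>2 \<le> Q / 2 * L\<^sup>2 * (h * sqrt h)"
        unfolding power2_eq_square[of h] by (rule mult_left_mono[OF h]) (use nn in simp)
      also have "\<dots> \<le> Q * L\<^sup>2 * (h * sqrt h)"
        using nn t by (intro mult_right_mono) auto
      finally show "Q / 2 * L\<^sup>2 * h\<^sup>2 \<le> Q * L\<^sup>2 * (h * sqrt h)" .
      show "4 * K * expectation (\<lambda>\<omega>. \<bar>Z \<omega>\<bar> ^ 3) \<le> 4 * K * (2 * (h * sqrt h))"
        using m(8) K by (intro mult_left_mono) auto
      show "4 * K * L ^ 3 * h ^ 3 \<le> 4 * K * L ^ 3 * (h * sqrt h)"
        using h3 K L by (intro mult_left_mono) auto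
    qed
    finally show ?thesis by (simp add: algebra_simps)
  qed
  finally show ?thesis by simp
qed

lemma measurable_phase:
  assumes X: "\<And>t. 0 \<le> t \<Longrightarrow> X t \<in> borel_measurable (F t)" and t: "0 \<le> t"
  shows "{\<omega> \<in> space M. phase (\<lambda>s. X s \<omega>) a c n t} \<in> sets (F t)"
proof -
  have sp: "space M = space (F t)" by (simp add: space_F)
  have cnt: "countable (triangle \<inter> (\<rat> \<times> \<rat>))"
    by (rule countable_subset[of _ "\<rat> \<times> \<rat>"]) (auto intro: countable_rat)
  have X_z: "X (fst z * t) \<in> borel_measurable (F t)" "X (snd z * t) \<in> borel_measurable (F t)"
    if "z \<in> triangle \<inter> (\<rat> \<times> \<rat>)" for z
    using triangle_scaled[OF t, of z] that X[of "fst z * t"] X[of "snd z * t"]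
      measurable_F_mono[of _ "fst z * t" _ t] measurable_F_mono[of _ "snd z * t" _ t] by auto
  have pred_rational: "Measurable.pred (F t) (\<lambda>\<omega>. \<forall>m::nat. \<exists>z\<in>triangle \<inter> (\<rat> \<times> \<rat>). - 1 / real (Suc m) < \<Phi> z \<omega>)"
    if \<Phi>: "\<And>z. z \<in> triangle \<inter> (\<rat> \<times> \<rat>) \<Longrightarrow> \<Phi> z \<in> borel_measurable (F t)" for \<Phi> :: "real \<times> real \<Rightarrow> 'w \<Rightarrow> real"
  proof (rule pred_intros_countable)
    fix m :: nat
    have "{\<omega> \<in> space (F t). \<exists>z\<in>triangle \<inter> (\<rat> \<times> \<rat>). - 1 / real (Suc m) < \<Phi> z \<omega>}
        = (\<Union>z\<in>triangle \<inter> (\<rat> \<times> \<rat>). {\<omega> \<in> space (F t). - 1 / real (Suc m) < \<Phi> z \<omega>})" by blast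
    also have "\<dots> \<in> sets (F t)"
    proof (rule sets.countable_UN''[OF cnt])
      fix z assume "z \<in> triangle \<inter> (\<rat> \<times> \<rat>)"
      from \<Phi>[OF this] show "{\<omega> \<in> space (F t). - 1 / real (Suc m) < \<Phi> z \<omega>} \<in> sets (F t)" by measurable
    qed
    finally show "Measurable.pred (F t) (\<lambda>\<omega>. \<exists>z\<in>triangle \<inter> (\<rat> \<times> \<rat>). - 1 / real (Suc m) < \<Phi> z \<omega>)"
      by (simp add: pred_def)
  qed
  have reach: "Measurable.pred (F t) (\<lambda>\<omega>. reached (\<lambda>s. X s \<omega>) k t)" for k
    unfolding reached_def by (rule pred_rational) (intro borel_measurable_diff X_z borel_measurable_const)
  have cross: "Measurable.pred (F t) (\<lambda>\<omega>. crossed (\<lambda>s. X s \<omega>) a c t)"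
    unfolding crossed_def
    by (rule pred_rational) (intro borel_measurable_diff borel_measurable_min X_z borel_measurable_const)
  have "Measurable.pred (F t) (\<lambda>\<omega>. phase (\<lambda>s. X s \<omega>) a c n t)"
    unfolding phase_def by (intro pred_intros_logic reach cross)
  then show ?thesis unfolding sp by (simp add: pred_def)
qed

lemma measurable_survives:
  assumes X: "\<And>t. 0 \<le> t \<Longrightarrow> X t \<in> borel_measurable (F t)"
  shows "{\<omega> \<in> space M. survives (\<lambda>s. X s \<omega>) a c n} \<in> sets M"
proof -
  have "{\<omega> \<in> space M. survives (\<lambda>s. X s \<omega>) a c n}
      = (\<Union>t\<in>\<rat> \<inter> {0..}. {\<omega> \<in> space M. phase (\<lambda>s. X s \<omega>) a c n t})"
    by (auto simp: survives_def)
  also have "\<dots> \<in> sets M"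
  proof (rule sets.countable_UN'')
    show "countable (\<rat> \<inter> {0::real..})" using countable_rat by (rule countable_Int1)
    fix t :: real assume "t \<in> \<rat> \<inter> {0..}"
    then have "0 \<le> t" by simp
    then show "{\<omega> \<in> space M. phase (\<lambda>s. X s \<omega>) a c n t} \<in> sets M"
      using measurable_phase[of X, OF X] sets_F by blast
  qed
  finally show ?thesis .
qed

end

section \<open>The exit inequality for one phase\<close>

text \<open>The grid points in a half-open interval are consecutive, so the sum telescopes.
  \<open>nat \<lceil>r / h\<rceil>\<close> is the index of the first grid point at or after
  \<open>r\<close>, capped at the last grid index \<open>N\<close>.\<close>

lemma grid_sum:
  fixes y :: "real \<Rightarrow> real"
  assumes P: "\<And>t. 0 \<le> t \<Longrightarrow> P t \<longleftrightarrow> \<sigma> \<le> t \<and> t < \<tau>" and st: "0 \<le> \<sigma>" "\<sigma> \<le> \<tau>" and h: "0 < h"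
  shows "(\<Sum>k<N. if P (real k * h) then y (real (Suc k) * h) - y (real k * h) else 0)
    = y (real (min N (nat \<lceil>\<tau> / h\<rceil>)) * h) - y (real (min N (nat \<lceil>\<sigma> / h\<rceil>)) * h)"
proof -
  define s t where "s = nat \<lceil>\<sigma> / h\<rceil>" and "t = nat \<lceil>\<tau> / h\<rceil>"
  define u v where "u = min N s" and "v = min N t"
  have uv: "u \<le> v"
    unfolding u_def v_def s_def t_def using st h by (intro min.mono nat_mono ceiling_mono divide_right_mono) auto
  have ceil: "nat \<lceil>r / h\<rceil> \<le> k \<longleftrightarrow> r \<le> real k * h" for r k
  proof -
    have "nat \<lceil>r / h\<rceil> \<le> k \<longleftrightarrow> r / h \<le> real k" by linarith
    also have "\<dots> \<longleftrightarrow> r \<le> real k * h" using h by (simp add: field_simps)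
    finally show ?thesis .
  qed
  have set: "{k. k < N \<and> P (real k * h)} = {u..<v}"
  proof (rule set_eqI)
    fix k
    have "P (real k * h) \<longleftrightarrow> s \<le> k \<and> \<not> t \<le> k"
      unfolding s_def t_def ceil using P[of "real k * h"] h by auto
    then show "k \<in> {k. k < N \<and> P (real k * h)} \<longleftrightarrow> k \<in> {u..<v}"
      by (auto simp: u_def v_def)
  qed
  have "(\<Sum>k<N. if P (real k * h) then y (real (Suc k) * h) - y (real k * h) else 0)
      = (\<Sum>k\<in>{k. k < N \<and> P (real k * h)}. y (real (Suc k) * h) - y (real k * h))"
    by (simp add: sum.inter_filter[symmetric])
  also have "\<dots> = y (real v * h) - y (real u * h)"
    unfolding set by (rule sum_Suc_diff'[OF uv, of "\<lambda>k. y (real k * h)"])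
  finally show ?thesis by (simp add: u_def v_def s_def t_def)
qed

text \<open>Once the horizon \<open>Suc j\<close> exceeds \<open>r\<close>, the cap is inactive and
  the first grid point at or after \<open>r\<close> is at most one step away.\<close>

lemma grid_limit:
  fixes r :: real
  assumes "0 \<le> r"
  shows "(\<lambda>j. real (min (Suc j ^ 5) (nat \<lceil>r / (1 / real (Suc j) ^ 4)\<rceil>)) * (1 / real (Suc j) ^ 4)) \<longlonglongrightarrow> r"
proof (rule tendsto_sandwich[of "\<lambda>_. r" _ _ "\<lambda>j. r + 1 / real (Suc j)"])
  let ?m = "\<lambda>j. min (Suc j ^ 5) (nat \<lceil>r / (1 / real (Suc j) ^ 4)\<rceil>)"
  have *: "r \<le> real (?m j) * (1 / real (Suc j) ^ 4) \<and> real (?m j) * (1 / real (Suc j) ^ 4) \<le> r + 1 / real (Suc j)"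
    if "nat \<lceil>r\<rceil> \<le> j" for j
  proof -
    let ?J = "real (Suc j)"
    have J: "1 \<le> ?J" "r \<le> ?J" using that by linarith+
    have "r * ?J ^ 4 \<le> ?J * ?J ^ 4" using J by (intro mult_right_mono) auto
    moreover have "?J * ?J ^ 4 = real (Suc j ^ 5)"
      using power_Suc[of ?J 4] by (simp del: of_nat_Suc power_Suc)
    ultimately have "r * ?J ^ 4 \<le> real (Suc j ^ 5)" by linarith
    then have "nat \<lceil>r * ?J ^ 4\<rceil> \<le> Suc j ^ 5" by linarith
    then have m: "?m j = nat \<lceil>r * ?J ^ 4\<rceil>" by simp
    have nn: "0 \<le> r * ?J ^ 4" using assms by simp
    have b: "r * ?J ^ 4 \<le> real (?m j)" "real (?m j) \<le> r * ?J ^ 4 + 1"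
      unfolding m using nn by linarith+
    have J4: "0 < ?J ^ 4" by simp
    have "r = r * ?J ^ 4 * (1 / ?J ^ 4)" using J4 by simp
    also have "\<dots> \<le> real (?m j) * (1 / ?J ^ 4)" by (rule mult_right_mono[OF b(1)]) simp
    finally have 1: "r \<le> real (?m j) * (1 / ?J ^ 4)" .
    have "real (?m j) * (1 / ?J ^ 4) \<le> (r * ?J ^ 4 + 1) * (1 / ?J ^ 4)" by (rule mult_right_mono[OF b(2)]) simp
    also have "\<dots> = r + 1 / ?J ^ 4" using J4 by (simp add: field_simps)
    also have "1 / ?J ^ 4 \<le> 1 / ?J"
      using power_increasing[of 1 4 ?J] J by (intro divide_left_mono) auto
    finally show ?thesis using 1 by simp
  qed
  show "\<forall>\<^sub>F j in sequentially. r \<le> real (?m j) * (1 / real (Suc j) ^ 4)"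
    using * by (intro eventually_sequentiallyI[of "nat \<lceil>r\<rceil>"]) blast
  show "\<forall>\<^sub>F j in sequentially. real (?m j) * (1 / real (Suc j) ^ 4) \<le> r + 1 / real (Suc j)"
    using * by (intro eventually_sequentiallyI[of "nat \<lceil>r\<rceil>"]) blast
  show "(\<lambda>j. r + 1 / real (Suc j)) \<longlonglongrightarrow> r"
    using tendsto_add[OF tendsto_const LIMSEQ_Suc[OF lim_1_over_n], of r] by simp
qed simp

context brownian_motion
begin

text \<open>Of the two errors allowed in the generator bound, the first has mean \<open>O(h\<^sup>2)\<close>, and the second occurs
  only in the one grid step in which the phase ends.\<close>

lemma exit_inequality:
  fixes X :: "real \<Rightarrow> 'w \<Rightarrow> real"
  assumes X: "\<And>t. 0 \<le> t \<Longrightarrow> X t \<in> borel_measurable (F t)"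
    and cont: "AE \<omega> in M. continuous_on {0..} (\<lambda>t. X t \<omega>)"
    and drift: "AE \<omega> in M. \<forall>s t. 0 \<le> s \<longrightarrow> s \<le> t \<longrightarrow> \<bar>X t \<omega> - X s \<omega> - (W t \<omega> - W s \<omega>)\<bar> \<le> L * (t - s)"
    and unbounded: "AE \<omega> in M. \<forall>r. \<exists>u\<ge>0. r \<le> X u \<omega>"
    and X0: "AE \<omega> in M. X 0 \<omega> < a" and levels: "c < a" "a \<le> n"
    and \<phi>: "continuous_on UNIV \<phi>" and pq: "p \<in> borel_measurable borel" "q \<in> borel_measurable borel"
    and bound: "\<And>x. \<bar>\<phi> x\<bar> \<le> B" "\<And>x. \<bar>p x\<bar> \<le> P" "\<And>x. \<bar>q x\<bar> \<le> Q"
    and K: "0 \<le> K" and L: "0 \<le> L" and K': "0 \<le> K'"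
    and cubic: "\<And>x. c < x \<Longrightarrow> cubic_bound \<phi> (p x) (q x) K x"
    and generator: "AE \<omega> in M. \<forall>t\<ge>0. \<forall>h>0. phase (\<lambda>s. X s \<omega>) a c n t \<longrightarrow>
      p (X t \<omega>) * (X (t + h) \<omega> - X t \<omega> - (W (t + h) \<omega> - W t \<omega>)) + q (X t \<omega>) / 2 * h
      \<le> K' * ((LINT u:{t..t + h}|lborel. (X u \<omega> - X t \<omega>)\<^sup>2)
        + h * (if phase (\<lambda>s. X s \<omega>) a c n (t + h) then 0 else 1))"
  defines "S \<equiv> (\<lambda>n. prob {\<omega> \<in> space M. survives (\<lambda>s. X s \<omega>) a c n})"
  shows "\<phi> (n + 1) * S (n + 1) + \<phi> c * (S n - S (n + 1)) \<le> \<phi> n * S n"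
proof -
  define G where "G t = {\<omega> \<in> space M. phase (\<lambda>s. X s \<omega>) a c n t}" for t
  define V where "V n = {\<omega> \<in> space M. survives (\<lambda>s. X s \<omega>) a c n}" for n
  have G: "G t \<in> sets (F t)" if "0 \<le> t" for t
    unfolding G_def by (rule measurable_phase[OF X that])
  have V [measurable]: "V m \<in> sets M" for m
    unfolding V_def by (rule measurable_survives[OF X])
  have [measurable]: "\<phi> \<in> borel_measurable borel"
    using \<phi> by (rule borel_measurable_continuous_onI)
  have XM: "X t \<in> borel_measurable M" if "0 \<le> t" for t
    using X[OF that] measurable_F by blast
  have B: "0 \<le> B" using bound(1)[of 0] by linarith
  have ind: "integrable M (\<lambda>\<omega>. indicator A \<omega> :: real)" if "A \<in> sets M" for A
    by (rule integrable_real_indicator[OF that]) (simp add: less_top[symmetric])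
  \<comment> \<open>The cubic bound is assumed only above \<open>c\<close>. During the phase the
    path stays there, because it has already been at \<open>n\<close>, hence at or above
    \<open>a\<close>, and has not crossed.\<close>
  have phase_above: "AE \<omega> in M. \<forall>t\<ge>0. \<omega> \<in> G t \<longrightarrow> c < X t \<omega>"
    using cont
  proof eventually_elim
    case (elim \<omega>)
    show ?case
    proof (intro allI impI, rule ccontr)
      fix t assume t: "0 \<le> t" "\<omega> \<in> G t" "\<not> c < X t \<omega>"
      then obtain s where s: "0 \<le> s" "s \<le> t" "n \<le> X s \<omega>"
        using reached_iff[OF elim t(1), of n] by (auto simp: G_def phase_def)
      then have "crossed (\<lambda>s. X s \<omega>) a c t"
        unfolding crossed_iff[OF elim t(1)] using t levels by (intro exI[of _ s] exI[of _ t]) auto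
      then show False using t by (simp add: G_def phase_def)
    qed
  qed
  define C where "C = Q * L + Q * L\<^sup>2 + 8 * K + 4 * K * L ^ 3"
  have step: "expectation (\<lambda>\<omega>. indicator (G t) \<omega> * (\<phi> (X (t + h) \<omega>) - \<phi> (X t \<omega>)))
      \<le> K' * h * expectation (indicator (G t - G (t + h))) + (C + 2 * K' * (1 + L\<^sup>2)) * (h * sqrt h)"
    if t: "0 \<le> t" "0 < h" "h \<le> 1" for t h
  proof -
    obtain J where J: "integrable M J" "expectation J \<le> h\<^sup>2" "\<And>\<omega>. 0 \<le> J \<omega>"
      "AE \<omega> in M. (LINT u:{t..t + h}|lborel. (W u \<omega> - W t \<omega>)\<^sup>2) = J \<omega>"
      using quadratic_oscillation[OF t(1,2)] by blast
    \<comment> \<open>The squared displacement of \<open>X\<close> is at most twice that of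
      \<open>W\<close> plus twice the squared drift part. This replaces the integral over
      \<open>X\<close> in the generator bound by the version \<open>J\<close>, whose mean is
      known.\<close>
    define R where "R \<omega> = 2 * K' * (J \<omega> + L\<^sup>2 * h\<^sup>2) + K' * h * indicator (space M - G (t + h)) \<omega>" for \<omega>
    have GM: "G t \<in> sets M" "G (t + h) \<in> sets M" using G sets_F t by (meson add_nonneg_nonneg less_imp_le)+
    have R: "integrable M R"
      unfolding R_def using J(1) GM by (intro Bochner_Integration.integrable_add integrable_mult_right integrable_const ind) auto
    have th: "0 \<le> t + h" using t by simp
    have gen: "AE \<omega> in M. \<omega> \<in> G t \<longrightarrow>
      p (X t \<omega>) * (X (t + h) \<omega> - X t \<omega> - (W (t + h) \<omega> - W t \<omega>)) + q (X t \<omega>) / 2 * h \<le> R \<omega>"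
      using generator J(4) drift cont continuous_paths
    proof eventually_elim
      case (elim \<omega>)
      show ?case
      proof
        assume w: "\<omega> \<in> G t"
        have sub: "{t..t + h} \<subseteq> {0..}" using t by auto
        note cX = continuous_on_subset[OF elim(4) sub] and cW = continuous_on_subset[OF elim(5) sub]
        have int: "set_integrable lborel {t..t + h} f" if "continuous_on {t..t + h} f" for f :: "real \<Rightarrow> real"
          by (rule borel_integrable_atLeastAtMost'[OF that])
        have "(LINT u:{t..t + h}|lborel. (X u \<omega> - X t \<omega>)\<^sup>2)
            \<le> (LINT u:{t..t + h}|lborel. 2 * (W u \<omega> - W t \<omega>)\<^sup>2 + 2 * L\<^sup>2 * h\<^sup>2)"
        proof (rule set_integral_mono)
          fix u assume u: "u \<in> {t..t + h}"
          let ?D = "X u \<omega> - X t \<omega> - (W u \<omega> - W t \<omega>)"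
          have "\<bar>?D\<bar> \<le> L * (u - t)" using elim(3) u t by simp
          also have "\<dots> \<le> L * h" using u L by (intro mult_left_mono) auto
          finally have "?D\<^sup>2 \<le> (L * h)\<^sup>2" using L t by (intro abs_le_square_iff[THEN iffD1]) auto
          moreover have "(X u \<omega> - X t \<omega>)\<^sup>2 \<le> 2 * (W u \<omega> - W t \<omega>)\<^sup>2 + 2 * ?D\<^sup>2"
            using zero_le_power2[of "W u \<omega> - W t \<omega> - ?D"] by (simp add: power2_eq_square algebra_simps)
          ultimately show "(X u \<omega> - X t \<omega>)\<^sup>2 \<le> 2 * (W u \<omega> - W t \<omega>)\<^sup>2 + 2 * L\<^sup>2 * h\<^sup>2"
            by (simp add: power_mult_distrib)
        qed (intro int continuous_intros cX cW)+
        also have "\<dots> = 2 * J \<omega> + 2 * L\<^sup>2 * h\<^sup>2 * h"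
        proof -
          have "set_integrable lborel {t..t + h} (\<lambda>u. 2 * (W u \<omega> - W t \<omega>)\<^sup>2)"
            "set_integrable lborel {t..t + h} (\<lambda>u. 2 * L\<^sup>2 * h\<^sup>2)"
            by (intro int continuous_intros cW)+
          then show ?thesis
            using elim(2) t by (subst set_integral_add) (auto simp: set_integral_const)
        qed
        also have "\<dots> \<le> 2 * (J \<omega> + L\<^sup>2 * h\<^sup>2)"
          using mult_left_le[OF t(3), of "L\<^sup>2 * h\<^sup>2"] by simp
        finally have "K' * (LINT u:{t..t + h}|lborel. (X u \<omega> - X t \<omega>)\<^sup>2) \<le> K' * (2 * (J \<omega> + L\<^sup>2 * h\<^sup>2))"
          using K' by (rule mult_left_mono)
        moreover have i: "(if phase (\<lambda>s. X s \<omega>) a c n (t + h) then 0 else 1) = (indicator (space M - G (t + h)) \<omega> :: real)"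
          using w by (auto simp: G_def)
        have "phase (\<lambda>s. X s \<omega>) a c n t" using w by (simp add: G_def)
        with elim(1) t have "p (X t \<omega>) * (X (t + h) \<omega> - X t \<omega> - (W (t + h) \<omega> - W t \<omega>)) + q (X t \<omega>) / 2 * h
            \<le> K' * ((LINT u:{t..t + h}|lborel. (X u \<omega> - X t \<omega>)\<^sup>2) + h * indicator (space M - G (t + h)) \<omega>)"
          unfolding i[symmetric] by blast
        ultimately show "p (X t \<omega>) * (X (t + h) \<omega> - X t \<omega> - (W (t + h) \<omega> - W t \<omega>)) + q (X t \<omega>) / 2 * h \<le> R \<omega>"
          unfolding R_def by (simp add: distrib_left mult_ac)
      qed
    qed
    have "AE \<omega> in M. \<bar>X (t + h) \<omega> - X t \<omega> - (W (t + h) \<omega> - W t \<omega>)\<bar> \<le> L * h"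
      using drift
    proof eventually_elim
      case (elim \<omega>)
      from elim[rule_format, of t "t + h"] t show ?case by simp
    qed
    moreover have "AE \<omega> in M. \<omega> \<in> G t \<longrightarrow> cubic_bound \<phi> (p (X t \<omega>)) (q (X t \<omega>)) K (X t \<omega>)"
      using phase_above t cubic by (auto elim!: eventually_mono)
    ultimately have "expectation (\<lambda>\<omega>. indicator (G t) \<omega> * (\<phi> (X (t + h) \<omega>) - \<phi> (X t \<omega>)))
        \<le> expectation (\<lambda>\<omega>. indicator (G t) \<omega> * R \<omega>) + C * (h * sqrt h)"
      unfolding C_def
      by (intro one_step[OF t G[OF t(1)] X[OF t(1)] XM[OF th] _ pq bound K L R _ _ gen]) simp_all
    also have "expectation (\<lambda>\<omega>. indicator (G t) \<omega> * R \<omega>)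
        \<le> expectation (\<lambda>\<omega>. 2 * K' * (J \<omega> + L\<^sup>2 * h\<^sup>2) + K' * h * indicator (G t - G (t + h)) \<omega>)"
    proof (rule integral_mono)
      show "integrable M (\<lambda>\<omega>. indicator (G t) \<omega> * R \<omega>)"
        using integrable_mult_indicator[OF GM(1) R] by simp
      show "integrable M (\<lambda>\<omega>. 2 * K' * (J \<omega> + L\<^sup>2 * h\<^sup>2) + K' * h * indicator (G t - G (t + h)) \<omega>)"
        using J(1) GM by (intro Bochner_Integration.integrable_add integrable_mult_right integrable_const ind) auto
      show "indicator (G t) \<omega> * R \<omega> \<le> 2 * K' * (J \<omega> + L\<^sup>2 * h\<^sup>2) + K' * h * indicator (G t - G (t + h)) \<omega>"
        if "\<omega> \<in> space M" for \<omega>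
        unfolding R_def using J(3)[of \<omega>] K' that by (auto split: split_indicator)
    qed
    also have "\<dots> = 2 * K' * (expectation J + L\<^sup>2 * h\<^sup>2) + K' * h * expectation (indicator (G t - G (t + h)))"
      using J(1) ind[of "G t - G (t + h)"] GM by (simp add: prob_space)
    also have "2 * K' * (expectation J + L\<^sup>2 * h\<^sup>2) \<le> 2 * K' * ((1 + L\<^sup>2) * (h * sqrt h))"
    proof (rule mult_left_mono)
      have "h * h \<le> h * sqrt h"
      proof (rule mult_left_mono)
        have "h * h \<le> h" using t by (simp add: mult_left_le)
        then show "h \<le> sqrt h" using t by (simp add: real_le_rsqrt power2_eq_square)
      qed (use t in simp)
      then have h: "h\<^sup>2 \<le> h * sqrt h" by (simp add: power2_eq_square)
      have "expectation J + L\<^sup>2 * h\<^sup>2 \<le> h * sqrt h + L\<^sup>2 * (h * sqrt h)"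
        using h J(2) by (intro add_mono mult_left_mono) auto
      then show "expectation J + L\<^sup>2 * h\<^sup>2 \<le> (1 + L\<^sup>2) * (h * sqrt h)" by (simp add: algebra_simps)
    qed (use K' in simp)
    finally show ?thesis by (simp add: algebra_simps)
  qed
  \<comment> \<open>The exponents balance two demands: \<open>N j\<close> errors of size
    \<open>h * sqrt h\<close> add up to \<open>1 / Suc j\<close>, while the horizon
    \<open>N j * h j = Suc j\<close> grows beyond the end of every bounded phase.\<close>
  define h where "h j = 1 / real (Suc j) ^ 4" for j :: nat
  define N where "N j = Suc j ^ 5" for j :: nat
  have h: "0 < h j" "h j \<le> 1" for j
  proof -
    have "1 \<le> real (Suc j) ^ 4" by (rule one_le_power) simp
    then show "0 < h j" "h j \<le> 1" by (auto simp: h_def divide_le_eq_1)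
  qed
  define Z where "Z j \<omega> = (\<Sum>k<N j. indicator (G (real k * h j)) \<omega> * (\<phi> (X (real (Suc k) * h j) \<omega>) - \<phi> (X (real k * h j) \<omega>)))"
    for j \<omega>
  \<comment> \<open>This is the value of \<open>\<phi>\<close> at the end of the phase minus its
    value at the start: the path starts the phase at \<open>n\<close> and leaves it at
    \<open>n + 1\<close> or at \<open>c\<close>.\<close>
  define Zl where "Zl \<omega> = \<phi> (n + 1) * indicator (V (n + 1)) \<omega>
      + \<phi> c * (indicator (V n) \<omega> - indicator (V (n + 1)) \<omega>) - \<phi> n * indicator (V n) \<omega>" for \<omega>
  have GM: "G (real k * h j) \<in> sets M" for k j
    using G[of "real k * h j"] sets_F h[of j] by auto
  have XkM: "X (real k * h j) \<in> borel_measurable M" for k j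
    using XM[of "real k * h j"] h[of j] by auto
  have int_summand: "integrable M (\<lambda>\<omega>. indicator (G (real k * h j)) \<omega> * (\<phi> (X (real (Suc k) * h j) \<omega>) - \<phi> (X (real k * h j) \<omega>)))" for k j
  proof (rule integrable_const_bound[where B="2 * B"])
    show "AE \<omega> in M. norm (indicator (G (real k * h j)) \<omega> * (\<phi> (X (real (Suc k) * h j) \<omega>) - \<phi> (X (real k * h j) \<omega>))) \<le> 2 * B"
    proof (intro AE_I2)
      fix \<omega>
      show "norm (indicator (G (real k * h j)) \<omega> * (\<phi> (X (real (Suc k) * h j) \<omega>) - \<phi> (X (real k * h j) \<omega>))) \<le> 2 * B"
        using bound(1)[of "X (real (Suc k) * h j) \<omega>"] bound(1)[of "X (real k * h j) \<omega>"] B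
        by (auto split: split_indicator)
    qed
    show "(\<lambda>\<omega>. indicator (G (real k * h j)) \<omega> * (\<phi> (X (real (Suc k) * h j) \<omega>) - \<phi> (X (real k * h j) \<omega>))) \<in> borel_measurable M"
      using GM[of k j] XkM[of k j] XkM[of "Suc k" j] by measurable
  qed
  \<comment> \<open>The bound \<open>2 * B\<close> is the dominating function for the limit. The
    second claim says that the phase ends in at most one grid step, so the exit errors cost only
    \<open>K' * h j\<close> altogether.\<close>
  have path: "AE \<omega> in M. (\<forall>j. norm (Z j \<omega>) \<le> 2 * B
      \<and> (\<Sum>k<N j. indicator (G (real k * h j) - G (real (Suc k) * h j)) \<omega>) \<le> (1::real))
      \<and> (\<lambda>j. Z j \<omega>) \<longlonglongrightarrow> Zl \<omega>"
    using cont unbounded X0 AE_space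
  proof eventually_elim
    case (elim \<omega>)
    let ?x = "\<lambda>s. X s \<omega>"
    have unb: "\<exists>u\<ge>0. r \<le> X u \<omega>" for r using elim(2) by blast
    note pi = phase_interval[OF elim(1) unb elim(3) levels]
    show ?case
    proof (cases "survives ?x a c n")
      case False
      then have no: "\<omega> \<notin> G t" if "0 \<le> t" for t using pi(1) that by (auto simp: G_def)
      have "\<not> survives ?x a c (n + 1)" using False pi(3) by blast
      then have "Zl \<omega> = 0" using False by (simp add: Zl_def V_def)
      moreover have "Z j \<omega> = 0" for j
        unfolding Z_def using no h[of j] by (intro sum.neutral) auto
      moreover have "(\<Sum>k<N j. indicator (G (real k * h j) - G (real (Suc k) * h j)) \<omega>) = (0::real)" for j
        using no h[of j] by (intro sum.neutral) auto
      ultimately show ?thesis using B by simp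
    next
      case True
      then obtain \<sigma> \<tau> where st: "0 \<le> \<sigma>" "\<sigma> < \<tau>" and ph: "\<And>t. 0 \<le> t \<Longrightarrow> phase ?x a c n t \<longleftrightarrow> \<sigma> \<le> t \<and> t < \<tau>"
        and val: "X \<sigma> \<omega> = n" "X \<tau> \<omega> = (if survives ?x a c (n + 1) then n + 1 else c)"
        using pi(2) by metis
      have Gp: "\<omega> \<in> G t \<longleftrightarrow> phase ?x a c n t" for t using elim by (simp add: G_def)
      define e where "e r j = real (min (N j) (nat \<lceil>r / h j\<rceil>)) * h j" for r j
      have e0: "0 \<le> e r j" for r j using h[of j] by (simp add: e_def)
      have sum_eq: "(\<Sum>k<N j. if phase ?x a c n (real k * h j) then y (real (Suc k) * h j) - y (real k * h j) else 0)
          = y (e \<tau> j) - y (e \<sigma> j)" for y :: "real \<Rightarrow> real" and j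
        unfolding e_def by (rule grid_sum[OF ph st(1) less_imp_le[OF st(2)] h(1)])
      have Z_eq: "Z j \<omega> = \<phi> (X (e \<tau> j) \<omega>) - \<phi> (X (e \<sigma> j) \<omega>)" for j
        unfolding sum_eq[symmetric, of "\<lambda>t. \<phi> (X t \<omega>)"] Z_def
        by (intro sum.cong) (auto simp: Gp)
      \<comment> \<open>The exit indicator is an increment of the function that is 0 during the
        phase and 1 outside, so the same telescoping applies.\<close>
      have "(\<Sum>k<N j. indicator (G (real k * h j) - G (real (Suc k) * h j)) \<omega>)
          = (\<Sum>k<N j. if phase ?x a c n (real k * h j) then
              (if phase ?x a c n (real (Suc k) * h j) then 0 else 1) - (if phase ?x a c n (real k * h j) then 0 else 1) else (0::real))" for j
        by (intro sum.cong) (auto simp: Gp split: split_indicator)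
      then have "(\<Sum>k<N j. indicator (G (real k * h j) - G (real (Suc k) * h j)) \<omega>) \<le> (1::real)" for j
        unfolding sum_eq[of _ "\<lambda>t. if phase ?x a c n t then 0 else 1"] by simp
      moreover have "norm (Z j \<omega>) \<le> 2 * B" for j
        unfolding Z_eq using bound(1)[of "X (e \<tau> j) \<omega>"] bound(1)[of "X (e \<sigma> j) \<omega>"] by simp
      moreover have "(\<lambda>j. Z j \<omega>) \<longlonglongrightarrow> Zl \<omega>"
      proof -
        have lim: "(\<lambda>j. \<phi> (X (e r j) \<omega>)) \<longlonglongrightarrow> \<phi> (X r \<omega>)" if "0 \<le> r" for r
        proof (rule continuous_on_tendsto_compose[OF \<phi>])
          have "e r \<longlonglongrightarrow> r" using grid_limit[OF that] by (simp add: e_def[abs_def] N_def h_def)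
          then show "(\<lambda>j. X (e r j) \<omega>) \<longlonglongrightarrow> X r \<omega>"
            by (rule continuous_on_tendsto_compose[OF elim(1)]) (use that e0 in auto)
        qed auto
        have "(\<lambda>j. Z j \<omega>) \<longlonglongrightarrow> \<phi> (X \<tau> \<omega>) - \<phi> (X \<sigma> \<omega>)"
          unfolding Z_eq by (intro tendsto_diff lim) (use st in auto)
        also have "\<phi> (X \<tau> \<omega>) - \<phi> (X \<sigma> \<omega>) = Zl \<omega>"
          using val True elim(4) by (auto simp: Zl_def V_def)
        finally show ?thesis .
      qed
      ultimately show ?thesis by simp
    qed
  qed
  define C' where "C' = C + 2 * K' * (1 + L\<^sup>2)"
  have Z_bound: "expectation (Z j) \<le> K' * h j + C' * (1 / real (Suc j))" for j
  proof -
    have "expectation (Z j) = (\<Sum>k<N j. expectation (\<lambda>\<omega>. indicator (G (real k * h j)) \<omega> * (\<phi> (X (real (Suc k) * h j) \<omega>) - \<phi> (X (real k * h j) \<omega>))))"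
      unfolding Z_def using int_summand by (rule Bochner_Integration.integral_sum)
    also have "\<dots> \<le> (\<Sum>k<N j. K' * h j * expectation (indicator (G (real k * h j) - G (real (Suc k) * h j))) + C' * (h j * sqrt (h j)))"
    proof (rule sum_mono)
      fix k
      have "real k * h j + h j = real (Suc k) * h j" by (simp add: algebra_simps)
      then show "expectation (\<lambda>\<omega>. indicator (G (real k * h j)) \<omega> * (\<phi> (X (real (Suc k) * h j) \<omega>) - \<phi> (X (real k * h j) \<omega>)))
          \<le> K' * h j * expectation (indicator (G (real k * h j) - G (real (Suc k) * h j))) + C' * (h j * sqrt (h j))"
        using step[of "real k * h j" "h j"] h[of j] by (simp add: C'_def)
    qed
    also have "\<dots> = K' * h j * expectation (\<lambda>\<omega>. \<Sum>k<N j. indicator (G (real k * h j) - G (real (Suc k) * h j)) \<omega>)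
        + C' * (real (N j) * (h j * sqrt (h j)))"
    proof -
      have "integrable M (indicator (G (real k * h j) - G (real (Suc k) * h j)) :: 'w \<Rightarrow> real)" for k
        using GM[of k j] GM[of "Suc k" j] by (intro ind) auto
      then have "expectation (\<lambda>\<omega>. \<Sum>k<N j. indicator (G (real k * h j) - G (real (Suc k) * h j)) \<omega>)
          = (\<Sum>k<N j. expectation (indicator (G (real k * h j) - G (real (Suc k) * h j))) :: real)"
        by (intro Bochner_Integration.integral_sum)
      then show ?thesis by (simp add: sum.distrib sum_distrib_left del: of_nat_Suc)
    qed
    also have "\<dots> \<le> K' * h j * 1 + C' * (real (N j) * (h j * sqrt (h j)))"
    proof (intro add_right_mono mult_left_mono)
      have "expectation (\<lambda>\<omega>. \<Sum>k<N j. indicator (G (real k * h j) - G (real (Suc k) * h j)) \<omega>) \<le> expectation (\<lambda>_. 1 :: real)"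
      proof (rule integral_mono_AE)
        show "integrable M (\<lambda>\<omega>. \<Sum>k<N j. indicator (G (real k * h j) - G (real (Suc k) * h j)) \<omega> :: real)"
          using GM by (intro Bochner_Integration.integrable_sum ind sets.Diff)
      qed (use path in auto)
      then show "expectation (\<lambda>\<omega>. \<Sum>k<N j. indicator (G (real k * h j) - G (real (Suc k) * h j)) \<omega>) \<le> (1 :: real)"
        by (simp add: prob_space)
    qed (use K' h[of j] in auto)
    also have "real (N j) * (h j * sqrt (h j)) = 1 / real (Suc j)"
    proof -
      let ?J = "real (Suc j)"
      have "h j = (1 / ?J ^ 2) ^ 2" by (simp add: h_def power_divide power_mult[symmetric])
      then have "sqrt (h j) = 1 / ?J ^ 2" by simp
      moreover have "real (N j) = ?J ^ 5" by (simp add: N_def)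
      ultimately show ?thesis by (simp add: h_def eval_nat_numeral del: of_nat_Suc)
    qed
    finally show ?thesis by simp
  qed
  have Z_meas: "Z j \<in> borel_measurable M" for j
    unfolding Z_def using int_summand by (intro borel_measurable_sum) auto
  have Zl_meas: "Zl \<in> borel_measurable M" unfolding Zl_def by measurable
  have "(\<lambda>j. expectation (Z j)) \<longlonglongrightarrow> expectation Zl"
    by (rule integral_dominated_convergence[where w="\<lambda>_. 2 * B"]) (use path Z_meas Zl_meas in auto)
  moreover have "(\<lambda>j. K' * h j + C' * (1 / real (Suc j))) \<longlonglongrightarrow> K' * 0 + C' * 0"
  proof (intro tendsto_intros)
    show "(\<lambda>j. 1 / real (Suc j)) \<longlonglongrightarrow> 0" by (rule LIMSEQ_Suc[OF lim_1_over_n])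
    from tendsto_power[OF this, of 4] show "h \<longlonglongrightarrow> 0" by (simp add: h_def[abs_def] power_divide)
  qed
  ultimately have "expectation Zl \<le> K' * 0 + C' * 0"
    by (rule LIMSEQ_le) (use Z_bound in auto)
  moreover have "expectation Zl = \<phi> (n + 1) * S (n + 1) + \<phi> c * (S n - S (n + 1)) - \<phi> n * S n"
  proof -
    have *: "integrable M (indicator (V m) :: 'w \<Rightarrow> real)" "expectation (indicator (V m)) = S m" for m
      using ind[OF V[of m]] sets.sets_into_space[OF V[of m]] by (auto simp: S_def V_def[symmetric] Int_absorb2)
    then show ?thesis unfolding Zl_def by simp
  qed
  ultimately show ?thesis by simp
qed

end

section \<open>Unboundedness of Brownian paths\<close>

context brownian_motion
begin

text \<open>A second moment argument. The mean of \<open>\<bar>Z\<bar> + Z\<close> is at least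
  \<open>sqrt h / 2\<close>. This variable is at most \<open>2 * r'\<close> off the event, and at
  most \<open>\<epsilon> Z\<^sup>2 + 1 / \<epsilon>\<close> on it. With the chosen
  \<open>\<epsilon>\<close> and \<open>r'\<close> the first two contributions are
  \<open>sqrt h / 8\<close> each, which leaves \<open>sqrt h / 4\<close> for
  \<open>8 * sqrt h\<close> times the probability.\<close>

lemma increment_exceeds:
  assumes "0 \<le> s" "0 < h" "16 * r \<le> sqrt h"
  shows "1 / 32 \<le> prob {\<omega> \<in> space M. r \<le> W (s + h) \<omega> - W s \<omega>}"
proof -
  define Z where "Z \<omega> = W (s + h) \<omega> - W s \<omega>" for \<omega>
  note m = increment_moments[OF assms(1,2), folded Z_def]
  have [measurable]: "Z \<in> borel_measurable M" using m(1) by auto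
  let ?A = "{\<omega> \<in> space M. r \<le> Z \<omega>}"
  have A: "?A \<in> sets M" by measurable
  define \<epsilon> where "\<epsilon> = 1 / (8 * sqrt h)"
  have \<epsilon>: "0 < \<epsilon>" "\<epsilon> * h = sqrt h / 8" "\<epsilon> * sqrt h = 1 / 8"
    using assms by (auto simp: \<epsilon>_def field_simps)
  define r' where "r' = sqrt h / 16"
  have r': "r \<le> r'" "0 \<le> r'" using assms by (auto simp: r'_def)
  have iA: "integrable M (\<lambda>\<omega>. indicator ?A \<omega> :: real)"
    by (rule integrable_real_indicator[OF A]) (simp add: less_top[symmetric])
  have "expectation (\<lambda>\<omega>. \<bar>Z \<omega>\<bar> + Z \<omega>) \<le> expectation (\<lambda>\<omega>. 2 * r' + \<epsilon> * (Z \<omega>)\<^sup>2 + 1 / \<epsilon> * indicator ?A \<omega>)"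
  proof (rule integral_mono)
    fix \<omega> assume w: "\<omega> \<in> space M"
    have sq: "0 \<le> \<epsilon> * (Z \<omega>)\<^sup>2" using \<epsilon> by simp
    show "\<bar>Z \<omega>\<bar> + Z \<omega> \<le> 2 * r' + \<epsilon> * (Z \<omega>)\<^sup>2 + 1 / \<epsilon> * indicator ?A \<omega>"
    proof (cases "r \<le> Z \<omega>")
      case True
      have "0 \<le> (\<epsilon> * Z \<omega> - 1)\<^sup>2 / \<epsilon>" using \<epsilon> by simp
      also have "\<dots> = \<epsilon> * (Z \<omega>)\<^sup>2 - 2 * Z \<omega> + 1 / \<epsilon>"
        using \<epsilon>(1) by (simp add: power2_eq_square field_simps)
      finally have "2 * Z \<omega> \<le> \<epsilon> * (Z \<omega>)\<^sup>2 + 1 / \<epsilon>" by simp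
      moreover have "0 < 1 / \<epsilon>" using \<epsilon> by simp
      moreover have "(indicator ?A \<omega> :: real) = 1" using True w by simp
      ultimately show ?thesis using sq r' by (simp only: mult_1_right)
    next
      case False
      then have "\<bar>Z \<omega>\<bar> + Z \<omega> \<le> 2 * r'" using r' by linarith
      with False sq show ?thesis by simp
    qed
  qed (use m iA in auto)
  also have "\<dots> = 2 * r' + \<epsilon> * h + 1 / \<epsilon> * prob ?A"
    using m(3,4) iA A by (simp add: prob_space)
  also have "expectation (\<lambda>\<omega>. \<bar>Z \<omega>\<bar> + Z \<omega>) = expectation (\<lambda>\<omega>. \<bar>Z \<omega>\<bar>)" using m by simp
  finally have "sqrt h / 2 \<le> 2 * r' + sqrt h / 8 + 1 / \<epsilon> * prob ?A" using m(9) \<epsilon> by simp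
  then have "sqrt h / 4 \<le> 1 / \<epsilon> * prob ?A" unfolding r'_def by linarith
  then have "\<epsilon> * (sqrt h / 4) \<le> \<epsilon> * (1 / \<epsilon> * prob ?A)" using \<epsilon> by (intro mult_left_mono) auto
  then show ?thesis using \<epsilon> by (simp add: Z_def)
qed

lemma increment_tail:
  assumes "0 \<le> s" "0 < h" "0 < r"
  shows "prob {\<omega> \<in> space M. W (s + h) \<omega> - W s \<omega> < - r} \<le> h / r\<^sup>2"
proof -
  define Z where "Z \<omega> = W (s + h) \<omega> - W s \<omega>" for \<omega>
  note m = increment_moments[OF assms(1,2), folded Z_def]
  have [measurable]: "Z \<in> borel_measurable M" using m(1) by auto
  let ?A = "{\<omega> \<in> space M. Z \<omega> < - r}"
  have A: "?A \<in> sets M" by measurable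
  have "r\<^sup>2 * prob ?A = expectation (\<lambda>\<omega>. r\<^sup>2 * indicator ?A \<omega>)" using A by simp
  also have "\<dots> \<le> expectation (\<lambda>\<omega>. (Z \<omega>)\<^sup>2)"
  proof (rule integral_mono)
    fix \<omega>
    have "r\<^sup>2 \<le> (Z \<omega>)\<^sup>2" if "Z \<omega> < - r"
      using power_mono[of r "- Z \<omega>" 2] that assms by simp
    then show "r\<^sup>2 * indicator ?A \<omega> \<le> (Z \<omega>)\<^sup>2" by (auto split: split_indicator)
  next
    show "integrable M (\<lambda>\<omega>. r\<^sup>2 * indicator ?A \<omega>)"
      using A by (intro integrable_mult_right integrable_real_indicator) (auto simp: less_top[symmetric])
  qed (rule m)
  finally show ?thesis using m(4) assms by (simp add: Z_def field_simps)
qed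

text \<open>Let \<open>B n\<close> say that the path stays below \<open>r\<close> at integer times
  up to \<open>n\<close>. Staying below forever forces either a very low value at time
  \<open>n\<close>, or the conjunction of \<open>B n\<close> with an independent event of
  probability at most \<open>31 / 32\<close>. In the limit the probability \<open>p\<close> of
  staying below forever satisfies \<open>p \<le> 31 / 32 * p\<close>.\<close>

lemma unbounded_above: "AE \<omega> in M. \<forall>r. \<exists>u\<ge>0. r \<le> W u \<omega>"
proof -
  have "AE \<omega> in M. \<exists>k::nat. real r \<le> W (real k) \<omega>" for r :: nat
  proof -
    define B where "B n = {\<omega> \<in> space M. \<forall>k\<le>n. W (real k) \<omega> < real r}" for n :: nat
    have B_F: "B n \<in> sets (F (real n))" for n
    proof -
      have "B n = (\<Inter>k\<le>n. {\<omega> \<in> space (F (real n)). W (real k) \<omega> < real r})"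
        by (auto simp: B_def space_F)
      also have "\<dots> \<in> sets (F (real n))"
      proof (rule sets.finite_INT)
        fix k assume "k \<in> {..n}"
        then have "W (real k) \<in> borel_measurable (F (real n))"
          using measurable_F_mono[OF adapted, of "real k" "real n"] by simp
        then show "{\<omega> \<in> space (F (real n)). W (real k) \<omega> < real r} \<in> sets (F (real n))" by measurable
      qed auto
      finally show ?thesis .
    qed
    then have B: "B n \<in> sets M" for n using sets_F by blast
    have dec: "decseq B" by (auto simp: decseq_def B_def)
    let ?B = "\<Inter>n. B n"
    have lim: "(\<lambda>n. prob (B n)) \<longlonglongrightarrow> prob ?B"
      by (rule finite_Lim_measure_decseq) (use B dec in auto)
    have step: "prob ?B \<le> 1 / real n + 31 / 32 * prob (B n)" if n: "0 < n" for n
    proof -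
      \<comment> \<open>The waiting time is chosen so that an increment of \<open>r + n\<close>,
        enough to climb from \<open>- n\<close> to \<open>r\<close>, has probability at least
        \<open>1 / 32\<close> by \<open>increment_exceeds\<close>.\<close>
      define d where "d = (16 * (r + n))\<^sup>2"
      have d: "0 < real d" "16 * (real r + real n) \<le> sqrt (real d)"
        using n by (auto simp: d_def)
      let ?L = "{\<omega> \<in> space M. W (0 + real n) \<omega> - W 0 \<omega> < - real n}"
      let ?U = "{\<omega> \<in> space M. real r + real n \<le> W (real n + real d) \<omega> - W (real n) \<omega>}"
      have W_meas [measurable]: "W (real k) \<in> borel_measurable M" for k using measurable_W by simp
      have W_nd [measurable]: "W (real n + real d) \<in> borel_measurable M" using measurable_W by simp
      have W_0 [measurable]: "W 0 \<in> borel_measurable M" using measurable_W by simp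
      have U: "?U \<in> sets M" and L: "?L \<in> sets M" by auto
      have U': "space M - ?U = (\<lambda>\<omega>. W (real n + real d) \<omega> - W (real n) \<omega>) -` {..<real r + real n} \<inter> space M"
        by auto
      have "indep_set (sets (F (real n)))
          {(\<lambda>\<omega>. W (real n + real d) \<omega> - W (real n) \<omega>) -` A \<inter> space M |A. A \<in> sets borel}"
        by (rule indep_increments) (use d in auto)
      from indep_setD[OF this B_F, of "space M - ?U"]
      have ind: "prob (B n \<inter> (space M - ?U)) = prob (B n) * prob (space M - ?U)"
        unfolding U' by (blast intro: borel_open open_lessThan)
      have "prob ?B \<le> prob (?L \<union> B n \<inter> (space M - ?U))"
      proof (rule finite_measure_mono_AE)
        show "AE \<omega> in M. \<omega> \<in> ?B \<longrightarrow> \<omega> \<in> ?L \<union> B n \<inter> (space M - ?U)"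
          using start
        proof eventually_elim
          case (elim \<omega>)
          show ?case
          proof
            assume w: "\<omega> \<in> ?B"
            then have "\<omega> \<in> B n" "\<omega> \<in> B (n + d)" by blast+
            then have "W (real n + real d) \<omega> < real r" "\<omega> \<in> space M"
              by (auto simp: B_def dest: spec[of _ "n + d"])
            with \<open>\<omega> \<in> B n\<close> elim show "\<omega> \<in> ?L \<union> B n \<inter> (space M - ?U)" by auto
          qed
        qed
        show "?L \<union> B n \<inter> (space M - ?U) \<in> sets M" using U L B by auto
      qed
      also have "\<dots> \<le> prob ?L + prob (B n \<inter> (space M - ?U))"
        using U L B by (intro measure_Un_le) auto
      also have "prob ?L \<le> real n / (real n)\<^sup>2" by (rule increment_tail) (use n in auto)
      also have "real n / (real n)\<^sup>2 = 1 / real n" by (simp add: power2_eq_square)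
      also have "prob (B n \<inter> (space M - ?U)) \<le> prob (B n) * (31 / 32)"
        unfolding ind using increment_exceeds[OF _ d] prob_compl[OF U]
        by (intro mult_left_mono) auto
      finally show ?thesis by simp
    qed
    have "(\<lambda>n. 1 / real n + 31 / 32 * prob (B n)) \<longlonglongrightarrow> 0 + 31 / 32 * prob ?B"
      by (intro tendsto_intros lim lim_1_over_n)
    then have "prob ?B \<le> 0 + 31 / 32 * prob ?B"
      by (rule LIMSEQ_le_const) (use step in \<open>auto intro!: exI[of _ 1]\<close>)
    then have "prob ?B = 0" using measure_nonneg[of M ?B] by linarith
    then have "AE \<omega> in M. \<omega> \<notin> ?B"
      using B by (intro AE_not_in) (auto simp: null_sets_def emeasure_eq_measure)
    then show ?thesis using AE_space
    proof eventually_elim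
      case (elim \<omega>)
      then show ?case by (auto simp: B_def not_less)
    qed
  qed
  then have "AE \<omega> in M. \<forall>r. \<exists>k::nat. real r \<le> W (real k) \<omega>" by (simp add: AE_all_countable)
  then show ?thesis
  proof eventually_elim
    case (elim \<omega>)
    show ?case
    proof
      fix r :: real
      obtain k where "real (nat \<lceil>r\<rceil>) \<le> W (real k) \<omega>" using elim by blast
      then show "\<exists>u\<ge>0. r \<le> W u \<omega>" by (intro exI[of _ "real k"]) linarith
    qed
  qed
qed

end

section \<open>Survival probabilities of the diffusion\<close>

lemma running_max_phase:
  assumes cont: "continuous_on {0..} x" and u: "0 \<le> u"
  shows "reached x n t \<Longrightarrow> 0 \<le> t \<Longrightarrow> t \<le> u \<Longrightarrow> n \<le> running_max x u"
    and "\<not> reached x n u \<Longrightarrow> running_max x u < n"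
    and "x 0 \<le> running_max x u"
proof -
  obtain s where s: "s \<in> {0..u}" "running_max x u = x s" "\<And>r. r \<in> {0..u} \<Longrightarrow> x r \<le> x s"
    using running_max_attained[OF cont u] by blast
  show "n \<le> running_max x u" if "reached x n t" "0 \<le> t" "t \<le> u"
    using that s(2,3) reached_iff[OF cont that(2), of n] by force
  show "running_max x u < n" if "\<not> reached x n u"
    using that s(1,2) reached_iff[OF cont u, of n] by force
  show "x 0 \<le> running_max x u" using s u by auto
qed

lemma reached_mono:
  assumes "continuous_on {0..} x" "reached x n t" "0 \<le> t" "t \<le> u"
  shows "reached x n u"
  using assms reached_iff[OF assms(1), of t n] reached_iff[OF assms(1), of u n] by auto

text \<open>A pointwise Chebyshev bound; 4 is the inverse square of \<open>1 / 2\<close>. In the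
  applications \<open>d\<close> is the drift or its deficit from \<open>b\<close>, and
  \<open>z\<close> is the displacement of the path.\<close>

lemma square_dominates_indicator:
  fixes b d z :: real
  assumes "0 < b" "0 \<le> d" "d \<le> b" "d \<noteq> 0 \<Longrightarrow> 1 / 2 \<le> \<bar>z\<bar>"
  shows "d \<le> 4 * b * z\<^sup>2"
proof (cases "d = 0")
  case False
  then have "(1 / 2)\<^sup>2 \<le> \<bar>z\<bar>\<^sup>2" using assms by (intro power_mono) auto
  then have "1 \<le> 4 * z\<^sup>2" by (simp add: power_divide)
  then have "b * 1 \<le> b * (4 * z\<^sup>2)" using assms by (intro mult_left_mono) auto
  with assms(3) have "d \<le> b * (4 * z\<^sup>2)" by linarith
  then show ?thesis by (simp add: mult_ac)
qed (use assms in simp)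

text \<open>\<open>threshold_mono\<close> is the form in which the bound on the derivative of
  \<open>\<gamma>\<close> enters: the switching point never moves down while the running maximum
  grows.\<close>

locale switched_drift_diffusion = two_phase_diffusion M F W "\<lambda>_. b" "\<lambda>_. 0" \<gamma> x\<^sub>0 X
  for M :: "'w measure" and F :: "real \<Rightarrow> 'w measure" and W :: "real \<Rightarrow> 'w \<Rightarrow> real"
    and b :: real and \<gamma> :: "real \<Rightarrow> real" and x\<^sub>0 :: real and X :: "real \<Rightarrow> 'w \<Rightarrow> real" +
  assumes b: "0 < b" and x0: "0 \<le> x\<^sub>0"
    and threshold_mono: "\<And>x y. 0 \<le> x \<Longrightarrow> x \<le> y \<Longrightarrow> x - \<gamma> x \<le> y - \<gamma> y"
begin

abbreviation drift :: "'w \<Rightarrow> real \<Rightarrow> real" where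
  "drift \<omega> s \<equiv> two_phase_drift (\<lambda>_. b) (\<lambda>_. 0) \<gamma> s (\<lambda>r. X r \<omega>)"

lemma drift_bounds: "0 \<le> drift \<omega> s" "drift \<omega> s \<le> b"
  using b by (auto simp: two_phase_drift_def)

lemma increment_eq:
  "AE \<omega> in M. \<forall>s t. 0 \<le> s \<longrightarrow> s \<le> t \<longrightarrow> set_integrable lborel {s..t} (drift \<omega>) \<and>
    X t \<omega> - X s \<omega> - (W t \<omega> - W s \<omega>) = (LINT u:{s..t}|lborel. drift \<omega> u)"
  using equation
proof eventually_elim
  case (elim \<omega>)
  show ?case
  proof (intro allI impI)
    fix s t :: real assume st: "0 \<le> s" "s \<le> t"
    then have t: "0 \<le> t" by simp
    note eq = elim[rule_format, OF st(1)] elim[rule_format, OF t]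
    have int: "set_integrable lborel {s..t} (drift \<omega>)"
      by (rule set_integrable_subset[OF conjunct1[OF eq(2)]]) (use st in auto)
    have "(LINT u:{0..s} \<union> {s..t}|lborel. drift \<omega> u)
        = (LINT u:{0..s}|lborel. drift \<omega> u) + (LINT u:{s..t}|lborel. drift \<omega> u)"
    proof (rule set_integral_Un_AE)
      show "AE x in lborel. \<not> (x \<in> {0..s} \<and> x \<in> {s..t})"
        using AE_lborel_singleton[of s] by eventually_elim auto
    qed (use eq int in auto)
    moreover have "{0..s} \<union> {s..t} = {0..t}" using st by auto
    ultimately show "set_integrable lborel {s..t} (drift \<omega>) \<and>
        X t \<omega> - X s \<omega> - (W t \<omega> - W s \<omega>) = (LINT u:{s..t}|lborel. drift \<omega> u)"
      using eq int by auto
  qed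
qed

lemma drift_integral_bounds:
  assumes "set_integrable lborel {s..t} (drift \<omega>)" "s \<le> t"
  shows "0 \<le> (LINT u:{s..t}|lborel. drift \<omega> u)" "(LINT u:{s..t}|lborel. drift \<omega> u) \<le> b * (t - s)"
proof -
  have const: "set_integrable lborel {s..t} (\<lambda>_. k :: real)" for k
    by (rule borel_integrable_atLeastAtMost'[OF continuous_on_const])
  have "(LINT u:{s..t}|lborel. drift \<omega> u) \<le> (LINT u:{s..t}|lborel. b)"
    by (rule set_integral_mono[OF assms(1) const]) (rule drift_bounds)
  then show "(LINT u:{s..t}|lborel. drift \<omega> u) \<le> b * (t - s)"
    using assms(2) by (simp add: set_integral_const mult.commute)
  have "(LINT u:{s..t}|lborel. 0) \<le> (LINT u:{s..t}|lborel. drift \<omega> u)"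
    by (rule set_integral_mono[OF const assms(1)]) (rule drift_bounds)
  then show "0 \<le> (LINT u:{s..t}|lborel. drift \<omega> u)"
    using assms(2) by (simp add: set_integral_const)
qed

lemma drift_increment_bound:
  "AE \<omega> in M. \<forall>s t. 0 \<le> s \<longrightarrow> s \<le> t \<longrightarrow> \<bar>X t \<omega> - X s \<omega> - (W t \<omega> - W s \<omega>)\<bar> \<le> b * (t - s)"
  using increment_eq
proof eventually_elim
  case (elim \<omega>)
  then show ?case using drift_integral_bounds by fastforce
qed

lemma X_start: "AE \<omega> in M. X 0 \<omega> = x\<^sub>0"
  using equation start
proof eventually_elim
  case (elim \<omega>)
  have "(LINT u:{0..0}|lborel. drift \<omega> u) = 0"
    using drift_integral_bounds[of 0 0 \<omega>] elim(1)[rule_format, of 0] by simp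
  then show ?case using elim(1)[rule_format, of 0] elim(2) by simp
qed

text \<open>The drift is nonnegative, so the path dominates \<open>x\<^sub>0 + W\<close>.\<close>

lemma X_unbounded: "AE \<omega> in M. \<forall>r. \<exists>u\<ge>0. r \<le> X u \<omega>"
  using unbounded_above increment_eq X_start start
proof eventually_elim
  case (elim \<omega>)
  show ?case
  proof
    fix r
    obtain u where u: "0 \<le> u" "r - x\<^sub>0 \<le> W u \<omega>" using elim(1) by blast
    have "0 \<le> X u \<omega> - X 0 \<omega> - (W u \<omega> - W 0 \<omega>)"
      using elim(2)[rule_format, of 0 u] drift_integral_bounds[of 0 u \<omega>] u by simp
    then show "\<exists>u\<ge>0. r \<le> X u \<omega>" using u elim(3,4) by (intro exI[of _ u]) auto
  qed
qed

text \<open>The switching point of the scale function is displaced by \<open>1\<close>, and that of \<open>q\<close> lies halfway. So if the actual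
  drift is worse than the model drift during a time step, the path has moved by at least \<open>1/2\<close>, and the
  discrepancy is dominated by the squared displacement.\<close>

lemma generator_upper:
  assumes n: "0 \<le> n" and c: "c = n - \<gamma> n - 1"
  shows "AE \<omega> in M. \<forall>t\<ge>0. \<forall>h>0. phase (\<lambda>s. X s \<omega>) a k n t \<longrightarrow>
      scale_density b c (X t \<omega>) * (X (t + h) \<omega> - X t \<omega> - (W (t + h) \<omega> - W t \<omega>))
        + (if c + 1 / 2 \<le> X t \<omega> then - (2 * b * scale_density b c (X t \<omega>)) else 0) / 2 * h
      \<le> 4 * b * ((LINT u:{t..t + h}|lborel. (X u \<omega> - X t \<omega>)\<^sup>2)
        + h * (if phase (\<lambda>s. X s \<omega>) a k n (t + h) then 0 else 1))"
  using increment_eq continuous_paths_X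
proof eventually_elim
  case (elim \<omega>)
  show ?case
  proof (intro allI impI)
    fix t h :: real assume t: "0 \<le> t" "0 < h" and ph: "phase (\<lambda>s. X s \<omega>) a k n t"
    let ?D = "X (t + h) \<omega> - X t \<omega> - (W (t + h) \<omega> - W t \<omega>)"
    let ?I = "LINT u:{t..t + h}|lborel. (X u \<omega> - X t \<omega>)\<^sup>2"
    let ?s = "scale_density b c (X t \<omega>)"
    have int: "set_integrable lborel {t..t + h} (drift \<omega>)" and D: "?D = (LINT u:{t..t + h}|lborel. drift \<omega> u)"
      using elim(1)[rule_format, of t "t + h"] t by auto
    have D': "0 \<le> ?D" "?D \<le> b * h" using drift_integral_bounds[OF int] t unfolding D by auto
    have I: "0 \<le> ?I" unfolding set_lebesgue_integral_def by (rule integral_nonneg_AE) auto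
    have s: "0 < ?s" "?s \<le> 1" using scale_density_pos scale_density_le_1[OF b] by auto
    have R: "4 * b * ?I \<le> 4 * b * (?I + h * (if phase (\<lambda>s. X s \<omega>) a k n (t + h) then 0 else 1))"
      using b t by (intro mult_left_mono) auto
    have "?s * ?D + (if c + 1 / 2 \<le> X t \<omega> then - (2 * b * ?s) else 0) / 2 * h \<le> 4 * b * ?I"
    proof (cases "c + 1 / 2 \<le> X t \<omega>")
      case True
      have "?s * ?D \<le> ?s * (b * h)" using D' s by (intro mult_left_mono) auto
      moreover have "0 \<le> 4 * b * ?I" using b I by simp
      moreover have "(if c + 1 / 2 \<le> X t \<omega> then - (2 * b * ?s) else 0) / 2 * h = - (?s * (b * h))"
        using True by simp
      ultimately show ?thesis by linarith
    next
      case False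
      have "?s * ?D \<le> 1 * ?D" using s D' by (intro mult_right_mono) auto
      also have "1 * ?D \<le> (LINT u:{t..t + h}|lborel. 4 * b * (X u \<omega> - X t \<omega>)\<^sup>2)"
        unfolding D mult_1
      proof (rule set_integral_mono[OF int])
        show "set_integrable lborel {t..t + h} (\<lambda>u. 4 * b * (X u \<omega> - X t \<omega>)\<^sup>2)"
          by (intro borel_integrable_atLeastAtMost' continuous_intros continuous_on_subset[OF elim(2)]) (use t in auto)
        fix u assume u: "u \<in> {t..t + h}"
        show "drift \<omega> u \<le> 4 * b * (X u \<omega> - X t \<omega>)\<^sup>2"
        proof (rule square_dominates_indicator[OF b drift_bounds])
          assume "drift \<omega> u \<noteq> 0"
          \<comment> \<open>This remains true after the end of the phase, so the step in which the
            phase ends needs no special treatment here.\<close>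
          moreover have "n \<le> running_max (\<lambda>r. X r \<omega>) u"
            using running_max_phase(1)[OF elim(2), of u n t] ph t u by (auto simp: phase_def)
          ultimately have "n - \<gamma> n < X u \<omega>"
            using threshold_mono[OF n, of "running_max (\<lambda>r. X r \<omega>) u"]
            by (auto simp: two_phase_drift_def split: if_splits)
          then show "1 / 2 \<le> \<bar>X u \<omega> - X t \<omega>\<bar>" using False c by linarith
        qed
      qed
      finally show ?thesis using False by simp
    qed
    then show "?s * ?D + (if c + 1 / 2 \<le> X t \<omega> then - (2 * b * ?s) else 0) / 2 * h
        \<le> 4 * b * (?I + h * (if phase (\<lambda>s. X s \<omega>) a k n (t + h) then 0 else 1))"
      using R by (rule order_trans)
  qed
qed

text \<open>Here the actual drift must not be off where the model drift is on. While the phase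
  lasts, the running maximum is below \<open>n + 1\<close>, so the drift is off only at or below
  \<open>c - 1\<close>, at least \<open>1 / 2\<close> away from any starting point above
  \<open>c - 1 / 2\<close>. If the phase is over at the end of the step, this control may be lost,
  and the deficit of at most \<open>b * h\<close> is charged to the exit term.\<close>

lemma generator_lower:
  assumes n: "0 \<le> n" and c: "c = (n + 1) - \<gamma> (n + 1) + 1"
  shows "AE \<omega> in M. \<forall>t\<ge>0. \<forall>h>0. phase (\<lambda>s. X s \<omega>) a k n t \<longrightarrow>
      - scale_density b c (X t \<omega>) * (X (t + h) \<omega> - X t \<omega> - (W (t + h) \<omega> - W t \<omega>))
        + (if c - 1 / 2 \<le> X t \<omega> then 2 * b * scale_density b c (X t \<omega>) else 0) / 2 * h
      \<le> 4 * b * ((LINT u:{t..t + h}|lborel. (X u \<omega> - X t \<omega>)\<^sup>2)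
        + h * (if phase (\<lambda>s. X s \<omega>) a k n (t + h) then 0 else 1))"
  using increment_eq continuous_paths_X X_start
proof eventually_elim
  case (elim \<omega>)
  show ?case
  proof (intro allI impI)
    fix t h :: real assume t: "0 \<le> t" "0 < h" and ph: "phase (\<lambda>s. X s \<omega>) a k n t"
    let ?D = "X (t + h) \<omega> - X t \<omega> - (W (t + h) \<omega> - W t \<omega>)"
    let ?I = "LINT u:{t..t + h}|lborel. (X u \<omega> - X t \<omega>)\<^sup>2"
    let ?s = "scale_density b c (X t \<omega>)"
    let ?R = "?I + h * (if phase (\<lambda>s. X s \<omega>) a k n (t + h) then 0 else 1)"
    have int: "set_integrable lborel {t..t + h} (drift \<omega>)" and D: "?D = (LINT u:{t..t + h}|lborel. drift \<omega> u)"
      using elim(1)[rule_format, of t "t + h"] t by auto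
    have D': "0 \<le> ?D" "?D \<le> b * h" using drift_integral_bounds[OF int] t unfolding D by auto
    have I: "0 \<le> ?I" unfolding set_lebesgue_integral_def by (rule integral_nonneg_AE) auto
    have s: "0 < ?s" "?s \<le> 1" using scale_density_pos scale_density_le_1[OF b] by auto
    have R: "0 \<le> 4 * b * ?R" using b t I by simp
    show "- ?s * ?D + (if c - 1 / 2 \<le> X t \<omega> then 2 * b * ?s else 0) / 2 * h \<le> 4 * b * ?R"
    proof (cases "c - 1 / 2 \<le> X t \<omega>")
      case True
      have "- ?s * ?D + (if c - 1 / 2 \<le> X t \<omega> then 2 * b * ?s else 0) / 2 * h = ?s * (b * h - ?D)"
        using True by (simp add: algebra_simps)
      also have "\<dots> \<le> 1 * (b * h - ?D)" using s D' by (intro mult_right_mono) auto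
      also have "\<dots> \<le> 4 * b * ?R"
      proof (cases "phase (\<lambda>s. X s \<omega>) a k n (t + h)")
        case False
        have "b * h \<le> 4 * b * h" using b t by simp
        moreover have "0 \<le> 4 * b * ?I" using b I by simp
        ultimately show ?thesis using False D' by (simp add: distrib_left)
      next
        case phase: True
        have const: "set_integrable lborel {t..t + h} (\<lambda>_. b)"
          by (rule borel_integrable_atLeastAtMost'[OF continuous_on_const])
        have "b * h - ?D = (LINT u:{t..t + h}|lborel. b - drift \<omega> u)"
          unfolding D using t by (subst set_integral_diff(2)[OF const int]) (simp add: set_integral_const)
        also have "\<dots> \<le> (LINT u:{t..t + h}|lborel. 4 * b * (X u \<omega> - X t \<omega>)\<^sup>2)"
        proof (rule set_integral_mono[OF set_integral_diff(1)[OF const int]])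
          show "set_integrable lborel {t..t + h} (\<lambda>u. 4 * b * (X u \<omega> - X t \<omega>)\<^sup>2)"
            by (intro borel_integrable_atLeastAtMost' continuous_intros continuous_on_subset[OF elim(2)]) (use t in auto)
          fix u assume u: "u \<in> {t..t + h}"
          show "b - drift \<omega> u \<le> 4 * b * (X u \<omega> - X t \<omega>)\<^sup>2"
          proof (rule square_dominates_indicator[OF b])
            assume "b - drift \<omega> u \<noteq> 0"
            moreover have "\<not> reached (\<lambda>r. X r \<omega>) (n + 1) u"
              using reached_mono[OF elim(2), of "n + 1" u "t + h"] phase u t by (auto simp: phase_def)
            then have "running_max (\<lambda>r. X r \<omega>) u < n + 1"
              using running_max_phase(2)[OF elim(2), of u] u t by auto
            moreover have "0 \<le> running_max (\<lambda>r. X r \<omega>) u"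
              using running_max_phase(3)[OF elim(2), of u] u t x0 elim(3) by auto
            ultimately have "X u \<omega> \<le> n + 1 - \<gamma> (n + 1)"
              using threshold_mono[of "running_max (\<lambda>r. X r \<omega>) u" "n + 1"]
              by (auto simp: two_phase_drift_def split: if_splits)
            then show "1 / 2 \<le> \<bar>X u \<omega> - X t \<omega>\<bar>" using True c by linarith
          qed (use drift_bounds[of u \<omega>] in auto)
        qed
        finally show ?thesis using phase by simp
      qed
      finally show ?thesis .
    next
      case False
      have "0 \<le> ?s * ?D" using s D' by simp
      then show ?thesis using False R by simp
    qed
  qed
qed

definition survival :: "real \<Rightarrow> real \<Rightarrow> real \<Rightarrow> real" where
  "survival a c n = prob {\<omega> \<in> space M. survives (\<lambda>s. X s \<omega>) a c n}"

text \<open>The model switching point lies one unit below the lowest actual one of the phase, so the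
  model drift dominates the actual drift and \<open>scale_fun\<close> behaves as a supermartingale.
  The exit inequality for the points \<open>x\<^sub>1\<close>, \<open>n\<close>,
  \<open>n + 1\<close> is then rearranged.\<close>

lemma survival_upper:
  assumes levels: "x\<^sub>0 < a" "x\<^sub>1 < a" "a \<le> n" and c: "c = n - \<gamma> n - 1"
  shows "survival a x\<^sub>1 (n + 1) * (scale_fun b c (n + 1) - scale_fun b c x\<^sub>1)
    \<le> survival a x\<^sub>1 n * (scale_fun b c n - scale_fun b c x\<^sub>1)"
proof -
  define l where "l = x\<^sub>1 - 1 / 2"
  obtain K where K: "0 \<le> K" "\<And>x. l + 1 / 2 \<le> x \<Longrightarrow> cubic_bound (\<lambda>y. scale_fun b c (max y l)) (scale_density b c x)
      (if c + 1 / 2 \<le> x then - (2 * b * scale_density b c x) else 0) K x"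
    using cubic_bound_flat_scale_fun(1)[OF b, of l c] by blast
  have n: "0 \<le> n" using x0 levels by simp
  have s: "\<bar>scale_density b c x\<bar> \<le> 1" for x
    using scale_density_pos[of b c x] scale_density_le_1[OF b, of c x] by simp
  have q: "\<bar>if c + 1 / 2 \<le> x then - (2 * b * scale_density b c x) else 0\<bar> \<le> 2 * b" for x
    using s[of x] b by (auto simp: abs_mult)
  have "scale_fun b c (max (n + 1) l) * survival a x\<^sub>1 (n + 1)
      + scale_fun b c (max x\<^sub>1 l) * (survival a x\<^sub>1 n - survival a x\<^sub>1 (n + 1))
      \<le> scale_fun b c (max n l) * survival a x\<^sub>1 n"
    unfolding survival_def
  proof (rule exit_inequality[where P=1 and Q="2 * b", OF adapted_X continuous_paths_X drift_increment_bound X_unbounded _ levels(2,3) _ _ _ _ _ _ K(1) _ _ _ generator_upper[OF n c]])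
    show "AE \<omega> in M. X 0 \<omega> < a" using X_start by eventually_elim (use levels in simp)
    show "continuous_on UNIV (\<lambda>y. scale_fun b c (max y l))"
      by (rule continuous_on_compose2[OF continuous_on_scale_fun[OF b, of UNIV]]) (auto intro!: continuous_intros)
    show "(\<lambda>x. if c + 1 / 2 \<le> x then - (2 * b * scale_density b c x) else 0) \<in> borel_measurable borel" by measurable
    show "\<bar>scale_fun b c (max x l)\<bar> \<le> \<bar>scale_fun b c l\<bar> + 1 / (2 * b)" for x
      by (rule flat_scale_bound[OF b])
  qed (use b s q K(2) in \<open>auto simp: l_def\<close>)
  then show ?thesis using levels by (simp add: l_def max_def algebra_simps)
qed

text \<open>Now the model switching point lies one unit above the highest actual one of the phase.
  The model drift is the weaker one, and the negated scale function behaves as a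
  supermartingale.\<close>

lemma survival_lower:
  assumes levels: "x\<^sub>0 < a" "x\<^sub>1 < a" "a \<le> n" and c: "c = (n + 1) - \<gamma> (n + 1) + 1"
  shows "survival a x\<^sub>1 n * (scale_fun b c n - scale_fun b c x\<^sub>1)
    \<le> survival a x\<^sub>1 (n + 1) * (scale_fun b c (n + 1) - scale_fun b c x\<^sub>1)"
proof -
  define l where "l = x\<^sub>1 - 1 / 2"
  obtain K where K: "0 \<le> K" "\<And>x. l + 1 / 2 \<le> x \<Longrightarrow> cubic_bound (\<lambda>y. - scale_fun b c (max y l)) (- scale_density b c x)
      (if c - 1 / 2 \<le> x then 2 * b * scale_density b c x else 0) K x"
    using cubic_bound_flat_scale_fun(2)[OF b, of l c] by blast
  have n: "0 \<le> n" using x0 levels by simp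
  have s: "\<bar>- scale_density b c x\<bar> \<le> 1" for x
    using scale_density_pos[of b c x] scale_density_le_1[OF b, of c x] by simp
  have q: "\<bar>if c - 1 / 2 \<le> x then 2 * b * scale_density b c x else 0\<bar> \<le> 2 * b" for x
    using s[of x] b by (auto simp: abs_mult)
  have "- scale_fun b c (max (n + 1) l) * survival a x\<^sub>1 (n + 1)
      + - scale_fun b c (max x\<^sub>1 l) * (survival a x\<^sub>1 n - survival a x\<^sub>1 (n + 1))
      \<le> - scale_fun b c (max n l) * survival a x\<^sub>1 n"
    unfolding survival_def
  proof (rule exit_inequality[where P=1 and Q="2 * b", OF adapted_X continuous_paths_X drift_increment_bound X_unbounded _ levels(2,3) _ _ _ _ _ _ K(1) _ _ _ generator_lower[OF n c]])
    show "AE \<omega> in M. X 0 \<omega> < a" using X_start by eventually_elim (use levels in simp)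
    show "continuous_on UNIV (\<lambda>y. - scale_fun b c (max y l))"
      by (intro continuous_on_minus continuous_on_compose2[OF continuous_on_scale_fun[OF b, of UNIV]]) (auto intro!: continuous_intros)
    show "(\<lambda>x. if c - 1 / 2 \<le> x then 2 * b * scale_density b c x else 0) \<in> borel_measurable borel" by measurable
    show "(\<lambda>x. - scale_density b c x) \<in> borel_measurable borel" by measurable
    show "\<bar>- scale_fun b c (max x l)\<bar> \<le> \<bar>scale_fun b c l\<bar> + 1 / (2 * b)" for x
      using flat_scale_bound[OF b, of c x l] by simp
  qed (use b s q K(2) in \<open>auto simp: l_def\<close>)
  then show ?thesis using levels by (simp add: l_def max_def algebra_simps)
qed

lemma survival_start:
  assumes "x\<^sub>0 < a" "x\<^sub>1 < a"
  shows "survival a x\<^sub>1 a = 1"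
proof -
  have "AE \<omega> in M. survives (\<lambda>s. X s \<omega>) a x\<^sub>1 a"
    using X_start continuous_paths_X X_unbounded
  proof eventually_elim
    case (elim \<omega>)
    let ?x = "\<lambda>s. X s \<omega>"
    have lt: "?x 0 < a" using elim assms by simp
    have unb: "\<exists>u\<ge>0. r \<le> ?x u" for r using elim by blast
    obtain T where T: "0 < T" "?x T = a" "\<And>t. 0 \<le> t \<Longrightarrow> reached ?x a t \<longleftrightarrow> T \<le> t"
      using reached_threshold[OF elim(2) lt unb] by metis
    have "\<not> crossed ?x a x\<^sub>1 T"
      using crossed_threshold[OF elim(2) lt unb assms(2) less_imp_le[OF T(1)] T(2)] T(1,3) by force
    then show ?case
      unfolding phase_interval(4)[OF elim(2) unb lt assms(2) order_refl] using T by (intro exI[of _ T]) auto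
  qed
  then show ?thesis unfolding survival_def
    using measurable_survives[OF adapted_X] by (subst prob_eq_1) auto
qed

end

section \<open>Recurrence and transience\<close>

lemma ln_diff_bounds:
  fixes u v :: real
  assumes "0 < u" "u \<le> v"
  shows "ln v - ln u \<le> (v - u) / u" "(v - u) / v \<le> ln v - ln u"
proof -
  have "ln (v / u) \<le> v / u - 1" using assms by (intro ln_le_minus_one) auto
  then show "ln v - ln u \<le> (v - u) / u" using assms by (simp add: ln_div field_simps)
  have "ln (u / v) \<le> u / v - 1" using assms by (intro ln_le_minus_one) auto
  then show "(v - u) / v \<le> ln v - ln u" using assms by (simp add: ln_div field_simps)
qed

text \<open>The threefold logarithm is a primitive of the right-hand side. In this telescoping form
  it replaces the integral test for the divergence that drives recurrence.\<close>

lemma triple_ln_increment: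
  fixes x :: real
  assumes "1 < x" "1 < ln x"
  shows "ln (ln (ln (x + 1))) - ln (ln (ln x)) \<le> 1 / (x * ln x * ln (ln x))"
proof -
  have pos: "0 < ln (ln x)" using assms by simp
  have 1: "ln x \<le> ln (x + 1)" using assms by simp
  then have 2: "ln (ln x) \<le> ln (ln (x + 1))" using assms by simp
  have a: "ln (x + 1) - ln x \<le> 1 / x" using ln_diff_bounds(1)[of x "x + 1"] assms by simp
  have "ln (ln (x + 1)) - ln (ln x) \<le> (ln (x + 1) - ln x) / ln x"
    using ln_diff_bounds(1)[OF _ 1] assms by simp
  also have "\<dots> \<le> 1 / x / ln x" using a assms by (intro divide_right_mono) auto
  finally have b: "ln (ln (x + 1)) - ln (ln x) \<le> 1 / x / ln x" .
  have "ln (ln (ln (x + 1))) - ln (ln (ln x)) \<le> (ln (ln (x + 1)) - ln (ln x)) / ln (ln x)"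
    by (rule ln_diff_bounds(1)[OF pos 2])
  also have "\<dots> \<le> 1 / x / ln x / ln (ln x)" using b pos by (intro divide_right_mono) auto
  finally show ?thesis by (simp add: mult_ac)
qed

text \<open>The convergent counterpart: \<open>- ln (ln x) powr (1 - k) / (k - 1)\<close> is a
  primitive of the summand, and it is bounded at infinity because \<open>k > 1\<close>.\<close>

lemma double_ln_powr_increment:
  fixes x k :: real
  assumes "1 < x" "1 < ln x" "1 < k"
  shows "1 / ((x + 1) * ln (x + 1) * ln (ln (x + 1)) powr k)
    \<le> (ln (ln x) powr (1 - k) - ln (ln (x + 1)) powr (1 - k)) / (k - 1)"
proof -
  define v v' where "v = ln (ln x)" and "v' = ln (ln (x + 1))"
  have 1: "ln x \<le> ln (x + 1)" using assms by simp
  have v: "0 < v" "v \<le> v'" using assms 1 by (auto simp: v_def v'_def)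
  have u: "0 < ln (x + 1)" using assms 1 by linarith
  have a: "1 / (x + 1) \<le> ln (x + 1) - ln x" using ln_diff_bounds(2)[of x "x + 1"] assms by simp
  have "1 / (x + 1) / ln (x + 1) \<le> (ln (x + 1) - ln x) / ln (x + 1)"
    using a u by (intro divide_right_mono) auto
  also have "\<dots> \<le> v' - v" unfolding v_def v'_def using ln_diff_bounds(2)[OF _ 1] assms by simp
  finally have d: "1 / ((x + 1) * ln (x + 1)) \<le> v' - v" by simp
  \<comment> \<open>The quotient of the two powers is \<open>exp ((k - 1) * (ln v' - ln v))\<close>,
    so the tangent bound for the exponential function yields the increment of the power.\<close>
  have "(k - 1) * ((v' - v) / v') \<le> (k - 1) * (ln v' - ln v)"
    by (rule mult_left_mono[OF ln_diff_bounds(2)[OF v]]) (use assms in simp)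
  then have "1 + (k - 1) * ((v' - v) / v') \<le> 1 + (k - 1) * (ln v' - ln v)" by simp
  also have "\<dots> \<le> exp ((k - 1) * (ln v' - ln v))" by (rule exp_ge_add_one_self)
  finally have "v' powr (1 - k) * (1 + (k - 1) * ((v' - v) / v')) \<le> v' powr (1 - k) * exp ((k - 1) * (ln v' - ln v))"
    by (rule mult_left_mono) simp
  also have "\<dots> = v powr (1 - k)"
    using v by (simp add: powr_def exp_add[symmetric] algebra_simps)
  finally have p: "(k - 1) * (v' powr (1 - k) * ((v' - v) / v')) \<le> v powr (1 - k) - v' powr (1 - k)"
    by (simp add: algebra_simps)
  have q: "v' powr (1 - k) * ((v' - v) / v') = (v' - v) * v' powr (- k)"
    using v by (simp add: powr_diff powr_minus_divide)
  have e: "(k - 1) * ((v' - v) * v' powr (- k)) \<le> v powr (1 - k) - v' powr (1 - k)"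
    using p unfolding q .
  have "1 / ((x + 1) * ln (x + 1)) * v' powr (- k) \<le> (v' - v) * v' powr (- k)"
    using d by (rule mult_right_mono) simp
  also have "\<dots> \<le> (v powr (1 - k) - v' powr (1 - k)) / (k - 1)"
    using e assms by (simp add: field_simps)
  finally show ?thesis by (simp add: v_def v'_def powr_minus_divide)
qed

lemma iterated_ln: "(ln ^^ 2) x = ln (ln (x::real))" "(ln ^^ 3) x = ln (ln (ln (x::real)))"
  by (simp_all add: eval_nat_numeral)

text \<open>Choose a level \<open>m\<close> above everything attained up to time \<open>T\<close>. A
  crossing from \<open>m\<close> to \<open>c\<close> then takes place after \<open>T\<close>, and
  the intermediate value theorem gives the visit.\<close>

lemma recurrent_path:
  fixes x :: "real \<Rightarrow> real"
  assumes cont: "continuous_on {0..} x"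
    and cross: "\<And>m::nat. x 0 < m \<Longrightarrow> c < m \<Longrightarrow> \<exists>t\<ge>0. crossed x m c t"
  shows "\<exists>t\<ge>max 0 T. x t = c"
proof -
  define u where "u = max 0 T"
  have u: "0 \<le> u" by (simp add: u_def)
  obtain m :: nat where m: "max (running_max x u) c < m" using reals_Archimedean2 by blast
  obtain s0 where s0: "running_max x u = x s0" "\<And>r. r \<in> {0..u} \<Longrightarrow> x r \<le> x s0"
    using running_max_attained[OF cont u] by blast
  have "x 0 < m" using s0(2)[of 0] s0(1) u m by simp
  then obtain t where t: "0 \<le> t" "crossed x m c t" using cross m by force
  then obtain r s where rs: "0 \<le> r" "r \<le> s" "m \<le> x r" "x s \<le> c"
    unfolding crossed_iff[OF cont t(1)] by blast
  have "u < r" using s0(2)[of r] s0(1) m rs by (cases "r \<le> u") auto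
  have "\<exists>t\<ge>r. t \<le> s \<and> x t = c"
    by (rule IVT2') (use rs m in \<open>auto intro: continuous_on_subset[OF cont]\<close>)
  then obtain t where "r \<le> t" "x t = c" by blast
  with \<open>u < r\<close> show ?thesis by (intro exI[of _ t]) (auto simp: u_def)
qed

text \<open>Suppose the path is at or below \<open>c\<close> at a late time \<open>t\<close>, and
  let \<open>n\<close> be the largest integer level attained by then. The path has crossed from
  \<open>n\<close> to \<open>c\<close> before attaining \<open>n + 1\<close>, which contradicts
  survival with marker \<open>n\<close>.\<close>

lemma transient_path:
  fixes x :: "real \<Rightarrow> real" and m0 :: nat
  assumes cont: "continuous_on {0..} x" and unb: "\<And>r. \<exists>u\<ge>0. r \<le> x u"
    and surv: "\<And>m::nat. m0 \<le> m \<Longrightarrow> survives x m c (m + 1)"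
  shows "\<exists>T. \<forall>t\<ge>T. c < x t"
proof -
  obtain m1 :: nat where m1: "max (x 0) c < m1" using reals_Archimedean2 by blast
  define l :: nat where "l = max m0 m1"
  have l: "x 0 < l" "c < l" "m0 \<le> l" using m1 by (auto simp: l_def)
  obtain T where T: "0 < T" "\<And>t. 0 \<le> t \<Longrightarrow> reached x l t \<longleftrightarrow> T \<le> t"
    using reached_threshold[OF cont l(1) unb] by metis
  have "c < x t" if t: "T \<le> t" for t
  proof (rule ccontr)
    assume below: "\<not> c < x t"
    have t0: "0 \<le> t" using T t by simp
    obtain k :: nat where k: "running_max x t < k" using reals_Archimedean2 by blast
    have "m \<le> k" if "reached x (real m) t" for m :: nat
      using running_max_phase(1)[OF cont t0 that t0] k by simp
    moreover have lr: "reached x (real l) t" using T(2)[OF t0] t by blast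
    ultimately obtain n where n: "reached x (real n) t" "\<And>m. reached x (real m) t \<Longrightarrow> m \<le> n"
      using ex_has_greatest_nat[of "\<lambda>m. reached x (real m) t" l "\<lambda>m. m" "Suc k"] by (auto simp: less_Suc_eq_le)
    have ln: "l \<le> n" using n lr by blast
    then have lt: "x 0 < real n" "c < real n" using l by auto
    have "survives x n c (real n + 1)" using surv[of n] ln l by (simp add: add.commute)
    then obtain t' where t': "0 \<le> t'" "reached x (real n + 1) t'" "\<not> crossed x n c t'"
      using phase_interval(4)[OF cont unb lt, of "real n + 1"] by auto
    have "\<not> reached x (real n + 1) t" using n(2)[of "Suc n"] by (auto simp: add.commute)
    then have "t < t'" using reached_mono[OF cont t'(2,1)] t0 by (cases "t' \<le> t") auto
    obtain r where r: "r \<in> {0..t}" "n \<le> x r" using n(1) reached_iff[OF cont t0] by auto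
    have "crossed x n c t'"
      unfolding crossed_iff[OF cont t'(1)] using r below \<open>t < t'\<close> by (intro exI[of _ r] exI[of _ t]) auto
    then show False using t' by blast
  qed
  then show ?thesis by blast
qed

section \<open>Asymptotics of the survival probabilities and the two conclusions\<close>

context switched_drift_diffusion
begin

lemma survival_nonneg: "0 \<le> survival a c n"
  by (simp add: survival_def)

text \<open>Each level multiplies the survival probability by at most
  \<open>1 - \<delta> / A\<close>, hence by at most \<open>exp (- \<delta> / A)\<close>. Since
  \<open>\<delta> / A\<close> is at least \<open>\<kappa>\<close> times the increment of the
  threefold logarithm, the survival probability times \<open>exp (\<kappa> * ln (ln (ln n)))\<close>
  is eventually nonincreasing.\<close>

lemma survival_tendsto_0:
  assumes \<gamma>: "\<forall>\<^sub>F x in at_top. \<gamma> x \<le> 1 / (2 * b) * (ln ^^ 2) x + 1 / (2 * b) * (ln ^^ 3) x"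
    and pos: "\<And>x. 0 \<le> x \<Longrightarrow> 0 < \<gamma> x" and levels: "x\<^sub>0 < real N" "x\<^sub>1 < real N"
  shows "(\<lambda>m. survival N x\<^sub>1 (real m)) \<longlonglongrightarrow> 0"
proof -
  \<comment> \<open>\<open>exp (- (2 * b))\<close> is the price of the displacement by 1, the next
    factor is the growth of the exponential branch over one unit, and the final 2 comes from
    \<open>A \<le> 2 * n\<close>.\<close>
  define \<kappa> where "\<kappa> = exp (- (2 * b)) * (1 - exp (- (2 * b))) / (2 * b) / 2"
  have \<kappa>: "0 < \<kappa>" using b by (simp add: \<kappa>_def)
  let ?L = "\<lambda>x::real. ln (ln (ln x))"
  have "\<forall>\<^sub>F x in at_top. \<gamma> x \<le> 1 / (2 * b) * (ln ^^ 2) x + 1 / (2 * b) * (ln ^^ 3) x \<and>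
      1 - x\<^sub>1 \<le> x \<and> real N \<le> x \<and> 1 < x \<and> 1 < ln x"
    using \<gamma> by (intro eventually_conj eventually_ge_at_top eventually_gt_at_top
        filterlim_at_top_dense[THEN iffD1, rule_format, OF ln_at_top])
  then have "\<forall>\<^sub>F m in sequentially. \<gamma> (real m) \<le> 1 / (2 * b) * (ln ^^ 2) (real m) + 1 / (2 * b) * (ln ^^ 3) (real m) \<and>
      1 - x\<^sub>1 \<le> real m \<and> real N \<le> real m \<and> 1 < real m \<and> 1 < ln (real m)"
    by (rule eventually_compose_filterlim[OF _ filterlim_real_sequentially])
  then obtain m0 where m0: "\<And>m. m0 \<le> m \<Longrightarrow> \<gamma> (real m) \<le> 1 / (2 * b) * (ln ^^ 2) (real m) + 1 / (2 * b) * (ln ^^ 3) (real m) \<and>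
      1 - x\<^sub>1 \<le> real m \<and> real N \<le> real m \<and> 1 < real m \<and> 1 < ln (real m)"
    unfolding eventually_sequentially by blast
  have decrease: "survival N x\<^sub>1 (real (Suc m)) * exp (\<kappa> * ?L (real (Suc m))) \<le> survival N x\<^sub>1 (real m) * exp (\<kappa> * ?L (real m))"
    if m: "m0 \<le> m" for m
  proof -
    define n where "n = real m"
    have n: "\<gamma> n \<le> 1 / (2 * b) * ln (ln n) + 1 / (2 * b) * ?L n" "1 - x\<^sub>1 \<le> n" "real N \<le> n" "1 < n" "1 < ln n"
      using m0[OF m] unfolding n_def iterated_ln by blast+
    define c where "c = n - \<gamma> n - 1"
    have v: "0 < ln (ln n)" using n by simp
    have cn: "c \<le> n" using pos[of n] n by (simp add: c_def)
    \<comment> \<open>\<open>\<delta> / A\<close> is the probability, for the model with frozen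
      switching point, of visiting \<open>x\<^sub>1\<close> before \<open>n + 1\<close> when
      starting from \<open>n\<close>.\<close>
    define A \<delta> where "A = scale_fun b c (n + 1) - scale_fun b c x\<^sub>1" and "\<delta> = scale_fun b c (n + 1) - scale_fun b c n"
    have main: "survival N x\<^sub>1 (n + 1) * A \<le> survival N x\<^sub>1 n * (A - \<delta>)"
      using survival_upper[OF levels n(3) c_def] by (simp add: A_def \<delta>_def)
    have "2 * b * \<gamma> n \<le> ln (ln n) + ?L n" using n(1) b by (simp add: field_simps)
    then have "exp (2 * b * \<gamma> n) \<le> exp (ln (ln n) + ?L n)" by simp
    also have "\<dots> = ln n * ln (ln n)" using n v by (simp add: exp_add)
    finally have "1 / (ln n * ln (ln n)) \<le> exp (- (2 * b * \<gamma> n))"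
      using n v by (simp add: exp_minus field_simps)
    then have "2 * \<kappa> * (1 / (ln n * ln (ln n))) \<le> 2 * \<kappa> * exp (- (2 * b * \<gamma> n))"
      using \<kappa> by (intro mult_left_mono) auto
    also have "\<dots> = \<delta>"
    proof -
      have "2 * b * (n - c) = 2 * b * \<gamma> n + 2 * b" by (simp add: c_def algebra_simps)
      then have "\<delta> = exp (- (2 * b * \<gamma> n + 2 * b)) * ((1 - exp (- (2 * b))) / (2 * b))"
        unfolding \<delta>_def using exp_branch_diff[OF b, of "n + 1" c n] cn by (simp add: scale_fun_upper_half[OF b])
      also have "exp (- (2 * b * \<gamma> n + 2 * b)) = exp (- (2 * b * \<gamma> n)) * exp (- (2 * b))"
        by (simp add: exp_add[symmetric])
      finally show ?thesis by (simp add: \<kappa>_def)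
    qed
    finally have \<delta>: "2 * \<kappa> * (1 / (ln n * ln (ln n))) \<le> \<delta>" .
    moreover have "0 < 2 * \<kappa> * (1 / (ln n * ln (ln n)))" using \<kappa> n v by simp
    ultimately have \<delta>_pos: "0 < \<delta>" by linarith
    have A_ge: "\<delta> \<le> A" using scale_fun_mono[OF b, of x\<^sub>1 n c] levels n by (simp add: A_def \<delta>_def)
    have A_pos: "0 < A" using A_ge \<delta>_pos by linarith
    have "A \<le> n + 1 - x\<^sub>1" unfolding A_def using levels n by (intro scale_fun_diff_le[OF b]) auto
    then have A_le: "A \<le> 2 * n" using n by simp
    have "\<kappa> * (?L (n + 1) - ?L n) \<le> \<kappa> * (1 / (n * ln n * ln (ln n)))"
      using triple_ln_increment[OF n(4,5)] \<kappa> by (intro mult_left_mono) auto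
    also have "\<dots> = 2 * \<kappa> * (1 / (ln n * ln (ln n))) / (2 * n)" by simp
    also have "\<dots> \<le> \<delta> / (2 * n)" using \<delta> n by (intro divide_right_mono) auto
    also have "\<dots> \<le> \<delta> / A" using A_le A_pos \<delta>_pos n by (intro divide_left_mono) auto
    finally have le: "\<kappa> * (?L (n + 1) - ?L n) \<le> \<delta> / A" .
    have "survival N x\<^sub>1 (n + 1) \<le> survival N x\<^sub>1 n * (1 - \<delta> / A)"
      using main A_pos by (simp add: field_simps)
    also have "\<dots> \<le> survival N x\<^sub>1 n * exp (- (\<kappa> * (?L (n + 1) - ?L n)))"
      using exp_ge_add_one_self[of "- (\<kappa> * (?L (n + 1) - ?L n))"] le survival_nonneg
      by (intro mult_left_mono) auto
    finally have "survival N x\<^sub>1 (n + 1) * exp (\<kappa> * ?L (n + 1))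
        \<le> survival N x\<^sub>1 n * exp (- (\<kappa> * (?L (n + 1) - ?L n))) * exp (\<kappa> * ?L (n + 1))"
      by (rule mult_right_mono) simp
    also have "\<dots> = survival N x\<^sub>1 n * exp (\<kappa> * ?L n)"
      by (simp add: mult.assoc exp_add[symmetric] algebra_simps)
    finally show ?thesis by (simp add: n_def add.commute)
  qed
  define C where "C = survival N x\<^sub>1 (real m0) * exp (\<kappa> * ?L (real m0))"
  have bound: "survival N x\<^sub>1 (real m) \<le> C * exp (- (\<kappa> * ?L (real m)))" if "m0 \<le> m" for m
  proof -
    have "survival N x\<^sub>1 (real m) * exp (\<kappa> * ?L (real m)) \<le> C"
      using that
    proof (induction rule: dec_induct)
      case (step m)
      then show ?case using decrease[OF step.hyps(1)] by linarith
    qed (simp add: C_def)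
    then show ?thesis by (simp add: exp_minus field_simps)
  qed
  have "LIM m sequentially. \<kappa> * ?L (real m) :> at_top"
    by (intro filterlim_tendsto_pos_mult_at_top[OF tendsto_const \<kappa>] filterlim_compose[OF ln_at_top] filterlim_real_sequentially)
  then have "LIM m sequentially. - (\<kappa> * ?L (real m)) :> at_bot"
    by (simp add: filterlim_uminus_at_bot)
  then have "(\<lambda>m. exp (- (\<kappa> * ?L (real m)))) \<longlonglongrightarrow> 0"
    by (rule filterlim_compose[OF exp_at_bot])
  then have "(\<lambda>m. C * exp (- (\<kappa> * ?L (real m)))) \<longlonglongrightarrow> 0"
    by (rule tendsto_mult_right_zero)
  then show ?thesis
    by (rule tendsto_0_le[where K=1]) (use bound survival_nonneg in \<open>auto intro!: eventually_sequentiallyI[of m0] order_trans[OF _ abs_ge_self]\<close>)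
qed

lemma recurrent:
  assumes \<gamma>: "\<forall>\<^sub>F x in at_top. \<gamma> x \<le> 1 / (2 * b) * (ln ^^ 2) x + 1 / (2 * b) * (ln ^^ 3) x"
    and pos: "\<And>x. 0 \<le> x \<Longrightarrow> 0 < \<gamma> x"
  shows "AE \<omega> in M. \<forall>T. \<exists>t\<ge>max 0 T. X t \<omega> = x\<^sub>1"
proof -
  have "AE \<omega> in M. x\<^sub>0 < real N \<longrightarrow> x\<^sub>1 < real N \<longrightarrow> (\<exists>t\<ge>0. crossed (\<lambda>s. X s \<omega>) N x\<^sub>1 t)" for N :: nat
  proof (cases "x\<^sub>0 < real N \<and> x\<^sub>1 < real N")
    case True
    let ?V = "\<lambda>m. {\<omega> \<in> space M. survives (\<lambda>s. X s \<omega>) N x\<^sub>1 (real m)}"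
    have V: "?V m \<in> sets M" for m by (rule measurable_survives[OF adapted_X])
    \<comment> \<open>Every level is attained, so a path outside this event, failing some phase,
      must have crossed from \<open>N\<close> to \<open>x\<^sub>1\<close>.\<close>
    let ?E = "\<Inter>m\<in>{N..}. ?V m"
    have E: "?E \<in> sets M" using V by (intro sets.countable_INT') auto
    have "prob ?E \<le> survival N x\<^sub>1 (real m)" if "N \<le> m" for m
      unfolding survival_def using that V by (intro finite_measure_mono) auto
    moreover have "(\<lambda>m. survival N x\<^sub>1 (real m)) \<longlonglongrightarrow> 0" using survival_tendsto_0[OF \<gamma> pos] True by blast
    ultimately have "prob ?E \<le> 0" by (intro LIMSEQ_le_const[of _ 0]) auto
    then have "prob ?E = 0" using measure_nonneg[of M ?E] by linarith
    then have "AE \<omega> in M. \<omega> \<notin> ?E"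
      using E by (intro AE_not_in) (auto simp: null_sets_def emeasure_eq_measure)
    then show ?thesis using AE_space X_start continuous_paths_X X_unbounded
    proof eventually_elim
      case (elim \<omega>)
      let ?x = "\<lambda>s. X s \<omega>"
      have unb: "\<exists>u\<ge>0. r \<le> ?x u" for r using elim(5) by blast
      have lt: "?x 0 < real N" "x\<^sub>1 < real N" using True elim(3) by auto
      obtain m where m: "N \<le> m" "\<not> survives ?x N x\<^sub>1 (real m)" using elim(1,2) by auto
      obtain u where u: "0 \<le> u" "real m \<le> ?x u" using unb by blast
      have "reached ?x m u" unfolding reached_iff[OF elim(4) u(1)] using u by auto
      then show ?case
        using m phase_interval(4)[OF elim(4) unb lt, of "real m"] u(1) by auto
    qed
  qed auto
  then have "AE \<omega> in M. \<forall>N::nat. x\<^sub>0 < real N \<longrightarrow> x\<^sub>1 < real N \<longrightarrow> (\<exists>t\<ge>0. crossed (\<lambda>s. X s \<omega>) N x\<^sub>1 t)"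
    by (simp add: AE_all_countable)
  then show ?thesis using X_start continuous_paths_X
  proof eventually_elim
    case (elim \<omega>)
    show ?case
      by (intro allI recurrent_path[OF elim(3)]) (use elim(1,2) in auto)
  qed
qed

text \<open>With the marker at the current level, survival starts at 1, so the failure probability
  of the phase is at most the model probability \<open>\<delta> / A\<close>.\<close>

lemma survival_step_summable:
  assumes \<gamma>: "\<forall>\<^sub>F x in at_top. \<gamma> x \<ge> 1 / (2 * b) * (ln ^^ 2) x + k / (2 * b) * (ln ^^ 3) x" and k: "1 < k"
    and gap: "filterlim (\<lambda>x. x - \<gamma> x) at_top at_top"
  shows "summable (\<lambda>m. 1 - survival (real m) x\<^sub>1 (real m + 1))"
proof -
  let ?w = "\<lambda>x::real. ln (ln x) powr (1 - k)"
  \<comment> \<open>The first summand telescopes; the geometric one covers the levels at which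
    \<open>\<gamma>\<close> exceeds half its argument.\<close>
  let ?g = "\<lambda>m::nat. 4 * exp (4 * b) * ((?w (real m) - ?w (real (Suc m))) / (k - 1) + exp (- b) ^ Suc m)"
  have ln_ln: "filterlim (\<lambda>x::real. ln (ln x)) at_top at_top"
    by (rule filterlim_compose[OF ln_at_top ln_at_top])
  have "\<forall>\<^sub>F x in at_top. 1 / (2 * b) * (ln ^^ 2) x + k / (2 * b) * (ln ^^ 3) x \<le> \<gamma> x \<and> x\<^sub>1 \<le> x - \<gamma> x"
    using \<gamma> gap by (intro eventually_conj) (auto simp: filterlim_at_top)
  then have ev: "\<forall>\<^sub>F x in at_top. 1 / (2 * b) * (ln ^^ 2) (x + 1) + k / (2 * b) * (ln ^^ 3) (x + 1) \<le> \<gamma> (x + 1)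
      \<and> x\<^sub>1 \<le> (x + 1) - \<gamma> (x + 1)"
  proof (rule eventually_compose_filterlim)
    show "filterlim (\<lambda>x::real. x + 1) at_top at_top"
      using filterlim_tendsto_add_at_top[OF tendsto_const filterlim_ident, of "1::real"] by (simp add: add.commute)
  qed
  have "\<forall>\<^sub>F x in at_top. (1 / (2 * b) * (ln ^^ 2) (x + 1) + k / (2 * b) * (ln ^^ 3) (x + 1) \<le> \<gamma> (x + 1)
      \<and> x\<^sub>1 \<le> (x + 1) - \<gamma> (x + 1)) \<and> max (max x\<^sub>0 x\<^sub>1) (4 * x\<^sub>1) < x \<and> 1 < x \<and> 1 < ln x \<and> max 1 (2 * b) < ln (ln x)"
    by (rule eventually_conj[OF ev]) (intro eventually_conj eventually_gt_at_top
        filterlim_at_top_dense[THEN iffD1, rule_format, OF ln_at_top]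
        filterlim_at_top_dense[THEN iffD1, rule_format, OF ln_ln])
  then have "\<forall>\<^sub>F m in sequentially. (1 / (2 * b) * (ln ^^ 2) (real m + 1) + k / (2 * b) * (ln ^^ 3) (real m + 1) \<le> \<gamma> (real m + 1)
      \<and> x\<^sub>1 \<le> (real m + 1) - \<gamma> (real m + 1)) \<and> max (max x\<^sub>0 x\<^sub>1) (4 * x\<^sub>1) < real m \<and> 1 < real m \<and> 1 < ln (real m) \<and> max 1 (2 * b) < ln (ln (real m))"
    by (rule eventually_compose_filterlim[OF _ filterlim_real_sequentially])
  then have "\<forall>\<^sub>F m in sequentially. norm (1 - survival (real m) x\<^sub>1 (real m + 1)) \<le> ?g m"
  proof eventually_elim
    case (elim m)
    define n where "n = real m"
    have n: "1 / (2 * b) * ln (ln (n + 1)) + k / (2 * b) * ln (ln (ln (n + 1))) \<le> \<gamma> (n + 1)"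
      "x\<^sub>1 \<le> (n + 1) - \<gamma> (n + 1)" "x\<^sub>0 < n" "x\<^sub>1 < n" "4 * x\<^sub>1 < n" "1 < n" "1 < ln n" "1 < ln (ln n)" "2 * b < ln (ln n)"
      using elim unfolding n_def iterated_ln by auto
    have ln_less: "ln n \<le> ln (n + 1)" using n by simp
    have ln_gt: "1 < ln (n + 1)" using n(7) ln_less by linarith
    then have v: "ln (ln n) \<le> ln (ln (n + 1))" using n by simp
    define c where "c = (n + 1) - \<gamma> (n + 1) + 1"
    define A \<delta> where "A = scale_fun b c (n + 1) - scale_fun b c x\<^sub>1" and "\<delta> = scale_fun b c (n + 1) - scale_fun b c n"
    have main: "A - \<delta> \<le> survival n x\<^sub>1 (n + 1) * A"
      using survival_lower[OF n(3,4) order_refl c_def] survival_start[OF n(3,4)] by (simp add: A_def \<delta>_def)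
    have \<gamma>v: "ln (ln (n + 1)) + k * ln (ln (ln (n + 1))) \<le> 2 * b * \<gamma> (n + 1)"
      using n(1) b by (simp add: field_simps)
    have "1 \<le> ln (ln (n + 1))" using n v by linarith
    then have "0 \<le> k * ln (ln (ln (n + 1)))" using k by simp
    \<comment> \<open>The requirement \<open>2 * b < ln (ln n)\<close> serves this bound. It puts
      \<open>c\<close> at or below \<open>n + 1\<close>, so that \<open>A\<close> contains the whole
      linear piece \<open>c - x\<^sub>1\<close>.\<close>
    then have "2 * b \<le> 2 * b * \<gamma> (n + 1)" using \<gamma>v n(9) v by linarith
    then have \<gamma>1: "1 \<le> \<gamma> (n + 1)" using b by simp
    have "\<delta> \<le> scale_density b c n * 1"
      using scale_fun_tangent[OF b, of c "n + 1" n] by (simp add: \<delta>_def)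
    also have "\<dots> \<le> exp (- (2 * b * (n - c)))" using scale_density_le[OF b] by simp
    \<comment> \<open>The distance \<open>n - c\<close> is \<open>\<gamma> (n + 1) - 2\<close>: one
      unit is the displacement of the switching point, the other comes from evaluating
      \<open>\<gamma>\<close> at the upper end of the phase.\<close>
    also have "- (2 * b * (n - c)) = 4 * b + - (2 * b * \<gamma> (n + 1))" by (simp add: c_def algebra_simps)
    finally have \<delta>: "\<delta> \<le> exp (4 * b) * exp (- (2 * b * \<gamma> (n + 1)))" by (simp add: exp_add[symmetric])
    have \<delta>_nn: "0 \<le> \<delta>" using scale_fun_mono[OF b, of n "n + 1" c] by (simp add: \<delta>_def)
    have "c - x\<^sub>1 = scale_fun b c c - scale_fun b c x\<^sub>1" using n(2) by (simp add: scale_fun_def c_def)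
    also have "\<dots> \<le> A" unfolding A_def using scale_fun_mono[OF b, of c "n + 1" c] \<gamma>1 by (simp add: c_def)
    finally have A: "c - x\<^sub>1 \<le> A" .
    then have A1: "1 \<le> A" using n(2) by (simp add: c_def)
    have "1 - survival n x\<^sub>1 (n + 1) \<le> \<delta> / A" using main A1 by (simp add: field_simps)
    also have "\<dots> \<le> 4 * exp (4 * b) * (exp (- (2 * b * \<gamma> (n + 1))) / (n + 1) + exp (- (b * (n + 1))))"
    \<comment> \<open>In the first case \<open>A\<close> is of order \<open>n\<close>. In the second
      only \<open>A \<ge> 1\<close> is available, but \<open>\<delta>\<close> is then exponentially
      small in \<open>n\<close>.\<close>
    proof (cases "\<gamma> (n + 1) \<le> (n + 1) / 2")
      case True
      then have A4: "(n + 1) / 4 \<le> A" using A n(5) by (simp add: c_def)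
      have "\<delta> / A \<le> \<delta> / ((n + 1) / 4)" using A4 \<delta>_nn n A1 by (intro divide_left_mono) auto
      also have "\<dots> \<le> exp (4 * b) * exp (- (2 * b * \<gamma> (n + 1))) / ((n + 1) / 4)"
        using \<delta> n by (intro divide_right_mono) auto
      also have "\<dots> = 4 * exp (4 * b) * (exp (- (2 * b * \<gamma> (n + 1))) / (n + 1))" by simp
      also have "\<dots> \<le> 4 * exp (4 * b) * (exp (- (2 * b * \<gamma> (n + 1))) / (n + 1) + exp (- (b * (n + 1))))"
        by (intro mult_left_mono) auto
      finally show ?thesis .
    next
      case False
      then have "b * (n + 1) \<le> b * (2 * \<gamma> (n + 1))" using b by (intro mult_left_mono) auto
      then have e: "exp (- (2 * b * \<gamma> (n + 1))) \<le> exp (- (b * (n + 1)))" by simp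
      have "\<delta> / A \<le> \<delta>" using A1 \<delta>_nn by (simp add: divide_le_eq mult_le_cancel_left1)
      also have "\<dots> \<le> exp (4 * b) * exp (- (b * (n + 1)))"
        by (rule order_trans[OF \<delta>]) (use e in simp)
      also have "\<dots> \<le> 4 * exp (4 * b) * exp (- (b * (n + 1)))" by simp
      also have "\<dots> \<le> 4 * exp (4 * b) * (exp (- (2 * b * \<gamma> (n + 1))) / (n + 1) + exp (- (b * (n + 1))))"
        using n by (intro mult_left_mono) auto
      finally show ?thesis .
    qed
    also have "\<dots> \<le> 4 * exp (4 * b) * ((?w n - ?w (n + 1)) / (k - 1) + exp (- b) ^ Suc m)"
    proof (intro mult_left_mono add_mono)
      have eq: "ln (n + 1) * ln (ln (n + 1)) powr k = exp (ln (ln (n + 1)) + k * ln (ln (ln (n + 1))))"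
        using n v ln_gt by (simp add: exp_add powr_def)
      have "ln (n + 1) * ln (ln (n + 1)) powr k \<le> exp (2 * b * \<gamma> (n + 1))"
        unfolding eq using \<gamma>v by simp
      moreover have "0 < ln (n + 1) * ln (ln (n + 1)) powr k" unfolding eq by simp
      ultimately have "exp (- (2 * b * \<gamma> (n + 1))) \<le> 1 / (ln (n + 1) * ln (ln (n + 1)) powr k)"
        unfolding exp_minus inverse_eq_divide[symmetric] by (rule le_imp_inverse_le)
      then have "exp (- (2 * b * \<gamma> (n + 1))) / (n + 1) \<le> 1 / (ln (n + 1) * ln (ln (n + 1)) powr k) / (n + 1)"
        using n by (intro divide_right_mono) auto
      also have "\<dots> = 1 / ((n + 1) * ln (n + 1) * ln (ln (n + 1)) powr k)" by (simp add: mult_ac)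
      also have "\<dots> \<le> (?w n - ?w (n + 1)) / (k - 1)"
        by (rule double_ln_powr_increment[OF n(6,7) k])
      finally show "exp (- (2 * b * \<gamma> (n + 1))) / (n + 1) \<le> (?w n - ?w (n + 1)) / (k - 1)" .
      have "exp (- (b * (n + 1))) = exp (- b) ^ Suc m"
        unfolding exp_of_nat_mult[symmetric] by (simp add: n_def algebra_simps)
      then show "exp (- (b * (n + 1))) \<le> exp (- b) ^ Suc m" by simp
    qed simp
    finally show ?case
      by (simp add: n_def survival_def add.commute)
  qed
  moreover have "summable ?g"
  proof (intro summable_mult summable_add summable_divide)
    have "(\<lambda>m. ?w (real m)) \<longlonglongrightarrow> 0"
      by (rule tendsto_neg_powr) (use k filterlim_compose[OF ln_ln filterlim_real_sequentially] in auto)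
    then show "summable (\<lambda>m. ?w (real m) - ?w (real (Suc m)))" by (rule telescope_summable')
    have "summable (\<lambda>m. exp (- b) ^ m)" using b by (intro summable_geometric) simp
    then show "summable (\<lambda>m. exp (- b) ^ Suc m)" by (subst summable_Suc_iff)
  qed
  ultimately show ?thesis by (rule summable_comparison_test_ev)
qed

lemma transient:
  assumes \<gamma>: "\<forall>\<^sub>F x in at_top. \<gamma> x \<ge> 1 / (2 * b) * (ln ^^ 2) x + k / (2 * b) * (ln ^^ 3) x" and k: "1 < k"
    and gap: "filterlim (\<lambda>x. x - \<gamma> x) at_top at_top"
  shows "AE \<omega> in M. filterlim (\<lambda>t. X t \<omega>) at_top at_top"
proof -
  have "AE \<omega> in M. \<exists>T. \<forall>t\<ge>T. real c < X t \<omega>" for c :: nat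
  proof -
    let ?V = "\<lambda>m::nat. {\<omega> \<in> space M. survives (\<lambda>s. X s \<omega>) (real m) (real c) (real m + 1)}"
    have V: "?V m \<in> sets M" for m by (rule measurable_survives[OF adapted_X])
    have "AE \<omega> in M. eventually (\<lambda>m. \<omega> \<in> space M - (space M - ?V m)) sequentially"
    proof (rule borel_cantelli_AE1)
      have "prob (space M - ?V m) = 1 - survival (real m) c (real m + 1)" for m
        unfolding survival_def by (rule prob_compl[OF V])
      then show "summable (\<lambda>m. prob (space M - ?V m))"
        using survival_step_summable[OF \<gamma> k gap, of "real c"] by simp
    qed (use V in \<open>auto simp: less_top[symmetric]\<close>)
    then show ?thesis using continuous_paths_X X_unbounded
    proof eventually_elim
      case (elim \<omega>)
      then obtain m0 where m0: "\<And>m. m0 \<le> m \<Longrightarrow> survives (\<lambda>s. X s \<omega>) (real m) c (real m + 1)"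
        by (auto simp: eventually_sequentially)
      have unb: "\<exists>u\<ge>0. r \<le> X u \<omega>" for r using elim(3) by blast
      show ?case
        by (rule transient_path[OF elim(2) unb, of m0]) (use m0 in \<open>simp add: add.commute\<close>)
    qed
  qed
  then have "AE \<omega> in M. \<forall>c::nat. \<exists>T. \<forall>t\<ge>T. real c < X t \<omega>" by (simp add: AE_all_countable)
  then show ?thesis
  proof eventually_elim
    case (elim \<omega>)
    show ?case
      unfolding filterlim_at_top eventually_at_top_linorder
    proof
      fix Z :: real
      obtain T where "\<And>t. T \<le> t \<Longrightarrow> real (nat \<lceil>Z\<rceil>) < X t \<omega>" using elim by blast
      then have "Z \<le> X t \<omega>" if "T \<le> t" for t
        using that real_nat_ceiling_ge[of Z] by (meson less_le_trans less_imp_le order_trans)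
      then show "\<exists>T. \<forall>t\<ge>T. Z \<le> X t \<omega>" by blast
    qed
  qed
qed

end

theorem theorem4:
  fixes b :: real and \<gamma> \<gamma>' :: "real \<Rightarrow> real"
  assumes "b > 0"
    and "\<And>x. x \<ge> 0 \<Longrightarrow> \<gamma> x > 0"
    and "continuous_on {0..} \<gamma>"
    and "\<And>x. x \<ge> 0 \<Longrightarrow> (\<gamma> has_real_derivative \<gamma>' x) (at x within {0..})"
    and "\<And>x. x \<ge> 0 \<Longrightarrow> \<gamma>' x < 1"
    and "filterlim (\<lambda>x. x - \<gamma> x) at_top at_top"
  shows "((\<forall>\<^sub>F x in at_top. \<gamma> x \<le> 1 / (2 * b) * (ln ^^ 2) x + 1 / (2 * b) * (ln ^^ 3) x)
      \<longrightarrow> two_phase_recurrent TYPE('w) (\<lambda>_. b) (\<lambda>_. 0) \<gamma>)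
    \<and> ((\<exists>k>1. \<forall>\<^sub>F x in at_top. \<gamma> x \<ge> 1 / (2 * b) * (ln ^^ 2) x + k / (2 * b) * (ln ^^ 3) x)
      \<longrightarrow> two_phase_transient TYPE('w) (\<lambda>_. b) (\<lambda>_. 0) \<gamma>)"
proof -
  have mono: "x - \<gamma> x \<le> y - \<gamma> y" if xy: "0 \<le> x" "x \<le> y" for x y
  proof (cases "x = y")
    case False
    have "\<exists>z\<in>{x<..<y}. \<gamma> y - \<gamma> x = \<gamma>' z * (y - x)"
    proof (rule mvt_simple)
      fix z assume "x \<le> z" "z \<le> y"
      then show "(\<gamma> has_derivative (\<lambda>h. \<gamma>' z * h)) (at z within {x..y})"
        using assms(4)[of z] xy unfolding has_field_derivative_def
        by (auto intro: has_derivative_subset)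
    qed (use xy False in simp)
    then obtain z where z: "x < z" "z < y" "\<gamma> y - \<gamma> x = \<gamma>' z * (y - x)" by auto
    have "\<gamma> y - \<gamma> x \<le> 1 * (y - x)"
      unfolding z(3) using assms(5)[of z] z xy by (intro mult_right_mono) auto
    then show ?thesis by simp
  qed simp
  have diffusion: "switched_drift_diffusion M F W b \<gamma> x\<^sub>0 X"
    if "0 \<le> x\<^sub>0" "two_phase_diffusion M F W (\<lambda>_. b) (\<lambda>_. 0) \<gamma> x\<^sub>0 X" for M :: "'w measure" and F W x\<^sub>0 X
    by (intro switched_drift_diffusion.intro switched_drift_diffusion_axioms.intro that assms(1) mono)
  show ?thesis
    unfolding two_phase_recurrent_def two_phase_transient_def
    using switched_drift_diffusion.recurrent[OF diffusion _ assms(2)]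
      switched_drift_diffusion.transient[OF diffusion _ _ assms(6)]
    by blast
qed

end
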